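(* Let $0<R<1$ and $\phi\in L^\infty(\partial A)$. The Hankel operator $H_\phi:H^2(\partial A)\to H^2(\partial A)^{\perp}$ is compact if and only if both functions $\phi_C$ and $\phi_{C_0}$ belong to $H^\infty+C$.
   Context: $A=\{z\in\mathbb{C}:R<|z|<1\}$, with boundary $\partial A=C\cup C_0$, where $C=\{|z|=1\}$ and $C_0=\{|z|=R\}$. $\sigma$ is the measure on $\partial A$ which is normalized angular Lebesgue measure $\frac{dt}{2\pi}$ on each of the two circles. $L^2(\partial A)=L^2(\partial A,\sigma)$ has inner product $$\langle f,g\rangle_{\partial A}=\frac1{2\pi}\int_0^{2\pi}f(e^{it})\overline{g(e^{it})}\,dt+\frac1{2\pi}\int_0^{2\pi}f(Re^{it})\overline{g(Re^{it})}\,dt,$$ and $L^\infty(\partial A)$ is the space of $\sigma$-essentially bounded functions. The Hardy space $H^2(\partial A)$ is the closure in $L^2(\partial A)$ of the rational functions with no poles in $\overline{A}$; equivalently, it has orthonormal basis $e_n(z)=\frac{1}{\sqrt{1+R^{2n}}}z^n$, $n\in\mathbb{Z}$. $H^2(\partial A)^\perp$ is its orthogonal complement in $L^2(\partial A)$, and $P_R$ is the orthogonal projection of $L^2(\partial A)$ onto $H^2(\partial A)$. For $\phi\in L^\infty(\partial A)$ the Hankel operator is $H_\phi f=(I-P_R)(\phi f)$, $f\in H^2(\partial A)$. Let $\mathbb{T}$ be the unit circle. To $\phi\in L^\infty(\partial A)$ are associated the functions $\phi_C,\phi_{C_0}\in L^\infty(\mathbb{T})$ defined by $\phi_C(z)=\phi(z)$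 and $\phi_{C_0}(z)=\phi(R/z)$ for $z\in\mathbb{T}$. Finally, $H^\infty+C=\{f+g: f\in H^\infty(\mathbb{T}),\ g\in C(\mathbb{T})\}$, where $H^\infty(\mathbb{T})$ is the space of functions in $L^\infty(\mathbb{T})$ whose Fourier coefficients of negative index vanish and $C(\mathbb{T})$ is the space of continuous functions on $\mathbb{T}$. *)

theory Defs
  imports "HOL-Probability.Probability" "HOL-Computational_Algebra.Polynomial"
begin

section \<open>The spaces $L^2(\mu)$ and $L^\infty(\mu)$\<close>

text \<open>
  Elements of these spaces are represented by measurable functions, not by equivalence classes.
  All notions below respect almost-everywhere equality, and only the values on the space of the
  measure matter.
\<close>

definition L2 :: "'a measure \<Rightarrow> ('a \<Rightarrow> complex) set" where
  "L2 M = {f \<in> borel_measurable M. integrable M (\<lambda>x. (norm (f x))\<^sup>2)}"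

definition L2_inner :: "'a measure \<Rightarrow> ('a \<Rightarrow> complex) \<Rightarrow> ('a \<Rightarrow> complex) \<Rightarrow> complex" where
  "L2_inner M f g = (\<integral>x. f x * cnj (g x) \<partial>M)"

definition L2_norm :: "'a measure \<Rightarrow> ('a \<Rightarrow> complex) \<Rightarrow> real" where
  "L2_norm M f = sqrt (\<integral>x. (norm (f x))\<^sup>2 \<partial>M)"

definition Linfty :: "'a measure \<Rightarrow> ('a \<Rightarrow> complex) set" where
  "Linfty M = {f \<in> borel_measurable M. \<exists>B. AE x in M. norm (f x) \<le> B}"

definition L2_closure :: "'a measure \<Rightarrow> ('a \<Rightarrow> complex) set \<Rightarrow> ('a \<Rightarrow> complex) set" where
  "L2_closure M S = {f \<in> L2 M. \<forall>\<epsilon>>0. \<exists>g\<in>S. L2_norm M (\<lambda>x. f x - g x) < \<epsilon>}"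

definition L2_orth :: "'a measure \<Rightarrow> ('a \<Rightarrow> complex) set \<Rightarrow> ('a \<Rightarrow> complex) set" where
  "L2_orth M S = {g \<in> L2 M. \<forall>f\<in>S. L2_inner M g f = 0}"

text \<open>The orthogonal projection onto a closed subspace is determined only almost everywhere;
  the choice operator picks some representative.\<close>

definition L2_proj :: "'a measure \<Rightarrow> ('a \<Rightarrow> complex) set \<Rightarrow> ('a \<Rightarrow> complex) \<Rightarrow> ('a \<Rightarrow> complex)" where
  "L2_proj M S f = (SOME g. g \<in> S \<and> (\<lambda>x. f x - g x) \<in> L2_orth M S)"

text \<open>Compactness of an operator from \<open>V\<close> to \<open>W\<close>: every bounded sequence in \<open>V\<close> has a
  subsequence whose images converge in \<open>W\<close> with respect to the $L^2$-norm.\<close>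

definition compact_operator ::
  "'a measure \<Rightarrow> ('a \<Rightarrow> complex) set \<Rightarrow> ('a \<Rightarrow> complex) set \<Rightarrow>
    (('a \<Rightarrow> complex) \<Rightarrow> ('a \<Rightarrow> complex)) \<Rightarrow> bool" where
  "compact_operator M V W T \<longleftrightarrow>
     (\<forall>f\<in>V. T f \<in> W) \<and>
     (\<forall>F :: nat \<Rightarrow> 'a \<Rightarrow> complex.
        (\<forall>n. F n \<in> V) \<and> (\<exists>B. \<forall>n. L2_norm M (F n) \<le> B) \<longrightarrow>
        (\<exists>g\<in>W. \<exists>s :: nat \<Rightarrow> nat. strict_mono s \<and>
           (\<lambda>n. L2_norm M (\<lambda>x. T (F (s n)) x - g x)) \<longlonglongrightarrow> 0))"


section \<open>The annulus, its Hardy space and Hankel operators\<close>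

definition annulus :: "real \<Rightarrow> complex set" where
  "annulus R = {z. R < norm z \<and> norm z < 1}"

definition annulus_boundary :: "real \<Rightarrow> complex set" where
  "annulus_boundary R = sphere 0 1 \<union> sphere 0 R"

text \<open>The index \<open>r\<close> below selects one of the two circles; each of them carries total mass one
  (see \<open>L2_inner_annulus\<close>).\<close>

definition annulus_measure :: "real \<Rightarrow> complex measure" where
  "annulus_measure R =
     distr (count_space {1, R} \<Otimes>\<^sub>M uniform_measure lborel {0..2*pi})
       (restrict_space borel (annulus_boundary R))
       (\<lambda>(r, t). of_real r * cis t)"

definition rational_functions_on :: "complex set \<Rightarrow> (complex \<Rightarrow> complex) set" where
  "rational_functions_on K =
     {f. \<exists>p q :: complex poly. (\<forall>z\<in>K. poly q z \<noteq> 0) \<and> f = (\<lambda>z. poly p z / poly q z)}"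

definition H2 :: "real \<Rightarrow> (complex \<Rightarrow> complex) set" where
  "H2 R = L2_closure (annulus_measure R) (rational_functions_on (closure (annulus R)))"

definition H2_perp :: "real \<Rightarrow> (complex \<Rightarrow> complex) set" where
  "H2_perp R = L2_orth (annulus_measure R) (H2 R)"

definition P_H2 :: "real \<Rightarrow> (complex \<Rightarrow> complex) \<Rightarrow> (complex \<Rightarrow> complex)" where
  "P_H2 R = L2_proj (annulus_measure R) (H2 R)"

definition hankel :: "real \<Rightarrow> (complex \<Rightarrow> complex) \<Rightarrow> (complex \<Rightarrow> complex) \<Rightarrow> (complex \<Rightarrow> complex)" where
  "hankel R \<phi> f = (\<lambda>z. \<phi> z * f z - P_H2 R (\<lambda>w. \<phi> w * f w) z)"


section \<open>The space $H^\infty + C$ on the unit circle\<close>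

definition circle_measure :: "complex measure" where
  "circle_measure =
     distr (uniform_measure lborel {0..2*pi}) (restrict_space borel (sphere 0 1)) cis"

definition fourier_coeff :: "(complex \<Rightarrow> complex) \<Rightarrow> int \<Rightarrow> complex" where
  "fourier_coeff f n = (\<integral>z. f z * cnj (z powi n) \<partial>circle_measure)"

definition Hinfty :: "(complex \<Rightarrow> complex) set" where
  "Hinfty = {f \<in> Linfty circle_measure. \<forall>n<0. fourier_coeff f n = 0}"

definition Hinfty_plus_C :: "(complex \<Rightarrow> complex) set" where
  "Hinfty_plus_C =
     {h \<in> Linfty circle_measure. \<exists>f\<in>Hinfty. \<exists>g. continuous_on (sphere 0 1) g \<and>
        (AE z in circle_measure. h z = f z + g z)}"

definition symbol_C :: "(complex \<Rightarrow> complex) \<Rightarrow> (complex \<Rightarrow> complex)" where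
  "symbol_C \<phi> = (\<lambda>z\<in>sphere 0 1. \<phi> z)"

definition symbol_C0 :: "real \<Rightarrow> (complex \<Rightarrow> complex) \<Rightarrow> (complex \<Rightarrow> complex)" where
  "symbol_C0 R \<phi> = (\<lambda>z\<in>sphere 0 1. \<phi> (of_real R / z))"


section \<open>The inner product on the boundary of the annulus\<close>

lemma integral_uniform_angle:
  fixes h :: "real \<Rightarrow> complex"
  assumes [measurable]: "h \<in> borel_measurable borel"
  shows "(\<integral>t. h t \<partial>uniform_measure lborel {0..2*pi}) =
         1 / (2*pi) * (LBINT t:{0..2*pi}. h t)"
proof -
  have "uniform_measure lborel {0..2*pi} =
     density lborel (\<lambda>t. ennreal (indicator {0..2*pi} t / (2*pi)))"
    unfolding uniform_measure_def
    by (intro density_cong AE_I2)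
       (auto simp: indicator_def divide_ennreal ennreal_1[symmetric] simp del: ennreal_1)
  then have "(\<integral>t. h t \<partial>uniform_measure lborel {0..2*pi}) =
     (\<integral>t. (indicator {0..2*pi} t / (2*pi)) *\<^sub>R h t \<partial>lborel)"
    by (simp add: integral_density)
  also have "\<dots> = (\<integral>t. (1/(2*pi)) *\<^sub>R (indicator {0..2*pi} t *\<^sub>R h t) \<partial>lborel)"
    by (intro Bochner_Integration.integral_cong) auto
  also have "\<dots> = (1/(2*pi)) *\<^sub>R (LBINT t:{0..2*pi}. h t)"
    unfolding set_lebesgue_integral_def by (rule integral_scaleR_right)
  finally show ?thesis by (simp add: scaleR_conv_of_real)
qed

lemma sets_uniform_angle [measurable_cong]: "sets (uniform_measure lborel {0..2*pi}) = sets borel"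
  by simp

lemma annulus_param_measurable [measurable]:
  "(\<lambda>(r, t). of_real r * cis t) \<in>
     measurable (count_space {1, R} \<Otimes>\<^sub>M uniform_measure lborel {0..2*pi})
       (restrict_space borel (annulus_boundary R))"
  if "0 < R"
proof (rule measurable_restrict_space2)
  show "(\<lambda>(r, t). of_real r * cis t) \<in> space (count_space {1, R} \<Otimes>\<^sub>M uniform_measure lborel {0..2*pi})
      \<rightarrow> annulus_boundary R"
    using that by (auto simp: space_pair_measure annulus_boundary_def norm_mult)
  have [measurable]: "cis \<in> borel_measurable borel"
    by (intro borel_measurable_continuous_onI continuous_intros)
  have [measurable]: "complex_of_real \<in> borel_measurable (count_space {1, R})" by simp
  show "(\<lambda>(r, t). of_real r * cis t) \<in>
     borel_measurable (count_space {1, R} \<Otimes>\<^sub>M uniform_measure lborel {0..2*pi})"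
    by measurable
qed

lemma L2_inner_annulus:
  assumes R: "0 < R" "R < 1"
    and f: "f \<in> L2 (annulus_measure R)" and g: "g \<in> L2 (annulus_measure R)"
  shows "L2_inner (annulus_measure R) f g =
     1 / (2*pi) * (LBINT t:{0..2*pi}. f (cis t) * cnj (g (cis t))) +
     1 / (2*pi) * (LBINT t:{0..2*pi}. f (of_real R * cis t) * cnj (g (of_real R * cis t)))"
proof -
  let ?U = "uniform_measure lborel {0..2*pi} :: real measure"
  let ?S = "count_space {1, R} :: real measure"
  let ?M = "annulus_measure R"
  let ?h = "\<lambda>z. f z * cnj (g z)"
  let ?p = "\<lambda>(r, t). of_real r * cis t :: complex"
  interpret U: prob_space ?U
    by (rule prob_space_uniform_measure) auto
  interpret S: sigma_finite_measure ?S
    by (rule sigma_finite_measure_count_space_finite) auto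
  interpret P: pair_sigma_finite ?S ?U ..
  have p [measurable]: "?p \<in> measurable (?S \<Otimes>\<^sub>M ?U) (restrict_space borel (annulus_boundary R))"
    by (rule annulus_param_measurable[OF R(1)])
  have sM: "sets ?M = sets (restrict_space borel (annulus_boundary R))"
    by (simp add: annulus_measure_def)
  have [measurable]: "f \<in> borel_measurable ?M" "g \<in> borel_measurable ?M"
    using f g by (auto simp: L2_def)
  have [measurable]: "cnj \<in> borel_measurable borel"
    by (intro borel_measurable_continuous_onI continuous_intros)
  have hM: "?h \<in> borel_measurable ?M"
    by measurable
  have hm: "?h \<in> borel_measurable (restrict_space borel (annulus_boundary R))"
    using hM by (simp add: measurable_cong_sets[OF sM refl])
  have intM: "integrable ?M ?h"
  proof (rule Bochner_Integration.integrable_bound)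
    show "integrable ?M (\<lambda>z. (norm (f z))\<^sup>2 + (norm (g z))\<^sup>2)"
      using f g by (auto simp: L2_def)
    show "AE z in ?M. norm (?h z) \<le> norm ((norm (f z))\<^sup>2 + (norm (g z))\<^sup>2)"
    proof (rule AE_I2)
      fix z
      have "2 * (norm (f z) * norm (g z)) \<le> (norm (f z))\<^sup>2 + (norm (g z))\<^sup>2"
        using sum_squares_bound[of "norm (f z)" "norm (g z)"] by simp
      moreover have "0 \<le> norm (f z) * norm (g z)" by simp
      ultimately have "norm (f z) * norm (g z) \<le> (norm (f z))\<^sup>2 + (norm (g z))\<^sup>2"
        by linarith
      then show "norm (?h z) \<le> norm ((norm (f z))\<^sup>2 + (norm (g z))\<^sup>2)"
        by (simp add: norm_mult)
    qed
  qed (rule hM)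
  have hp: "(\<lambda>x. ?h (?p x)) \<in> borel_measurable (?S \<Otimes>\<^sub>M ?U)"
    by (rule measurable_compose[OF p hm])
  have int: "integrable (?S \<Otimes>\<^sub>M ?U) (\<lambda>x. ?h (?p x))"
    using intM unfolding annulus_measure_def by (subst (asm) integrable_distr_eq[OF p hm])
  have sec: "(\<lambda>t. ?h (of_real r * cis t)) \<in> borel_measurable borel" if "r \<in> {1, R}" for r
  proof -
    have "(\<lambda>t. ?h (?p (r, t))) \<in> borel_measurable ?U"
      by (rule measurable_compose[OF measurable_Pair1' hp]) (use that in simp)
    then show ?thesis
      by (simp cong: measurable_cong_sets)
  qed
  have "L2_inner ?M f g = (\<integral>x. ?h (?p x) \<partial>(?S \<Otimes>\<^sub>M ?U))"
    unfolding L2_inner_def annulus_measure_def by (rule integral_distr[OF p hm])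
  also have "\<dots> = (\<integral>r. (\<integral>t. ?h (?p (r, t)) \<partial>?U) \<partial>?S)"
    by (rule P.integral_fst'[OF int, symmetric])
  also have "\<dots> = (\<Sum>r\<in>{1, R}. \<integral>t. ?h (of_real r * cis t) \<partial>?U)"
    by (subst lebesgue_integral_count_space_finite) auto
  also have "\<dots> = (\<Sum>r\<in>{1, R}. 1 / (2*pi) * (LBINT t:{0..2*pi}. ?h (of_real r * cis t)))"
    by (intro sum.cong refl integral_uniform_angle sec)
  finally show ?thesis
    using R by simp
qed

end

theory Submission
  imports Defs "HOL-Complex_Analysis.Complex_Analysis" "HOL-Computational_Algebra.Fundamental_Theorem_Algebra"
begin

text \<open>
  Let $s = 1$ on $C$ and $s = -1$ on $C_0$. A product of two monomials has the same mean over both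
  circles, so $s\,\overline{g}$ is orthogonal to $H^2(\partial A)$ for every $g \in H^2(\partial A)$.
  At each frequency $L^2(\partial A)$ has two dimensions and $H^2(\partial A)$ has one, hence
  $H^2(\partial A)^\perp = s\,\overline{H^2(\partial A)}$ (\<open>sg_cnj_laurent_perp\<close>, \<open>sg_cnj_perp_H2\<close>).
  The Hankel operator is therefore encoded by the bilinear form
  $B(f,g) = \int s\,\phi f g\,d\sigma$ on $H^2(\partial A)$ (\<open>hankel_form\<close>). It is the
  difference of two ordinary Hankel forms on the unit circle, one for $\phi_C$ and, after the
  substitution $z \mapsto R/z$, one for $\phi_{C_0}$. The two forms decouple at high frequencies,
  because $z^m$ is small on $C_0$ for large $m$, and $(R/z)^m$ is small on $C$.

  Suppose that $H_\phi$ is compact. Then $B(f, g)$ is small when $f$ and $g$ are of norm one and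
  $g$ has only high frequencies (\<open>compact_imp_form_small\<close>). For analytic polynomials $p$ and $q$
  the functions $f = z^m p$ and $g = z^m q$ give
  $|\int_{\mathbb{T}} \phi_C z^{2m} p q| \le \epsilon \|p\| \|q\|$ for large $m$. On the circle every
  polynomial is a product $uv$ of functions in the disc algebra with $|u|^2 = |v|^2 = |uv|$
  (\<open>disc_factors_poly\<close>), so the last bound is a bound by $L^1$ norms, and Nehari's theorem
  (\<open>nehari_L1\<close>) shows that $\phi_C$ has distance at most $\epsilon$ from the sum of
  $H^\infty$ and the trigonometric polynomials. Such functions belong to $H^\infty + C$
  (\<open>Hinfty_plus_C_I\<close>): with the help of Fejer means the trigonometric polynomials can be
  corrected by analytic ones to a uniformly convergent sequence. The functions composed with
  $z \mapsto R/z$ give the same result for $\phi_{C_0}$.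

  Conversely, let $\phi_C$ and $\phi_{C_0}$ belong to $H^\infty + C$. Up to a uniformly small
  error they have only finitely many nonzero Fourier coefficients of negative index. Then the
  matrix entries of $B$ at the normalized monomials of degrees $i$ and $j$ are
  $O(R^{(|i|+|j|)/2})$ (\<open>hankel_form_laurent_bound\<close>). Hence finitely many coefficients of $f$
  control $\|H_\phi f\|$ up to a small multiple of $\|f\|$ (\<open>hankel_bound\<close>), and a diagonal
  argument yields compactness.
\<close>

section \<open>Inner products and completeness of $L^2$\<close>

lemma L2_measurable [measurable_dest]: "f \<in> L2 M \<Longrightarrow> f \<in> borel_measurable M"
  by (simp add: L2_def)

lemma L2_integrable: "f \<in> L2 M \<Longrightarrow> integrable M (\<lambda>x. (norm (f x))\<^sup>2)"
  by (simp add: L2_def)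

lemma L2_bound:
  assumes f: "f \<in> borel_measurable M" and g: "integrable M g"
    and le: "AE x in M. (norm (f x))\<^sup>2 \<le> g x"
  shows "f \<in> L2 M"
proof -
  have "integrable M (\<lambda>x. (norm (f x))\<^sup>2)"
    by (rule Bochner_Integration.integrable_bound[OF g]) (use f le in auto)
  with f show ?thesis by (simp add: L2_def)
qed

lemma L2_mult_bounded:
  assumes f: "f \<in> L2 M" and [measurable]: "u \<in> borel_measurable M"
    and B: "AE x in M. norm (u x) \<le> B"
  shows "(\<lambda>x. u x * f x) \<in> L2 M"
proof (rule L2_bound)
  show "integrable M (\<lambda>x. B\<^sup>2 * (norm (f x))\<^sup>2)"
    using L2_integrable[OF f] by simp
  show "(\<lambda>x. u x * f x) \<in> borel_measurable M"
    using f by measurable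
  show "AE x in M. (norm (u x * f x))\<^sup>2 \<le> B\<^sup>2 * (norm (f x))\<^sup>2"
    using B by eventually_elim (auto simp: norm_mult power_mult_distrib intro!: mult_right_mono power_mono)
qed

lemma L2_cmult: "f \<in> L2 M \<Longrightarrow> (\<lambda>x. c * f x) \<in> L2 M"
  by (rule L2_mult_bounded[where B = "norm c"]) auto

lemma L2_zero [simp]: "(\<lambda>x. 0) \<in> L2 M"
  by (simp add: L2_def)

lemma L2_add:
  assumes f: "f \<in> L2 M" and g: "g \<in> L2 M"
  shows "(\<lambda>x. f x + g x) \<in> L2 M"
proof (rule L2_bound)
  show "integrable M (\<lambda>x. 2 * (norm (f x))\<^sup>2 + 2 * (norm (g x))\<^sup>2)"
    using L2_integrable[OF f] L2_integrable[OF g] by simp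
  show "(\<lambda>x. f x + g x) \<in> borel_measurable M"
    using f g by measurable
  have "(norm (f x + g x))\<^sup>2 \<le> 2 * (norm (f x))\<^sup>2 + 2 * (norm (g x))\<^sup>2" for x
  proof -
    have "(norm (f x + g x))\<^sup>2 \<le> (norm (f x) + norm (g x))\<^sup>2"
      by (intro power_mono norm_triangle_ineq) simp
    also have "\<dots> \<le> 2 * (norm (f x))\<^sup>2 + 2 * (norm (g x))\<^sup>2"
      using sum_squares_bound[of "norm (f x)" "norm (g x)"] by (simp add: power2_sum)
    finally show ?thesis .
  qed
  then show "AE x in M. (norm (f x + g x))\<^sup>2 \<le> 2 * (norm (f x))\<^sup>2 + 2 * (norm (g x))\<^sup>2"
    by simp
qed

lemma L2_diff: "f \<in> L2 M \<Longrightarrow> g \<in> L2 M \<Longrightarrow> (\<lambda>x. f x - g x) \<in> L2 M"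
  using L2_add[of f M "\<lambda>x. (-1) * g x"] L2_cmult[of g M "-1"] by simp

lemma L2_cnj: "f \<in> L2 M \<Longrightarrow> (\<lambda>x. cnj (f x)) \<in> L2 M"
  by (auto simp: L2_def intro!: borel_measurable_continuous_on[of cnj] continuous_intros)

lemma L2_bounded:
  assumes "finite_measure M" "u \<in> borel_measurable M" "AE x in M. norm (u x) \<le> B"
  shows "u \<in> L2 M"
proof -
  interpret finite_measure M by fact
  have "(\<lambda>x. 1) \<in> L2 M" by (simp add: L2_def)
  from L2_mult_bounded[OF this assms(2,3)] show ?thesis by simp
qed

lemma L2_norm_nonneg [simp]: "0 \<le> L2_norm M f"
  by (simp add: L2_norm_def)

lemma L2_norm_sq: "(L2_norm M f)\<^sup>2 = (\<integral>x. (norm (f x))\<^sup>2 \<partial>M)"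
  by (simp add: L2_norm_def)

lemma L2_norm_minus_commute: "L2_norm M (\<lambda>x. f x - g x) = L2_norm M (\<lambda>x. g x - f x)"
  by (simp add: L2_norm_def norm_minus_commute)

lemma L2_norm_mono:
  assumes f: "f \<in> borel_measurable M" and g: "g \<in> L2 M" and le: "AE x in M. norm (f x) \<le> norm (g x)"
  shows "L2_norm M f \<le> L2_norm M g"
proof -
  have "f \<in> L2 M"
    by (rule L2_bound[OF f L2_integrable[OF g]]) (use le in \<open>auto elim!: eventually_mono intro!: power_mono\<close>)
  then show ?thesis
    unfolding L2_norm_def
    by (intro real_sqrt_le_mono integral_mono_AE L2_integrable g)
       (use le in \<open>auto elim!: eventually_mono intro!: power_mono\<close>)
qed

lemma L2_norm_cmult: "L2_norm M (\<lambda>x. c * f x) = norm c * L2_norm M f"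
  by (simp add: L2_norm_def norm_mult power_mult_distrib real_sqrt_mult)

lemma L2_norm_mult_bounded:
  assumes f: "f \<in> L2 M" and [measurable]: "u \<in> borel_measurable M"
    and B: "AE x in M. norm (u x) \<le> B" "0 \<le> B"
  shows "L2_norm M (\<lambda>x. u x * f x) \<le> B * L2_norm M f"
proof -
  have [measurable]: "f \<in> borel_measurable M" using f by measurable
  have "L2_norm M (\<lambda>x. u x * f x) \<le> L2_norm M (\<lambda>x. of_real B * f x)"
    by (intro L2_norm_mono L2_cmult f)
       (use B in \<open>auto elim!: eventually_mono intro!: mult_right_mono simp: norm_mult\<close>)
  then show ?thesis using B by (simp add: L2_norm_cmult)
qed

lemma L2_norm_cnj: "L2_norm M (\<lambda>x. cnj (f x)) = L2_norm M f"
  by (simp add: L2_norm_def)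

lemma L2_mult_integrable:
  assumes f: "f \<in> L2 M" and g: "g \<in> L2 M"
  shows "integrable M (\<lambda>x. f x * g x)"
proof (rule Bochner_Integration.integrable_bound)
  show "integrable M (\<lambda>x. (norm (f x))\<^sup>2 + (norm (g x))\<^sup>2)"
    using L2_integrable[OF f] L2_integrable[OF g] by simp
  show "(\<lambda>x. f x * g x) \<in> borel_measurable M"
    using f g by measurable
  have "norm (f x * g x) \<le> (norm (f x))\<^sup>2 + (norm (g x))\<^sup>2" for x
  proof -
    have "2 * (norm (f x) * norm (g x)) \<le> (norm (f x))\<^sup>2 + (norm (g x))\<^sup>2"
      using sum_squares_bound[of "norm (f x)" "norm (g x)"] by simp
    moreover have "0 \<le> norm (f x) * norm (g x)" by simp
    ultimately have "norm (f x) * norm (g x) \<le> (norm (f x))\<^sup>2 + (norm (g x))\<^sup>2"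
      by linarith
    then show ?thesis by (simp add: norm_mult)
  qed
  then show "AE x in M. norm (f x * g x) \<le> norm ((norm (f x))\<^sup>2 + (norm (g x))\<^sup>2)"
    by (simp add: abs_of_nonneg)
qed

lemma L2_inner_integrable: "f \<in> L2 M \<Longrightarrow> g \<in> L2 M \<Longrightarrow> integrable M (\<lambda>x. f x * cnj (g x))"
  by (intro L2_mult_integrable L2_cnj)

lemma L2_Cauchy_Schwarz_norm:
  assumes f: "f \<in> L2 M" and g: "g \<in> L2 M"
  shows "(\<integral>x. norm (f x * g x) \<partial>M) \<le> L2_norm M f * L2_norm M g"
proof -
  have [measurable]: "f \<in> borel_measurable M" "g \<in> borel_measurable M" using f g by measurable
  define I where "I = (\<integral>x. norm (f x * g x) \<partial>M)"
  have I: "0 \<le> I" unfolding I_def by (rule integral_nonneg_AE) simp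
  have sq: "(\<integral>\<^sup>+x. ennreal (norm (h x)) ^ 2 \<partial>M) = ennreal ((L2_norm M h)\<^sup>2)" if "h \<in> L2 M" for h
    using L2_integrable[OF that]
    by (simp add: L2_norm_sq ennreal_power nn_integral_eq_integral)
  have "ennreal I = (\<integral>\<^sup>+x. ennreal (norm (f x)) * ennreal (norm (g x)) \<partial>M)"
    unfolding I_def nn_integral_eq_integral[OF integrable_norm[OF L2_mult_integrable[OF f g]], symmetric, simplified]
    by (simp add: norm_mult ennreal_mult)
  then have "(ennreal I)\<^sup>2 \<le> ennreal ((L2_norm M f)\<^sup>2) * ennreal ((L2_norm M g)\<^sup>2)"
    using Cauchy_Schwarz_nn_integral[of "\<lambda>x. ennreal (norm (f x))" M "\<lambda>x. ennreal (norm (g x))"]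
    by (simp add: sq f g)
  then have "ennreal (I\<^sup>2) \<le> ennreal ((L2_norm M f * L2_norm M g)\<^sup>2)"
    using I by (simp add: ennreal_power ennreal_mult power_mult_distrib)
  then have "I\<^sup>2 \<le> (L2_norm M f * L2_norm M g)\<^sup>2"
    by (subst (asm) ennreal_le_iff) auto
  then show ?thesis unfolding I_def[symmetric]
    by (rule power2_le_imp_le) simp
qed

lemma L2_Cauchy_Schwarz_mult:
  assumes "f \<in> L2 M" "g \<in> L2 M"
  shows "norm (\<integral>x. f x * g x \<partial>M) \<le> L2_norm M f * L2_norm M g"
  using L2_Cauchy_Schwarz_norm[OF assms] integral_norm_bound[of M "\<lambda>x. f x * g x"] by linarith

lemma L2_Cauchy_Schwarz:
  assumes "f \<in> L2 M" "g \<in> L2 M"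
  shows "norm (L2_inner M f g) \<le> L2_norm M f * L2_norm M g"
  using L2_Cauchy_Schwarz_mult[OF assms(1) L2_cnj[OF assms(2)]]
  by (simp add: L2_inner_def L2_norm_cnj)

lemma L2_inner_commute: "L2_inner M g f = cnj (L2_inner M f g)"
proof -
  have "cnj (L2_inner M f g) = (\<integral>x. cnj (f x * cnj (g x)) \<partial>M)"
    unfolding L2_inner_def by (rule Bochner_Integration.integral_cnj[symmetric])
  also have "\<dots> = L2_inner M g f"
    unfolding L2_inner_def by (intro Bochner_Integration.integral_cong) auto
  finally show ?thesis by simp
qed

lemma L2_inner_self: "L2_inner M f f = of_real ((L2_norm M f)\<^sup>2)"
  unfolding L2_inner_def L2_norm_sq by (simp add: complex_norm_square[symmetric] del: of_real_power)

lemma L2_inner_add_left: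
  "f \<in> L2 M \<Longrightarrow> g \<in> L2 M \<Longrightarrow> h \<in> L2 M \<Longrightarrow>
    L2_inner M (\<lambda>x. f x + g x) h = L2_inner M f h + L2_inner M g h"
  unfolding L2_inner_def by (simp add: distrib_right L2_inner_integrable)

lemma L2_inner_diff_left:
  "f \<in> L2 M \<Longrightarrow> g \<in> L2 M \<Longrightarrow> h \<in> L2 M \<Longrightarrow>
    L2_inner M (\<lambda>x. f x - g x) h = L2_inner M f h - L2_inner M g h"
  unfolding L2_inner_def by (simp add: left_diff_distrib L2_inner_integrable)

lemma L2_inner_cmult_left: "L2_inner M (\<lambda>x. c * f x) h = c * L2_inner M f h"
  unfolding L2_inner_def by (simp add: mult.assoc)

lemma L2_inner_add_right:
  "f \<in> L2 M \<Longrightarrow> g \<in> L2 M \<Longrightarrow> h \<in> L2 M \<Longrightarrow>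
    L2_inner M h (\<lambda>x. f x + g x) = L2_inner M h f + L2_inner M h g"
  unfolding L2_inner_def by (simp add: distrib_left L2_inner_integrable)

lemma L2_inner_diff_right:
  "f \<in> L2 M \<Longrightarrow> g \<in> L2 M \<Longrightarrow> h \<in> L2 M \<Longrightarrow>
    L2_inner M h (\<lambda>x. f x - g x) = L2_inner M h f - L2_inner M h g"
  unfolding L2_inner_def by (simp add: right_diff_distrib L2_inner_integrable)

lemma L2_inner_cmult_right: "L2_inner M h (\<lambda>x. c * f x) = cnj c * L2_inner M h f"
  by (subst (1 2) L2_inner_commute) (simp add: L2_inner_cmult_left)

lemma L2_inner_zero_right [simp]: "L2_inner M h (\<lambda>x. 0) = 0"
  by (simp add: L2_inner_def)

lemma L2_norm_add_sq:
  assumes "f \<in> L2 M" "g \<in> L2 M"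
  shows "(L2_norm M (\<lambda>x. f x + g x))\<^sup>2 = (L2_norm M f)\<^sup>2 + 2 * Re (L2_inner M f g) + (L2_norm M g)\<^sup>2"
proof -
  have "of_real ((L2_norm M (\<lambda>x. f x + g x))\<^sup>2) =
     of_real ((L2_norm M f)\<^sup>2) + (L2_inner M f g + cnj (L2_inner M f g)) + of_real ((L2_norm M g)\<^sup>2)"
    using assms unfolding L2_inner_self[symmetric]
    by (simp add: L2_inner_add_left L2_inner_add_right L2_add L2_inner_commute[of M g f])
  also have "\<dots> = complex_of_real ((L2_norm M f)\<^sup>2 + 2 * Re (L2_inner M f g) + (L2_norm M g)\<^sup>2)"
    by (simp add: complex_add_cnj)
  finally show ?thesis by (simp only: of_real_eq_iff)
qed

lemma L2_norm_diff_sq: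
  assumes "f \<in> L2 M" "g \<in> L2 M"
  shows "(L2_norm M (\<lambda>x. f x - g x))\<^sup>2 = (L2_norm M f)\<^sup>2 - 2 * Re (L2_inner M f g) + (L2_norm M g)\<^sup>2"
  using L2_norm_add_sq[OF assms(1) L2_cmult[OF assms(2), of "-1"]]
    L2_norm_cmult[of M "-1" g] L2_inner_cmult_right[of M f "-1" g]
  by simp

lemma L2_norm_triangle:
  assumes "f \<in> L2 M" "g \<in> L2 M"
  shows "L2_norm M (\<lambda>x. f x + g x) \<le> L2_norm M f + L2_norm M g"
proof (rule power2_le_imp_le)
  have "Re (L2_inner M f g) \<le> L2_norm M f * L2_norm M g"
    using L2_Cauchy_Schwarz[OF assms] complex_Re_le_cmod order_trans by blast
  then show "(L2_norm M (\<lambda>x. f x + g x))\<^sup>2 \<le> (L2_norm M f + L2_norm M g)\<^sup>2"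
    unfolding L2_norm_add_sq[OF assms] by (simp add: power2_sum)
qed simp

lemma L2_norm_triangle_diff:
  assumes "f \<in> L2 M" "g \<in> L2 M" "h \<in> L2 M"
  shows "L2_norm M (\<lambda>x. f x - h x) \<le> L2_norm M (\<lambda>x. f x - g x) + L2_norm M (\<lambda>x. g x - h x)"
  using L2_norm_triangle[OF L2_diff[OF assms(1,2)] L2_diff[OF assms(2,3)]] by simp

lemma L2_norm_triangle_sub:
  assumes "f \<in> L2 M" "g \<in> L2 M"
  shows "L2_norm M f \<le> L2_norm M (\<lambda>x. f x - g x) + L2_norm M g"
  using L2_norm_triangle_diff[OF assms L2_zero] by simp

lemma L2_norm_eq_0_AE:
  assumes "f \<in> L2 M" "L2_norm M f = 0"
  shows "AE x in M. f x = 0"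
proof -
  have "(\<integral>x. (norm (f x))\<^sup>2 \<partial>M) = 0"
    using assms(2) by (simp add: L2_norm_def)
  then show ?thesis
    using integral_nonneg_eq_0_iff_AE[OF L2_integrable[OF assms(1)]] by simp
qed

lemma L2_norm_eq_0I: "AE x in M. f x = 0 \<Longrightarrow> L2_norm M f = 0"
  unfolding L2_norm_def by (simp add: integral_eq_zero_AE)

lemma L1_le_L2:
  assumes "prob_space M" "f \<in> L2 M"
  shows "(\<integral>x. norm (f x) \<partial>M) \<le> L2_norm M f"
proof -
  interpret prob_space M by fact
  have "(\<lambda>x. 1) \<in> L2 M" by (simp add: L2_def)
  from L2_Cauchy_Schwarz_norm[OF assms(2) this] show ?thesis
    by (simp add: L2_norm_def prob_space)
qed

lemma tendsto_sandwich0: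
  fixes f g :: "nat \<Rightarrow> real"
  assumes "\<And>n. 0 \<le> f n" "\<And>n. f n \<le> g n" "g \<longlonglongrightarrow> 0"
  shows "f \<longlonglongrightarrow> 0"
  by (rule tendsto_sandwich[OF _ _ tendsto_const assms(3)]) (use assms in auto)

lemma L2_inner_tendsto_left:
  assumes "\<And>n. f n \<in> L2 M" "g \<in> L2 M" "h \<in> L2 M"
    and lim: "(\<lambda>n. L2_norm M (\<lambda>x. f n x - g x)) \<longlonglongrightarrow> 0"
  shows "(\<lambda>n. L2_inner M (f n) h) \<longlonglongrightarrow> L2_inner M g h"
proof -
  have "(\<lambda>n. norm (L2_inner M (f n) h - L2_inner M g h)) \<longlonglongrightarrow> 0"
  proof (rule tendsto_sandwich0)
    show "norm (L2_inner M (f n) h - L2_inner M g h) \<le> L2_norm M (\<lambda>x. f n x - g x) * L2_norm M h" for n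
      using L2_Cauchy_Schwarz[OF L2_diff[OF assms(1)[of n] assms(2)] assms(3)]
      by (simp add: L2_inner_diff_left assms)
    show "(\<lambda>n. L2_norm M (\<lambda>x. f n x - g x) * L2_norm M h) \<longlonglongrightarrow> 0"
      using tendsto_mult_right[OF lim, of "L2_norm M h"] by simp
  qed simp
  then show ?thesis
    by (rule LIM_zero_cancel[OF tendsto_norm_zero_cancel])
qed

lemma L2_norm_tendsto:
  assumes "\<And>n. f n \<in> L2 M" "g \<in> L2 M"
    and lim: "(\<lambda>n. L2_norm M (\<lambda>x. f n x - g x)) \<longlonglongrightarrow> 0"
  shows "(\<lambda>n. L2_norm M (f n)) \<longlonglongrightarrow> L2_norm M g"
proof -
  have "(\<lambda>n. norm (L2_norm M (f n) - L2_norm M g)) \<longlonglongrightarrow> 0"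
  proof (rule tendsto_sandwich0[OF _ _ lim])
    show "norm (L2_norm M (f n) - L2_norm M g) \<le> L2_norm M (\<lambda>x. f n x - g x)" for n
      using L2_norm_triangle_sub[OF assms(1)[of n] assms(2)] L2_norm_triangle_sub[OF assms(2) assms(1)[of n]]
      by (simp add: L2_norm_minus_commute[of M g] abs_le_iff)
  qed simp
  then show ?thesis
    by (rule LIM_zero_cancel[OF tendsto_norm_zero_cancel])
qed

lemma L2_bounded_form_le:
  assumes \<psi>: "\<psi> \<in> borel_measurable M" "AE z in M. norm (\<psi> z) \<le> B" "0 \<le> B" and L: "f \<in> L2 M" "g \<in> L2 M"
  shows "norm (\<integral>z. \<psi> z * f z * g z \<partial>M) \<le> B * L2_norm M f * L2_norm M g"
proof -
  have *: "(\<lambda>z. \<psi> z * f z) \<in> L2 M" by (rule L2_mult_bounded[OF L(1) \<psi>(1,2)])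
  have "norm (\<integral>z. \<psi> z * f z * g z \<partial>M) \<le> L2_norm M (\<lambda>z. \<psi> z * f z) * L2_norm M g"
    by (rule L2_Cauchy_Schwarz_mult[OF * L(2)])
  also have "\<dots> \<le> B * L2_norm M f * L2_norm M g"
    by (intro mult_right_mono L2_norm_mult_bounded L \<psi>) auto
  finally show ?thesis .
qed

lemma L2_bilinear_tendsto:
  assumes \<psi>: "\<psi> \<in> borel_measurable M" "AE z in M. norm (\<psi> z) \<le> B" "0 \<le> B"
    and L: "\<And>n. p n \<in> L2 M" "\<And>n. q n \<in> L2 M" "u \<in> L2 M" "v \<in> L2 M"
    and lim: "(\<lambda>n. L2_norm M (\<lambda>z. p n z - u z)) \<longlonglongrightarrow> 0" "(\<lambda>n. L2_norm M (\<lambda>z. q n z - v z)) \<longlonglongrightarrow> 0"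
  shows "(\<lambda>n. \<integral>z. \<psi> z * p n z * q n z \<partial>M) \<longlonglongrightarrow> (\<integral>z. \<psi> z * u z * v z \<partial>M)"
proof -
  have int: "integrable M (\<lambda>z. \<psi> z * f z * g z)" if "f \<in> L2 M" "g \<in> L2 M" for f g
    by (rule L2_mult_integrable[OF L2_mult_bounded[OF that(1) \<psi>(1,2)] that(2)])
  note le = L2_bounded_form_le[OF \<psi>]
  have qlim: "(\<lambda>n. L2_norm M (q n)) \<longlonglongrightarrow> L2_norm M v" by (rule L2_norm_tendsto[OF L(2,4) lim(2)])
  have "(\<lambda>n. norm ((\<integral>z. \<psi> z * p n z * q n z \<partial>M) - (\<integral>z. \<psi> z * u z * v z \<partial>M))) \<longlonglongrightarrow> 0"
  proof (rule tendsto_sandwich0)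
    fix n
    have d: "(\<lambda>z. p n z - u z) \<in> L2 M" "(\<lambda>z. q n z - v z) \<in> L2 M" by (intro L2_diff L)+
    have "(\<integral>z. \<psi> z * p n z * q n z \<partial>M) - (\<integral>z. \<psi> z * u z * v z \<partial>M)
       = (\<integral>z. \<psi> z * (p n z - u z) * q n z + \<psi> z * u z * (q n z - v z) \<partial>M)"
      using int[OF L(1) L(2), of n n] int[OF L(3,4)]
      by (subst Bochner_Integration.integral_diff[symmetric]) (auto simp: algebra_simps)
    also have "\<dots> = (\<integral>z. \<psi> z * (p n z - u z) * q n z \<partial>M) + (\<integral>z. \<psi> z * u z * (q n z - v z) \<partial>M)"
      by (rule Bochner_Integration.integral_add[OF int[OF d(1) L(2)] int[OF L(3) d(2)]])
    finally have eq: "(\<integral>z. \<psi> z * p n z * q n z \<partial>M) - (\<integral>z. \<psi> z * u z * v z \<partial>M)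
      = (\<integral>z. \<psi> z * (p n z - u z) * q n z \<partial>M) + (\<integral>z. \<psi> z * u z * (q n z - v z) \<partial>M)" .
    show "norm ((\<integral>z. \<psi> z * p n z * q n z \<partial>M) - (\<integral>z. \<psi> z * u z * v z \<partial>M))
       \<le> B * L2_norm M (\<lambda>z. p n z - u z) * L2_norm M (q n) + B * L2_norm M u * L2_norm M (\<lambda>z. q n z - v z)"
      unfolding eq by (rule order_trans[OF norm_triangle_ineq add_mono[OF le[OF d(1) L(2)] le[OF L(3) d(2)]]])
    show "(\<lambda>n. B * L2_norm M (\<lambda>z. p n z - u z) * L2_norm M (q n) + B * L2_norm M u * L2_norm M (\<lambda>z. q n z - v z)) \<longlonglongrightarrow> 0"
      using tendsto_add[OF tendsto_mult[OF tendsto_mult_right_zero[OF lim(1), of B] qlim]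
          tendsto_mult_right_zero[OF lim(2), of "B * L2_norm M u"]] by simp
  qed simp
  then show ?thesis by (rule LIM_zero_cancel[OF tendsto_norm_zero_cancel])
qed

text \<open>
  A Cauchy sequence has a subsequence with successive distances at most $2^{-k}$. As the measure
  is finite, the increments are summable in $L^1$, so the subsequence converges almost everywhere,
  and Fatou's lemma turns this into convergence in norm.
\<close>

lemma L2_complete:
  fixes f :: "nat \<Rightarrow> 'a \<Rightarrow> complex"
  assumes fin: "finite_measure M" and f: "\<And>n. f n \<in> L2 M"
    and Cauchy: "\<And>e. e > 0 \<Longrightarrow> \<exists>N. \<forall>m\<ge>N. \<forall>n\<ge>N. L2_norm M (\<lambda>x. f m x - f n x) < e"
  shows "\<exists>g\<in>L2 M. (\<lambda>n. L2_norm M (\<lambda>x. f n x - g x)) \<longlonglongrightarrow> 0"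
proof -
  interpret finite_measure M by fact
  have [measurable]: "f n \<in> borel_measurable M" for n using f[of n] by measurable
  define c where "c = sqrt (measure M (space M))"
  have c1: "(\<lambda>x. 1) \<in> L2 M" "L2_norm M (\<lambda>x. 1) = c" by (auto simp: L2_def L2_norm_def c_def)
  obtain N where N: "\<And>k m n. m \<ge> N k \<Longrightarrow> n \<ge> N k \<Longrightarrow> L2_norm M (\<lambda>x. f m x - f n x) < (1/2)^k"
    using Cauchy[of "(1/2)^k" for k] by (metis zero_less_divide_1_iff zero_less_numeral zero_less_power)
  \<comment> \<open>summing makes the indices strictly increasing and at least \<open>N k\<close>\<close>
  define s where "s k = (\<Sum>j\<le>k. Suc (N j))" for k
  have sN: "s k \<ge> N k" for k
    unfolding s_def using member_le_sum[of k "{..k}" "\<lambda>j. Suc (N j)"] by simp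
  have s: "strict_mono s"
    by (rule strict_monoI_Suc) (simp add: s_def)
  define d where "d k x = f (s (Suc k)) x - f (s k) x" for k x
  have dL2: "d k \<in> L2 M" for k unfolding d_def by (intro L2_diff f)
  have [measurable]: "d k \<in> borel_measurable M" for k using dL2[of k] by measurable
  have dn: "L2_norm M (d k) \<le> (1/2)^k" for k
    unfolding d_def
    using N[of k "s (Suc k)" "s k"] sN[of k] strict_mono_less_eq[OF s, of k "Suc k"] by (simp add: less_imp_le)
  have "(\<integral>\<^sup>+x. (\<Sum>k. ennreal (norm (d k x))) \<partial>M) = (\<Sum>k. \<integral>\<^sup>+x. ennreal (norm (d k x)) \<partial>M)"
    by (rule nn_integral_suminf) simp
  also have "\<dots> \<le> (\<Sum>k. ennreal (c * (1/2)^k))"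
  proof (intro suminf_le summableI)
    fix k
    have "(\<integral>x. norm (d k x) \<partial>M) \<le> (1/2)^k * c"
      using L2_Cauchy_Schwarz_norm[OF dL2[of k] c1(1)] mult_right_mono[OF dn[of k], of c]
      by (simp add: c1 c_def)
    moreover have "integrable M (\<lambda>x. norm (d k x))"
      using L2_mult_integrable[OF dL2[of k] c1(1)] by simp
    ultimately show "(\<integral>\<^sup>+x. ennreal (norm (d k x)) \<partial>M) \<le> ennreal (c * (1/2)^k)"
      by (simp add: nn_integral_eq_integral mult.commute ennreal_leI)
  qed
  also have "\<dots> < \<top>"
    using sums_mult[OF geometric_sums[of "1/2::real"], of c]
    by (subst suminf_ennreal_eq[of _ "c * (1 / (1 - 1/2))"]) (auto simp: c_def)
  finally have "(\<integral>\<^sup>+x. (\<Sum>k. ennreal (norm (d k x))) \<partial>M) \<noteq> \<infinity>"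
    by (simp add: infinity_ennreal_def)
  then have "AE x in M. (\<Sum>k. ennreal (norm (d k x))) \<noteq> \<infinity>"
    by (intro nn_integral_PInf_AE) auto
  then have conv: "AE x in M. convergent (\<lambda>k. f (s k) x)"
  proof eventually_elim
    case (elim x)
    then have "summable (\<lambda>k. norm (d k x))"
      by (intro summable_suminf_not_top) auto
    then have "summable (\<lambda>k. d k x)" by (rule summable_norm_cancel)
    then have "convergent (\<lambda>n. \<Sum>k<n. d k x)" by (simp add: summable_iff_convergent)
    then have "convergent (\<lambda>n. f (s n) x - f (s 0) x)"
      using sum_lessThan_telescope[of "\<lambda>n. f (s n) x"] by (simp add: d_def)
    then have "convergent (\<lambda>n. (f (s n) x - f (s 0) x) + f (s 0) x)"
      by (intro convergent_add convergent_const)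
    then show ?case by simp
  qed
  define g where "g x = lim (\<lambda>k. f (s k) x)" for x
  have [measurable]: "g \<in> borel_measurable M"
    unfolding g_def by (rule borel_measurable_lim_metric) measurable
  have lim: "AE x in M. (\<lambda>k. f (s k) x) \<longlonglongrightarrow> g x"
    using conv by eventually_elim (auto simp: g_def convergent_LIMSEQ_iff)
  have bd: "L2_norm M (\<lambda>x. f n x - g x) \<le> e \<and> (\<lambda>x. f n x - g x) \<in> L2 M"
    if e: "e > 0" and n: "\<And>m. m \<ge> n \<Longrightarrow> L2_norm M (\<lambda>x. f n x - f m x) \<le> e" for n e
  proof -
    have "(\<integral>\<^sup>+x. ennreal ((norm (f n x - g x))\<^sup>2) \<partial>M)
        = (\<integral>\<^sup>+x. liminf (\<lambda>k. ennreal ((norm (f n x - f (s k) x))\<^sup>2)) \<partial>M)"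
    proof (rule nn_integral_cong_AE)
      show "AE x in M. ennreal ((norm (f n x - g x))\<^sup>2) = liminf (\<lambda>k. ennreal ((norm (f n x - f (s k) x))\<^sup>2))"
        using lim
      proof eventually_elim
        case (elim x)
        have "(\<lambda>k. ennreal ((norm (f n x - f (s k) x))\<^sup>2)) \<longlonglongrightarrow> ennreal ((norm (f n x - g x))\<^sup>2)"
          by (intro tendsto_intros tendsto_ennrealI elim)
        then show ?case by (metis lim_imp_Liminf sequentially_bot)
      qed
    qed
    also have "\<dots> \<le> liminf (\<lambda>k. \<integral>\<^sup>+x. ennreal ((norm (f n x - f (s k) x))\<^sup>2) \<partial>M)"
      by (rule nn_integral_liminf) measurable
    also have "\<dots> \<le> liminf (\<lambda>k. ennreal (e\<^sup>2))"
    proof (rule Liminf_mono)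
      show "\<forall>\<^sub>F k in sequentially. (\<integral>\<^sup>+x. ennreal ((norm (f n x - f (s k) x))\<^sup>2) \<partial>M) \<le> ennreal (e\<^sup>2)"
        using eventually_ge_at_top[of n]
      proof eventually_elim
        case (elim k)
        have "s k \<ge> n" using elim seq_suble[OF s, of k] by linarith
        then have "(L2_norm M (\<lambda>x. f n x - f (s k) x))\<^sup>2 \<le> e\<^sup>2"
          using n by (intro power_mono) auto
        then show ?case
          using L2_integrable[OF L2_diff[OF f[of n] f[of "s k"]]]
          by (simp add: nn_integral_eq_integral L2_norm_sq ennreal_leI)
      qed
    qed
    also have "\<dots> = ennreal (e\<^sup>2)" by (simp add: Liminf_const)
    finally have *: "(\<integral>\<^sup>+x. ennreal ((norm (f n x - g x))\<^sup>2) \<partial>M) \<le> ennreal (e\<^sup>2)" .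
    have i: "integrable M (\<lambda>x. (norm (f n x - g x))\<^sup>2)"
      using le_less_trans[OF *, of "\<top>"] by (intro integrableI_bounded) auto
    then have "(L2_norm M (\<lambda>x. f n x - g x))\<^sup>2 \<le> e\<^sup>2"
      using * by (simp add: nn_integral_eq_integral L2_norm_sq)
    then have "L2_norm M (\<lambda>x. f n x - g x) \<le> e"
      by (rule power2_le_imp_le) (use e in simp)
    with i show ?thesis by (simp add: L2_def)
  qed
  obtain N1 where N1: "\<And>m n. m \<ge> N1 \<Longrightarrow> n \<ge> N1 \<Longrightarrow> L2_norm M (\<lambda>x. f m x - f n x) < 1"
    using Cauchy[of 1] by auto
  have "(\<lambda>x. f N1 x - g x) \<in> L2 M"
    using bd[of 1 N1] N1[of N1] by (simp add: less_imp_le)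
  then have gL2: "g \<in> L2 M"
    using L2_diff[OF f[of N1], of "\<lambda>x. f N1 x - g x"] by simp
  have "(\<lambda>n. L2_norm M (\<lambda>x. f n x - g x)) \<longlonglongrightarrow> 0"
  proof (rule LIMSEQ_I)
    fix r :: real assume r: "r > 0"
    obtain n0 where n0: "\<And>m n. m \<ge> n0 \<Longrightarrow> n \<ge> n0 \<Longrightarrow> L2_norm M (\<lambda>x. f m x - f n x) < r/2"
      using Cauchy[of "r/2"] r by auto
    have half: "L2_norm M (\<lambda>x. f n x - g x) \<le> r/2" if "n \<ge> n0" for n
      using bd[of "r/2" n] n0[of n] that r by (simp add: less_imp_le)
    have "L2_norm M (\<lambda>x. f n x - g x) < r" if "n \<ge> n0" for n
      using half[OF that] r by linarith
    then show "\<exists>no. \<forall>n\<ge>no. norm (L2_norm M (\<lambda>x. f n x - g x) - 0) < r"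
      by (intro exI[of _ n0]) simp
  qed
  with gL2 show ?thesis by blast
qed

section \<open>Closed subspaces and convex sets in $L^2$\<close>

definition L2_subspace :: "'a measure \<Rightarrow> ('a \<Rightarrow> complex) set \<Rightarrow> bool" where
  "L2_subspace M V \<longleftrightarrow> V \<subseteq> L2 M \<and> (\<lambda>x. 0) \<in> V \<and>
     (\<forall>f\<in>V. \<forall>g\<in>V. \<forall>c. (\<lambda>x. f x + c * g x) \<in> V)"

lemma L2_subspaceD:
  assumes "L2_subspace M V"
  shows "f \<in> V \<Longrightarrow> f \<in> L2 M" "(\<lambda>x. 0) \<in> V"
    "f \<in> V \<Longrightarrow> g \<in> V \<Longrightarrow> (\<lambda>x. f x + c * g x) \<in> V"
    "f \<in> V \<Longrightarrow> g \<in> V \<Longrightarrow> (\<lambda>x. f x + g x) \<in> V"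
    "f \<in> V \<Longrightarrow> g \<in> V \<Longrightarrow> (\<lambda>x. f x - g x) \<in> V"
    "f \<in> V \<Longrightarrow> (\<lambda>x. c * f x) \<in> V"
proof -
  have *: "(\<lambda>x. f x + c * g x) \<in> V" if "f \<in> V" "g \<in> V" for f g c
    using assms that by (auto simp: L2_subspace_def)
  show "f \<in> V \<Longrightarrow> f \<in> L2 M" and z: "(\<lambda>x. 0) \<in> V"
    using assms by (auto simp: L2_subspace_def)
  show "f \<in> V \<Longrightarrow> g \<in> V \<Longrightarrow> (\<lambda>x. f x + c * g x) \<in> V" by (rule *)
  show "f \<in> V \<Longrightarrow> g \<in> V \<Longrightarrow> (\<lambda>x. f x + g x) \<in> V" using *[of f g 1] by simp
  show "f \<in> V \<Longrightarrow> g \<in> V \<Longrightarrow> (\<lambda>x. f x - g x) \<in> V" using *[of f g "-1"] by simp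
  show "f \<in> V \<Longrightarrow> (\<lambda>x. c * f x) \<in> V" using *[OF z, of f c] by simp
qed

lemma L2_closure_L2: "f \<in> L2_closure M S \<Longrightarrow> f \<in> L2 M"
  by (simp add: L2_closure_def)

lemma L2_closure_subset: "S \<subseteq> L2 M \<Longrightarrow> S \<subseteq> L2_closure M S"
  by (auto simp: L2_closure_def L2_norm_def intro!: bexI)

lemma L2_closure_approx:
  assumes "f \<in> L2_closure M S"
  shows "\<exists>g. (\<forall>n. g n \<in> S) \<and> (\<lambda>n. L2_norm M (\<lambda>x. g n x - f x)) \<longlonglongrightarrow> 0"
proof -
  have "\<exists>g\<in>S. L2_norm M (\<lambda>x. f x - g x) < inverse (real (Suc n))" for n
    using assms by (auto simp: L2_closure_def)
  then obtain g where g: "\<And>n. g n \<in> S" "\<And>n. L2_norm M (\<lambda>x. f x - g n x) < inverse (real (Suc n))"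
    by metis
  have "(\<lambda>n. L2_norm M (\<lambda>x. g n x - f x)) \<longlonglongrightarrow> 0"
    by (rule tendsto_sandwich0[OF _ _ LIMSEQ_inverse_real_of_nat])
       (use g(2) in \<open>auto simp: L2_norm_minus_commute[of M _ f] less_imp_le\<close>)
  with g(1) show ?thesis by blast
qed

lemma L2_closureI:
  assumes "f \<in> L2 M" "\<And>n. g n \<in> S" "(\<lambda>n. L2_norm M (\<lambda>x. g n x - f x)) \<longlonglongrightarrow> 0"
  shows "f \<in> L2_closure M S"
  unfolding L2_closure_def
proof safe
  fix e :: real assume "e > 0"
  then obtain n where "L2_norm M (\<lambda>x. g n x - f x) < e"
    using order_tendstoD(2)[OF assms(3), of e] by (auto simp: eventually_sequentially)
  then show "\<exists>g\<in>S. L2_norm M (\<lambda>x. f x - g x) < e"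
    using assms(2) by (intro bexI[of _ "g n"]) (auto simp: L2_norm_minus_commute)
qed fact

lemma L2_closure_limit:
  assumes S: "S \<subseteq> L2 M" and f: "f \<in> L2 M" and g: "\<And>n. g n \<in> L2_closure M S"
    and lim: "(\<lambda>n. L2_norm M (\<lambda>x. g n x - f x)) \<longlonglongrightarrow> 0"
  shows "f \<in> L2_closure M S"
  unfolding L2_closure_def
proof safe
  fix e :: real assume e: "e > 0"
  then obtain n where n: "L2_norm M (\<lambda>x. g n x - f x) < e/2"
    using order_tendstoD(2)[OF lim, of "e/2"] by (auto simp: eventually_sequentially)
  obtain h where h: "h \<in> S" "L2_norm M (\<lambda>x. g n x - h x) < e/2"
  proof -
    have "\<forall>\<epsilon>>0. \<exists>h\<in>S. L2_norm M (\<lambda>x. g n x - h x) < \<epsilon>"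
      using g[of n] by (simp add: L2_closure_def)
    then show ?thesis using half_gt_zero[OF e] that by blast
  qed
  have "L2_norm M (\<lambda>x. f x - h x) \<le> L2_norm M (\<lambda>x. f x - g n x) + L2_norm M (\<lambda>x. g n x - h x)"
    using S h g[of n] f by (intro L2_norm_triangle_diff) (auto simp: L2_closure_L2)
  then show "\<exists>g\<in>S. L2_norm M (\<lambda>x. f x - g x) < e"
    using n h by (intro bexI[of _ h]) (auto simp: L2_norm_minus_commute[of M _ f])
qed fact

lemma L2_closure_cong_AE:
  assumes S: "S \<subseteq> L2 M" and g: "g \<in> L2_closure M S" and f: "f \<in> L2 M" and eq: "AE x in M. f x = g x"
  shows "f \<in> L2_closure M S"
proof (rule L2_closure_limit[OF S f])
  show "(\<lambda>n. L2_norm M (\<lambda>x. g x - f x)) \<longlonglongrightarrow> 0"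
    using eq by (subst L2_norm_eq_0I) auto
qed (rule g)

lemma L2_subspace_closure:
  assumes V: "L2_subspace M V"
  shows "L2_subspace M (L2_closure M V)"
  unfolding L2_subspace_def
proof (intro conjI ballI allI subsetI)
  note V' = L2_subspaceD[OF V]
  have sub: "V \<subseteq> L2 M" using V'(1) by auto
  show "(\<lambda>x. 0) \<in> L2_closure M V" using L2_closure_subset[OF sub] V'(2) by auto
  fix f g c assume fg: "f \<in> L2_closure M V" "g \<in> L2_closure M V"
  then have L: "f \<in> L2 M" "g \<in> L2 M" by (auto simp: L2_closure_L2)
  obtain a where a: "\<And>n. a n \<in> V" "(\<lambda>n. L2_norm M (\<lambda>x. a n x - f x)) \<longlonglongrightarrow> 0"
    using L2_closure_approx[OF fg(1)] by blast
  obtain b where b: "\<And>n. b n \<in> V" "(\<lambda>n. L2_norm M (\<lambda>x. b n x - g x)) \<longlonglongrightarrow> 0"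
    using L2_closure_approx[OF fg(2)] by blast
  show "(\<lambda>x. f x + c * g x) \<in> L2_closure M V"
  proof (rule L2_closureI)
    show "(\<lambda>x. f x + c * g x) \<in> L2 M" using L by (intro L2_add L2_cmult)
    show "(\<lambda>x. a n x + c * b n x) \<in> V" for n by (intro V' a b)
    show "(\<lambda>n. L2_norm M (\<lambda>x. a n x + c * b n x - (f x + c * g x))) \<longlonglongrightarrow> 0"
    proof (rule tendsto_sandwich0)
      fix n
      show "L2_norm M (\<lambda>x. a n x + c * b n x - (f x + c * g x))
         \<le> L2_norm M (\<lambda>x. a n x - f x) + norm c * L2_norm M (\<lambda>x. b n x - g x)"
        unfolding L2_norm_cmult[symmetric]
        using L2_norm_triangle[OF L2_diff[OF V'(1)[OF a(1)[of n]] L(1)]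
            L2_cmult[OF L2_diff[OF V'(1)[OF b(1)[of n]] L(2)], of c]]
        by (simp add: algebra_simps)
      show "(\<lambda>n. L2_norm M (\<lambda>x. a n x - f x) + norm c * L2_norm M (\<lambda>x. b n x - g x)) \<longlonglongrightarrow> 0"
        using tendsto_add[OF a(2) tendsto_mult_left[OF b(2), of "norm c"]] by simp
    qed simp
  qed
qed (simp add: L2_closure_L2)

lemma L2_orth_closure:
  assumes S: "S \<subseteq> L2 M" and r: "r \<in> L2_orth M S"
  shows "r \<in> L2_orth M (L2_closure M S)"
  unfolding L2_orth_def
proof safe
  show rL: "r \<in> L2 M" using r by (simp add: L2_orth_def)
  fix f assume f: "f \<in> L2_closure M S"
  obtain g where g: "\<And>n. g n \<in> S" "(\<lambda>n. L2_norm M (\<lambda>x. g n x - f x)) \<longlonglongrightarrow> 0"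
    using L2_closure_approx[OF f] by blast
  have "L2_inner M (g n) r = 0" for n
    using r g(1)[of n] by (subst L2_inner_commute) (simp add: L2_orth_def)
  moreover have "(\<lambda>n. L2_inner M (g n) r) \<longlonglongrightarrow> L2_inner M f r"
    by (rule L2_inner_tendsto_left[OF _ _ rL g(2)]) (use g(1) S f in \<open>auto simp: L2_closure_L2\<close>)
  ultimately have "L2_inner M f r = 0" by (simp add: LIMSEQ_const_iff)
  then show "L2_inner M r f = 0" by (subst L2_inner_commute) simp
qed

lemma L2_subspace_orth:
  assumes "V \<subseteq> L2 M"
  shows "L2_subspace M (L2_orth M V)"
  unfolding L2_subspace_def
proof (intro conjI ballI allI subsetI)
  show "(\<lambda>x. 0) \<in> L2_orth M V" by (simp add: L2_orth_def L2_inner_def)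
  show "f \<in> L2_orth M V \<Longrightarrow> f \<in> L2 M" for f by (simp add: L2_orth_def)
  fix f g c assume fg: "f \<in> L2_orth M V" "g \<in> L2_orth M V"
  then have L: "f \<in> L2 M" "(\<lambda>x. c * g x) \<in> L2 M" by (auto simp: L2_orth_def L2_cmult)
  have "L2_inner M (\<lambda>x. f x + c * g x) v = 0" if "v \<in> V" for v
    using that fg assms by (simp add: L2_inner_add_left[OF L] L2_inner_cmult_left L2_orth_def subsetD)
  then show "(\<lambda>x. f x + c * g x) \<in> L2_orth M V"
    using L2_add[OF L] by (simp add: L2_orth_def)
qed

lemma L2_parallelogram:
  assumes "a \<in> L2 M" "b \<in> L2 M"
  shows "(L2_norm M (\<lambda>x. a x + b x))\<^sup>2 + (L2_norm M (\<lambda>x. a x - b x))\<^sup>2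
    = 2 * (L2_norm M a)\<^sup>2 + 2 * (L2_norm M b)\<^sup>2"
  using assms by (simp add: L2_norm_add_sq L2_norm_diff_sq)

text \<open>
  By the parallelogram law almost nearest points to $f$ form a Cauchy sequence, even when the
  convex set shrinks on the way, since the distances to $f$ increase to a finite limit. For a
  constant sequence of sets this is the existence of a nearest point. For a decreasing
  sequence of sets at bounded distance from $f$ it gives a point that all their closures share.
\<close>

lemma L2_nearest_nested:
  fixes S :: "nat \<Rightarrow> ('a \<Rightarrow> complex) set"
  assumes fin: "finite_measure M" and f: "f \<in> L2 M"
    and S: "\<And>n. S n \<subseteq> L2 M" "\<And>n. S n \<noteq> {}" "\<And>n. S (Suc n) \<subseteq> S n"
    and mid: "\<And>n a b. a \<in> S n \<Longrightarrow> b \<in> S n \<Longrightarrow> (\<lambda>x. (a x + b x) / 2) \<in> S n"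
    and bdd: "\<And>n. \<exists>a\<in>S n. L2_norm M (\<lambda>x. f x - a x) \<le> B"
  shows "\<exists>x\<in>L2 M. \<exists>xs. (\<forall>n. xs n \<in> S n) \<and> (\<lambda>n. L2_norm M (\<lambda>t. xs n t - x t)) \<longlonglongrightarrow> 0 \<and>
    (\<forall>y. (\<forall>n. y \<in> S n) \<longrightarrow> L2_norm M (\<lambda>t. f t - x t) \<le> L2_norm M (\<lambda>t. f t - y t))"
proof -
  define d where "d n = (INF a\<in>S n. L2_norm M (\<lambda>x. f x - a x))" for n
  have bb: "bdd_below ((\<lambda>a. L2_norm M (\<lambda>x. f x - a x)) ` S n)" for n
    by (rule bdd_belowI[of _ 0]) auto
  have dle: "d n \<le> L2_norm M (\<lambda>x. f x - a x)" if "a \<in> S n" for n a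
    unfolding d_def using bb that by (rule cINF_lower)
  have d0: "0 \<le> d n" for n
    unfolding d_def by (rule cINF_greatest) (use S(2) in auto)
  have "incseq d"
    unfolding incseq_Suc_iff d_def by (intro allI cINF_superset_mono[OF S(2) bb S(3)]) simp
  moreover have "d n \<le> B" for n
    using bdd[of n] dle[of _ n] by (meson order_trans)
  ultimately obtain D where D: "d \<longlonglongrightarrow> D" "\<And>n. d n \<le> D"
    using incseq_convergent[of d B] by metis
  define e where "e n = inverse (real (Suc n))" for n
  have e: "e \<longlonglongrightarrow> 0" "\<And>n. e n > 0" unfolding e_def by (rule LIMSEQ_inverse_real_of_nat) simp
  have "\<exists>a\<in>S n. L2_norm M (\<lambda>x. f x - a x) < d n + e n" for n
    using cINF_less_iff[OF S(2) bb, of n "d n + e n"] e(2)[of n] by (simp add: d_def)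
  then obtain xs where xs: "\<And>n. xs n \<in> S n" "\<And>n. L2_norm M (\<lambda>x. f x - xs n x) < d n + e n"
    by metis
  have xsL: "xs n \<in> L2 M" for n using xs(1) S(1) by blast
  define w where "w n = 2 * (d n + e n)\<^sup>2 - 2 * (d n)\<^sup>2 " for n
  have lime: "(\<lambda>n. d n + e n) \<longlonglongrightarrow> D" using tendsto_add[OF D(1) e(1)] by simp
  define u where "u n = 2 * (d n + e n)\<^sup>2" for n
  have limu: "u \<longlonglongrightarrow> 2 * D\<^sup>2" unfolding u_def by (intro tendsto_intros lime)
  have limv: "(\<lambda>n. 4 * (d n)\<^sup>2) \<longlonglongrightarrow> 4 * D\<^sup>2" by (intro tendsto_intros D)
  have SS: "S m \<subseteq> S n" if "n \<le> m" for n m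
    using lift_Suc_antimono_le[of S n m] S(3) that by auto
  have key: "(L2_norm M (\<lambda>t. xs m t - xs n t))\<^sup>2 \<le> u n + u m - 4 * (d n)\<^sup>2" if "n \<le> m" for n m
  proof -
    let ?a = "\<lambda>t. f t - xs n t" and ?b = "\<lambda>t. f t - xs m t"
    have L: "?a \<in> L2 M" "?b \<in> L2 M" by (intro L2_diff f xsL)+
    have "(\<lambda>t. (xs n t + xs m t) / 2) \<in> S n"
      using xs(1) SS[OF that] by (intro mid) auto
    then have "d n \<le> L2_norm M (\<lambda>t. f t - (xs n t + xs m t) / 2)" by (rule dle)
    also have "\<dots> = L2_norm M (\<lambda>t. (1/2) * (?a t + ?b t))"
      by (intro arg_cong[where f = "L2_norm M"] ext) (simp add: field_simps)
    also have "\<dots> = L2_norm M (\<lambda>t. ?a t + ?b t) / 2"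
      by (subst L2_norm_cmult) simp
    finally have "2 * d n \<le> L2_norm M (\<lambda>t. ?a t + ?b t)" by simp
    then have "(2 * d n)\<^sup>2 \<le> (L2_norm M (\<lambda>t. ?a t + ?b t))\<^sup>2"
      using d0[of n] by (intro power_mono) auto
    then have 1: "4 * (d n)\<^sup>2 \<le> (L2_norm M (\<lambda>t. ?a t + ?b t))\<^sup>2" by (simp add: power_mult_distrib)
    have 2: "(L2_norm M ?a)\<^sup>2 \<le> (d n + e n)\<^sup>2" "(L2_norm M ?b)\<^sup>2 \<le> (d m + e m)\<^sup>2"
      by (intro power_mono less_imp_le xs(2) L2_norm_nonneg)+
    have "(\<lambda>t. ?a t - ?b t) = (\<lambda>t. xs m t - xs n t)" by auto
    then show ?thesis
      using L2_parallelogram[OF L] 1 2 unfolding u_def by simp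
  qed
  have "\<exists>x\<in>L2 M. (\<lambda>n. L2_norm M (\<lambda>t. xs n t - x t)) \<longlonglongrightarrow> 0"
  proof (rule L2_complete[OF fin xsL])
    fix r :: real assume r: "r > 0"
    then have r2: "r\<^sup>2 / 8 > 0" by simp
    have "eventually (\<lambda>n. \<bar>u n - 2 * D\<^sup>2\<bar> < r\<^sup>2/8 \<and> \<bar>4 * (d n)\<^sup>2 - 4 * D\<^sup>2\<bar> < r\<^sup>2/8) sequentially"
      using tendstoD[OF limu r2] tendstoD[OF limv r2] by eventually_elim (auto simp: dist_real_def)
    then obtain N where N: "\<And>n. n \<ge> N \<Longrightarrow> \<bar>u n - 2 * D\<^sup>2\<bar> < r\<^sup>2/8 \<and> \<bar>4 * (d n)\<^sup>2 - 4 * D\<^sup>2\<bar> < r\<^sup>2/8"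
      by (auto simp: eventually_sequentially)
    have *: "L2_norm M (\<lambda>t. xs m t - xs n t) < r" if "n \<ge> N" "n \<le> m" for n m
    proof -
      have "\<bar>u m - 2 * D\<^sup>2\<bar> < r\<^sup>2/8" using N[of m] that by simp
      then have "(L2_norm M (\<lambda>t. xs m t - xs n t))\<^sup>2 \<le> 3 * (r\<^sup>2 / 8)"
        using key[OF that(2)] N[OF that(1)] by (auto simp: abs_if split: if_splits)
      then have "(L2_norm M (\<lambda>t. xs m t - xs n t))\<^sup>2 < r\<^sup>2" using r2 by linarith
      then show ?thesis using r by (simp add: power2_less_imp_less)
    qed
    show "\<exists>N. \<forall>m\<ge>N. \<forall>n\<ge>N. L2_norm M (\<lambda>t. xs m t - xs n t) < r"
    proof (intro exI[of _ N] allI impI)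
      fix m n assume "m \<ge> N" "n \<ge> N"
      then show "L2_norm M (\<lambda>t. xs m t - xs n t) < r"
        using *[of n m] *[of m n] L2_norm_minus_commute[of M "xs m" "xs n"] by (cases "n \<le> m") auto
    qed
  qed
  then obtain x where x: "x \<in> L2 M" "(\<lambda>n. L2_norm M (\<lambda>t. xs n t - x t)) \<longlonglongrightarrow> 0" by blast
  have "(\<lambda>n. L2_norm M (\<lambda>t. f t - xs n t)) \<longlonglongrightarrow> L2_norm M (\<lambda>t. f t - x t)"
  proof (rule L2_norm_tendsto)
    show "(\<lambda>n. L2_norm M (\<lambda>t. f t - xs n t - (f t - x t))) \<longlonglongrightarrow> 0"
      using x(2) L2_norm_minus_commute[of M x] by simp
  qed (intro L2_diff f xsL x)+
  then have *: "L2_norm M (\<lambda>t. f t - x t) \<le> D"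
    by (rule LIMSEQ_le[OF _ lime]) (use xs(2) in \<open>auto intro: less_imp_le\<close>)
  have "L2_norm M (\<lambda>t. f t - x t) \<le> L2_norm M (\<lambda>t. f t - y t)" if "\<forall>n. y \<in> S n" for y
  proof -
    have "D \<le> L2_norm M (\<lambda>t. f t - y t)"
      by (rule LIMSEQ_le_const2[OF D(1)]) (use dle that in auto)
    with * show ?thesis by simp
  qed
  with x xs(1) show ?thesis by blast
qed

text \<open>
  Moving from a nearest point towards a point of \<open>C\<close> cannot decrease the distance to \<open>f\<close> to
  first order.
\<close>

lemma L2_convex_nearest:
  assumes fin: "finite_measure M" and f: "f \<in> L2 M" and C: "C \<subseteq> L2 M" "C \<noteq> {}"
    and conv: "\<And>a b t. a \<in> C \<Longrightarrow> b \<in> C \<Longrightarrow> 0 \<le> t \<Longrightarrow> t \<le> 1 \<Longrightarrow>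
      (\<lambda>x. a x + of_real t * (b x - a x)) \<in> C"
  shows "\<exists>x\<in>L2_closure M C. \<forall>y\<in>C. Re (L2_inner M (\<lambda>t. f t - x t) (\<lambda>t. y t - x t)) \<le> 0"
proof -
  obtain c where c: "c \<in> C" using C by blast
  have "\<exists>x\<in>L2 M. \<exists>xs. (\<forall>n. xs n \<in> C) \<and> (\<lambda>n. L2_norm M (\<lambda>t. xs n t - x t)) \<longlonglongrightarrow> 0 \<and>
    (\<forall>y. (\<forall>n::nat. y \<in> C) \<longrightarrow> L2_norm M (\<lambda>t. f t - x t) \<le> L2_norm M (\<lambda>t. f t - y t))"
  proof (rule L2_nearest_nested[OF fin f])
    show "(\<lambda>x. (a x + b x) / 2) \<in> C" if "a \<in> C" "b \<in> C" for a b
      using conv[OF that, of "1/2"] by (simp add: field_simps)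
    show "\<exists>a\<in>C. L2_norm M (\<lambda>x. f x - a x) \<le> L2_norm M (\<lambda>x. f x - c x)" using c by blast
  qed (use C in auto)
  then obtain x xs where x: "x \<in> L2 M" "\<And>n. xs n \<in> C" "(\<lambda>n. L2_norm M (\<lambda>t. xs n t - x t)) \<longlonglongrightarrow> 0"
    and near: "\<And>y. y \<in> C \<Longrightarrow> L2_norm M (\<lambda>t. f t - x t) \<le> L2_norm M (\<lambda>t. f t - y t)"
    by auto
  have xsL: "xs n \<in> L2 M" for n using x(2) C by auto
  have "Re (L2_inner M (\<lambda>t. f t - x t) (\<lambda>t. y t - x t)) \<le> 0" if y: "y \<in> C" for y
  proof -
    have yL: "y \<in> L2 M" using y C by auto
    define I N2 where "I = Re (L2_inner M (\<lambda>t. f t - x t) (\<lambda>t. y t - x t))"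
      and "N2 = (L2_norm M (\<lambda>t. y t - x t))\<^sup>2"
    have step: "2 * I \<le> s * N2" if s: "0 < s" "s \<le> 1" for s
    proof -
      let ?g = "\<lambda>t. f t - x t" and ?h = "\<lambda>t. complex_of_real s * (y t - x t)"
      have L: "?g \<in> L2 M" "?h \<in> L2 M" by (intro L2_diff L2_cmult f x yL)+
      have "(\<lambda>n. L2_norm M (\<lambda>t. f t - (xs n t + of_real s * (y t - xs n t))))
          \<longlonglongrightarrow> L2_norm M (\<lambda>t. ?g t - ?h t)"
      proof (rule L2_norm_tendsto)
        show "(\<lambda>n. L2_norm M (\<lambda>t. f t - (xs n t + of_real s * (y t - xs n t)) - (?g t - ?h t))) \<longlonglongrightarrow> 0"
        proof -
          have "(\<lambda>t. f t - (xs n t + of_real s * (y t - xs n t)) - (?g t - ?h t))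
            = (\<lambda>t. of_real (s - 1) * (xs n t - x t))" for n
            by (auto simp: algebra_simps)
          then have "(\<lambda>n. L2_norm M (\<lambda>t. f t - (xs n t + of_real s * (y t - xs n t)) - (?g t - ?h t)))
             = (\<lambda>n. \<bar>s - 1\<bar> * L2_norm M (\<lambda>t. xs n t - x t))"
            by (simp add: L2_norm_cmult del: of_real_diff)
          then show ?thesis using tendsto_mult_right_zero[OF x(3)] by simp
        qed
      qed (intro L2_diff L2_add L2_cmult f x yL xsL)+
      then have "L2_norm M ?g \<le> L2_norm M (\<lambda>t. ?g t - ?h t)"
        by (rule LIMSEQ_le_const) (use near conv[OF x(2) y] s in auto)
      then have "(L2_norm M ?g)\<^sup>2 \<le> (L2_norm M (\<lambda>t. ?g t - ?h t))\<^sup>2"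
        by (intro power_mono) auto
      also have "\<dots> = (L2_norm M ?g)\<^sup>2 - 2 * (s * I) + s\<^sup>2 * N2"
        unfolding L2_norm_diff_sq[OF L] I_def N2_def L2_inner_cmult_right L2_norm_cmult
        by (simp add: power_mult_distrib)
      finally have "s * (2 * I) \<le> s * (s * N2)" by (simp add: power2_eq_square algebra_simps)
      then show ?thesis using s by simp
    qed
    have "((\<lambda>s. s * N2) \<longlongrightarrow> 0 * N2) (at_right 0)" by (intro tendsto_intros)
    then have "2 * I \<le> 0 * N2"
    proof (rule tendsto_lowerbound)
      show "\<forall>\<^sub>F s in at_right 0. 2 * I \<le> s * N2"
        unfolding eventually_at_right_field using step by (intro exI[of _ 1]) auto
    qed simp
    then show ?thesis by (simp add: I_def)
  qed
  moreover have "x \<in> L2_closure M C" by (rule L2_closureI[OF x])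
  ultimately show ?thesis by blast
qed

lemma Re_mult_bounded_imp_0:
  fixes w :: complex
  assumes "\<And>c. Re (cnj c * w) \<le> K"
  shows "w = 0"
proof (rule ccontr)
  assume "w \<noteq> 0"
  then have pos: "(norm w)\<^sup>2 > 0" by simp
  have "cnj (of_real t * w) * w = of_real (t * (norm w)\<^sup>2)" for t
    unfolding of_real_mult complex_norm_square by (simp add: mult_ac)
  then have "Re (cnj (of_real t * w) * w) = t * (norm w)\<^sup>2" for t
    by (metis Re_complex_of_real)
  then have "t * (norm w)\<^sup>2 \<le> K" for t using assms by metis
  from this[of "(\<bar>K\<bar> + 1) / (norm w)\<^sup>2"] show False using pos by simp
qed

text \<open>
  In the variational inequality \<open>y\<close> may be replaced by any complex multiple, which forces
  orthogonality.
\<close>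

lemma L2_projection:
  assumes fin: "finite_measure M" and f: "f \<in> L2 M" and V: "L2_subspace M V"
  shows "\<exists>x\<in>L2_closure M V. (\<lambda>t. f t - x t) \<in> L2_orth M (L2_closure M V)"
proof -
  note V' = L2_subspaceD[OF V]
  have sub: "V \<subseteq> L2 M" using V'(1) by auto
  obtain x where x: "x \<in> L2_closure M V"
    and var: "\<And>y. y \<in> V \<Longrightarrow> Re (L2_inner M (\<lambda>t. f t - x t) (\<lambda>t. y t - x t)) \<le> 0"
  proof -
    have "\<exists>x\<in>L2_closure M V. \<forall>y\<in>V. Re (L2_inner M (\<lambda>t. f t - x t) (\<lambda>t. y t - x t)) \<le> 0"
    proof (rule L2_convex_nearest[OF fin f sub])
      show "(\<lambda>x. a x + of_real t * (b x - a x)) \<in> V" if "a \<in> V" "b \<in> V" for a b t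
        using V'(3)[OF that(1) V'(5)[OF that(2) that(1)]] .
    qed (use V' in auto)
    then show ?thesis using that by blast
  qed
  have xL: "x \<in> L2 M" using x by (rule L2_closure_L2)
  let ?r = "\<lambda>t. f t - x t"
  have rL: "?r \<in> L2 M" by (intro L2_diff f xL)
  have "L2_inner M ?r y = 0" if y: "y \<in> V" for y
  proof (rule Re_mult_bounded_imp_0)
    fix c
    have yL: "y \<in> L2 M" using y by (rule V')
    show "Re (cnj c * L2_inner M ?r y) \<le> Re (L2_inner M ?r x)"
      using var[OF V'(6)[OF y, of c]]
      by (simp add: L2_inner_diff_right[OF L2_cmult[OF yL] xL rL] L2_inner_cmult_right)
  qed
  then have "?r \<in> L2_orth M V" using rL by (auto simp: L2_orth_def)
  then show ?thesis using x L2_orth_closure[OF sub] by blast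
qed

text \<open>
  After projection of \<open>y\<close> onto the closure of \<open>V\<close> the remainder is orthogonal to both
  subspaces, hence it vanishes. With uniqueness of Fourier coefficients as the hypothesis
  \<open>total\<close> this identifies spaces that are given by their frequencies.
\<close>

lemma L2_closure_if_orth:
  assumes fin: "finite_measure M" and V: "L2_subspace M V" and W: "W \<subseteq> L2 M"
    and VW: "\<And>f g. f \<in> V \<Longrightarrow> g \<in> W \<Longrightarrow> L2_inner M f g = 0"
    and total: "\<And>r. r \<in> L2_orth M V \<Longrightarrow> r \<in> L2_orth M W \<Longrightarrow> AE x in M. r x = 0"
    and y: "y \<in> L2_orth M W"
  shows "y \<in> L2_closure M V"
proof -
  have yL: "y \<in> L2 M" using y by (simp add: L2_orth_def)
  have sub: "V \<subseteq> L2 M" using L2_subspaceD(1)[OF V] by auto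
  obtain x where x: "x \<in> L2_closure M V" "(\<lambda>t. y t - x t) \<in> L2_orth M (L2_closure M V)"
    using L2_projection[OF fin yL V] by blast
  have xL: "x \<in> L2 M" using x by (simp add: L2_closure_L2)
  have "L2_inner M x g = 0" if "g \<in> W" for g
  proof -
    have "g \<in> L2_orth M V"
      using that W VW by (auto simp: L2_orth_def L2_inner_commute[of M g])
    from L2_orth_closure[OF sub this] x(1) show ?thesis
      by (subst L2_inner_commute) (auto simp: L2_orth_def)
  qed
  then have "(\<lambda>t. y t - x t) \<in> L2_orth M W"
    using y W xL by (auto simp: L2_orth_def L2_inner_diff_left L2_diff subsetD)
  moreover have "(\<lambda>t. y t - x t) \<in> L2_orth M V"
    using x(2) L2_closure_subset[OF sub] by (auto simp: L2_orth_def)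
  ultimately have "AE t in M. y t - x t = 0" using total by blast
  then have "AE t in M. y t = x t" by simp
  then show ?thesis by (rule L2_closure_cong_AE[OF sub x(1) yL])
qed

text \<open>
  The function $\max(0, |x| - e)$ is bounded by $|k_n - x|$ for every $n$, so its norm
  is zero.
\<close>

lemma L2_limit_bounded:
  assumes k: "\<And>n. k n \<in> L2 M" "\<And>n. AE t in M. norm (k n t) \<le> e" and x: "x \<in> L2 M"
    and lim: "(\<lambda>n. L2_norm M (\<lambda>t. k n t - x t)) \<longlonglongrightarrow> 0"
  shows "AE t in M. norm (x t) \<le> e"
proof -
  define p where "p t = complex_of_real (max 0 (norm (x t) - e))" for t
  have pm: "p \<in> borel_measurable M"
    unfolding p_def using x by measurable
  have le: "L2_norm M p \<le> L2_norm M (\<lambda>t. k n t - x t)" for n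
  proof (rule L2_norm_mono[OF pm L2_diff[OF k(1) x]])
    show "AE t in M. norm (p t) \<le> norm (k n t - x t)"
      using k(2)[of n]
    proof eventually_elim
      case (elim t)
      then show ?case
        using norm_triangle_ineq2[of "x t" "k n t"] norm_minus_commute[of "x t" "k n t"]
        by (simp add: p_def)
    qed
  qed
  have "L2_norm M p \<le> 0"
    by (rule LIMSEQ_le_const[OF lim]) (use le in auto)
  then have 0: "L2_norm M p = 0" using L2_norm_nonneg[of M p] by linarith
  have "p \<in> L2 M"
  proof (rule L2_bound[OF pm L2_integrable[OF L2_diff[OF k(1)[of 0] x]]])
    show "AE t in M. (norm (p t))\<^sup>2 \<le> (norm (k 0 t - x t))\<^sup>2"
      using k(2)[of 0]
    proof eventually_elim
      case (elim t)
      then have "norm (p t) \<le> norm (k 0 t - x t)"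
        using norm_triangle_ineq2[of "x t" "k 0 t"] norm_minus_commute[of "x t" "k 0 t"]
        by (simp add: p_def)
      then show ?case by (rule power_mono) simp
    qed
  qed
  from L2_norm_eq_0_AE[OF this 0] show ?thesis
    by eventually_elim (auto simp: p_def max_def split: if_splits)
qed

section \<open>Laurent polynomials\<close>

text \<open>
  The linear span of the monomials $z^i$ with $i \in I$, as functions on the plane in which
  negative powers have the value $0$ at the origin. Products of Laurent polynomials are therefore
  Laurent polynomials only away from the origin.
\<close>

inductive_set laurent :: "int set \<Rightarrow> (complex \<Rightarrow> complex) set" for I where
  zero: "(\<lambda>z. 0) \<in> laurent I"
| step: "f \<in> laurent I \<Longrightarrow> i \<in> I \<Longrightarrow> (\<lambda>z. f z + c * z powi i) \<in> laurent I"

lemma laurent_term: "i \<in> I \<Longrightarrow> (\<lambda>z. c * z powi i) \<in> laurent I"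
  using laurent.step[OF laurent.zero, of i I c] by simp

lemma laurent_powi: "i \<in> I \<Longrightarrow> (\<lambda>z. z powi i) \<in> laurent I"
  using laurent_term[of i I 1] by simp

lemma laurent_mono: "f \<in> laurent I \<Longrightarrow> I \<subseteq> J \<Longrightarrow> f \<in> laurent J"
  by (induction rule: laurent.induct) (auto intro: laurent.intros)

lemma laurent_add: "f \<in> laurent I \<Longrightarrow> g \<in> laurent I \<Longrightarrow> (\<lambda>z. f z + g z) \<in> laurent I"
proof (induction f rule: laurent.induct)
  case (step f i c)
  then show ?case using laurent.step[of "\<lambda>z. f z + g z" I i c] by (simp add: algebra_simps)
qed simp

lemma laurent_cmult: "f \<in> laurent I \<Longrightarrow> (\<lambda>z. c * f z) \<in> laurent I"
proof (induction f rule: laurent.induct)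
  case (step f i d)
  then show ?case using laurent.step[of "\<lambda>z. c * f z" I i "c * d"] by (simp add: algebra_simps)
qed (auto intro: laurent.zero)

lemma laurent_diff: "f \<in> laurent I \<Longrightarrow> g \<in> laurent I \<Longrightarrow> (\<lambda>z. f z - g z) \<in> laurent I"
  using laurent_add[of f I "\<lambda>z. (-1) * g z"] laurent_cmult[of g I "-1"] by simp

lemma laurent_sum: "(\<And>j. j \<in> F \<Longrightarrow> f j \<in> laurent I) \<Longrightarrow> (\<lambda>z. \<Sum>j\<in>F. f j z) \<in> laurent I"
  by (induction F rule: infinite_finite_induct) (auto intro: laurent.zero laurent_add)

lemma laurent_sum_form:
  "f \<in> laurent I \<Longrightarrow> \<exists>F a. finite F \<and> F \<subseteq> I \<and> f = (\<lambda>z. \<Sum>i\<in>F. a i * z powi i)"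
proof (induction f rule: laurent.induct)
  case zero
  show ?case by (intro exI[of _ "{}"]) auto
next
  case (step f i c)
  then obtain F a where F: "finite F" "F \<subseteq> I" "f = (\<lambda>z. \<Sum>i\<in>F. a i * z powi i)" by blast
  let ?a = "\<lambda>j. (if j \<in> F then a j else 0) + (if j = i then c else 0)"
  have "f z + c * z powi i = (\<Sum>j\<in>insert i F. ?a j * z powi j)" for z
  proof -
    have "(\<Sum>j\<in>insert i F. ?a j * z powi j) = (\<Sum>j\<in>insert i F. if j \<in> F then a j * z powi j else 0)
        + (\<Sum>j\<in>insert i F. if j = i then c * z powi j else 0)"
      unfolding sum.distrib[symmetric] by (intro sum.cong) (auto simp: algebra_simps)
    also have "(\<Sum>j\<in>insert i F. if j \<in> F then a j * z powi j else 0) = f z"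
      using F(1) unfolding F(3) by (intro sum.mono_neutral_cong_right) auto
    also have "(\<Sum>j\<in>insert i F. if j = i then c * z powi j else 0) = c * z powi i"
      using F(1) by (subst sum.delta) auto
    finally show ?thesis by simp
  qed
  then show ?case
    using F step(2) by (intro exI[of _ "insert i F"] exI[of _ ?a]) auto
qed

lemma laurent_mult_powi:
  "f \<in> laurent I \<Longrightarrow> \<exists>h\<in>laurent ((\<lambda>i. i + j) ` I). \<forall>z. z \<noteq> 0 \<longrightarrow> h z = f z * z powi j"
proof (induction f rule: laurent.induct)
  case zero
  show ?case by (intro bexI[OF _ laurent.zero]) auto
next
  case (step f i c)
  then obtain h where h: "h \<in> laurent ((\<lambda>i. i + j) ` I)" "\<And>z. z \<noteq> 0 \<Longrightarrow> h z = f z * z powi j" by blast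
  show ?case
    by (rule bexI[OF _ laurent.step[OF h(1), of "i + j" c]])
       (use h(2) step in \<open>auto simp: algebra_simps power_int_add\<close>)
qed

lemma laurent_mult:
  assumes "f \<in> laurent I" "g \<in> laurent J" "\<And>i j. i \<in> I \<Longrightarrow> j \<in> J \<Longrightarrow> i + j \<in> K"
  shows "\<exists>h\<in>laurent K. \<forall>z. z \<noteq> 0 \<longrightarrow> h z = f z * g z"
  using assms(2,3)
proof (induction g rule: laurent.induct)
  case zero
  show ?case by (intro bexI[OF _ laurent.zero]) auto
next
  case (step g j c)
  then obtain h where h: "h \<in> laurent K" "\<And>z. z \<noteq> 0 \<Longrightarrow> h z = f z * g z" by blast
  obtain k where k: "k \<in> laurent ((\<lambda>i. i + j) ` I)" "\<And>z. z \<noteq> 0 \<Longrightarrow> k z = f z * z powi j"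
    using laurent_mult_powi[OF assms(1)] by blast
  have "k \<in> laurent K" using k(1) by (rule laurent_mono) (use step in auto)
  then show ?case
    by (intro bexI[OF _ laurent_add[OF h(1) laurent_cmult[of k K c]]])
       (use h k in \<open>auto simp: algebra_simps\<close>)
qed

lemma laurent_compose:
  assumes f: "f \<in> laurent I" and g: "\<And>i. i \<in> I \<Longrightarrow> \<exists>h\<in>laurent J. \<forall>z\<in>S. h z = g z powi i"
  shows "\<exists>h\<in>laurent J. \<forall>z\<in>S. h z = f (g z)"
  using f
proof (induction f rule: laurent.induct)
  case zero
  show ?case by (intro bexI[OF _ laurent.zero]) auto
next
  case (step f i c)
  then obtain h where h: "h \<in> laurent J" "\<And>z. z \<in> S \<Longrightarrow> h z = f (g z)" by blast
  obtain k where k: "k \<in> laurent J" "\<And>z. z \<in> S \<Longrightarrow> k z = g z powi i" using g[OF step(2)] by blast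
  show ?case
    by (rule bexI[OF _ laurent_add[OF h(1) laurent_cmult[OF k(1)]]]) (use h k in auto)
qed

lemma laurent_borel [measurable]: "f \<in> laurent I \<Longrightarrow> f \<in> borel_measurable borel"
proof (induction f rule: laurent.induct)
  case (step f i c)
  have "(\<lambda>z::complex. z powi i) \<in> borel_measurable borel"
    unfolding power_int_def by (cases "i \<ge> 0") auto
  with step show ?case by measurable
qed auto

lemma laurent_bounded:
  assumes "f \<in> laurent I" "r > 0"
  shows "\<exists>B. \<forall>z\<in>sphere 0 r. norm (f z) \<le> B"
  using assms(1)
proof (induction f rule: laurent.induct)
  case (step f i c)
  then obtain B where B: "\<And>z. z \<in> sphere 0 r \<Longrightarrow> norm (f z) \<le> B" by blast
  show ?case
  proof (intro exI ballI)
    fix z :: complex assume z: "z \<in> sphere 0 r"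
    have "norm (f z + c * z powi i) \<le> norm (f z) + norm (c * z powi i)" by (rule norm_triangle_ineq)
    also have "\<dots> \<le> B + norm c * r powi i"
      using B[OF z] z by (simp add: norm_mult norm_power_int)
    finally show "norm (f z + c * z powi i) \<le> B + norm c * r powi i" .
  qed
qed auto

lemma laurent_continuous: "f \<in> laurent I \<Longrightarrow> 0 \<notin> S \<Longrightarrow> continuous_on S f"
proof (induction f rule: laurent.induct)
  case (step f i c)
  then show ?case by (auto intro!: continuous_intros)
qed auto

section \<open>Integration over the unit circle\<close>

abbreviation \<T> :: "complex measure" where "\<T> \<equiv> circle_measure"

abbreviation \<U> :: "real measure" where "\<U> \<equiv> uniform_measure lborel {0..2*pi}"

lemma prob_space_\<U>: "prob_space \<U>"
  by (rule prob_space_uniform_measure) auto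

lemma cis_measurable_\<U>: "cis \<in> measurable \<U> (restrict_space borel (sphere 0 1))"
  by (rule measurable_restrict_space2)
     (auto simp: measurable_cong_sets[OF sets_uniform_angle refl]
       intro!: borel_measurable_continuous_onI continuous_intros)

lemma prob_space_circle: "prob_space \<T>"
  unfolding circle_measure_def by (rule prob_space.prob_space_distr[OF prob_space_\<U> cis_measurable_\<U>])

interpretation circle: prob_space \<T> by (rule prob_space_circle)

lemma finite_measure_circle: "finite_measure \<T>" by unfold_locales

lemma sets_circle [measurable_cong]: "sets \<T> = sets (restrict_space borel (sphere 0 1))"
  by (simp add: circle_measure_def)

lemma space_circle [simp]: "space \<T> = sphere 0 1"
  by (simp add: circle_measure_def space_restrict_space)

lemma AE_circleI: "(\<And>z. norm z = 1 \<Longrightarrow> P z) \<Longrightarrow> AE z in \<T>. P z"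
  by (rule AE_I2) auto

lemma borel_imp_circle: "f \<in> borel_measurable borel \<Longrightarrow> f \<in> borel_measurable \<T>"
  using measurable_restrict_space1[of f borel borel "sphere 0 1"]
  by (simp only: measurable_cong_sets[OF sets_circle refl])

lemma continuous_imp_circle:
  fixes f :: "complex \<Rightarrow> 'b::topological_space"
  shows "continuous_on (sphere 0 1) f \<Longrightarrow> f \<in> borel_measurable \<T>"
  using borel_measurable_continuous_on_restrict[of "sphere 0 1" f]
  by (simp only: measurable_cong_sets[OF sets_circle refl])

lemma continuous_circle_bounded:
  fixes f :: "complex \<Rightarrow> complex"
  assumes "continuous_on (sphere 0 1) f"
  shows "\<exists>b. \<forall>z\<in>sphere 0 1. norm (f z) \<le> b"
proof -
  obtain b where "\<forall>x\<in>f ` sphere 0 1. norm x \<le> b"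
    using compact_imp_bounded[OF compact_continuous_image[OF assms compact_sphere]] by (auto simp only: bounded_iff)
  then show ?thesis by auto
qed

lemma continuous_circle_L2:
  assumes "continuous_on (sphere 0 1) f"
  shows "f \<in> L2 \<T>"
proof -
  obtain b where "\<forall>z\<in>sphere 0 1. norm (f z) \<le> b" using continuous_circle_bounded[OF assms] by blast
  then show ?thesis
    by (intro L2_bounded[OF finite_measure_circle continuous_imp_circle[OF assms], of b] AE_circleI) auto
qed

lemma circle_integral:
  fixes f :: "complex \<Rightarrow> complex"
  assumes "f \<in> borel_measurable \<T>"
  shows "(\<integral>z. f z \<partial>\<T>) = 1/(2*pi) * (LBINT t:{0..2*pi}. f (cis t))"
proof -
  have f: "f \<in> borel_measurable (restrict_space borel (sphere 0 1))"
    using assms by (simp only: measurable_cong_sets[OF sets_circle refl])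
  have "(\<lambda>t. f (cis t)) \<in> borel_measurable \<U>"
    by (rule measurable_compose[OF cis_measurable_\<U> f])
  then have m: "(\<lambda>t. f (cis t)) \<in> borel_measurable borel"
    by (simp only: measurable_cong_sets[OF sets_uniform_angle refl])
  show ?thesis
    unfolding integral_uniform_angle[OF m, symmetric] unfolding circle_measure_def
    by (rule integral_distr[OF cis_measurable_\<U> f])
qed

lemma circle_integral_powi: "(\<integral>z. z powi n \<partial>\<T>) = (if n = 0 then 1 else 0)"
proof (cases "n = 0")
  case True
  then show ?thesis using circle.prob_space by simp
next
  case False
  have "(\<integral>z. z powi n \<partial>\<T>) = 1/(2*pi) * (LBINT t:{0..2*pi}. cis (of_int n * t))"
    using laurent_borel[OF laurent_powi[of n UNIV]]
    by (subst circle_integral) (auto intro: borel_imp_circle simp: cis_power_int)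
  also have "(LBINT t:{0..2*pi}. cis (of_int n * t)) = (LBINT t=0..2*pi. cis (of_int n * t))"
    by (simp add: interval_integral_Icc zero_ereal_def)
  also have "\<dots> = cis (of_int n * (2*pi)) / (\<i> * of_int n) - cis (of_int n * 0) / (\<i> * of_int n)"
    unfolding zero_ereal_def
  proof (rule interval_integral_FTC_finite)
    show "continuous_on {min 0 (2 * pi)..max 0 (2 * pi)} (\<lambda>t. cis (of_int n * t))"
      by (intro continuous_intros)
    fix x
    show "((\<lambda>t. cis (of_int n * t) / (\<i> * of_int n)) has_vector_derivative cis (of_int n * x))
        (at x within {min 0 (2 * pi)..max 0 (2 * pi)})"
    proof -
      have "((\<lambda>z. exp (\<i> * (of_int n * z)) / (\<i> * of_int n)) has_field_derivative
          exp (\<i> * (of_int n * of_real x))) (at (of_real x))"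
        using False by (auto intro!: derivative_eq_intros simp: algebra_simps)
      from has_vector_derivative_real_field[OF this] show ?thesis
        by (simp add: cis_conv_exp)
    qed
  qed
  also have "cis (of_int n * (2*pi)) = 1"
    using cis_multiple_2pi[of "of_int n"] by (simp add: mult_ac)
  finally show ?thesis using False by simp
qed

section \<open>Uniqueness of Fourier coefficients\<close>

lemma cnj_powi_circle: "norm z = 1 \<Longrightarrow> cnj (z powi n) = z powi (- n)"
proof -
  assume "norm z = 1"
  then have "z * cnj z = 1" using complex_norm_square[of z] by simp
  then have "inverse z = cnj z" by (rule inverse_unique)
  then show "cnj (z powi n) = z powi (- n)"
    by (metis complex_cnj_power_int power_int_inverse power_int_minus)
qed

text \<open>
  On the circle $\overline{z} = 1/z$, so the polynomials in $\mathrm{Re}\,z$ and $\mathrm{Im}\,z$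
  of the Stone--Weierstrass theorem are Laurent polynomials there.
\<close>

lemma circle_approx_laurent:
  assumes g: "continuous_on (sphere 0 1) g" and e: "e > 0"
  shows "\<exists>h\<in>laurent UNIV. \<forall>z\<in>sphere 0 1. norm (g z - h z :: complex) < e"
proof -
  obtain p where p: "polynomial_function p" "\<And>z. z \<in> sphere 0 1 \<Longrightarrow> norm (g z - p z) < e"
    using Stone_Weierstrass_polynomial_function[OF compact_sphere g e] by blast
  define P :: "(complex \<Rightarrow> complex) \<Rightarrow> bool"
    where "P q \<longleftrightarrow> (\<exists>h\<in>laurent UNIV. \<forall>z\<in>sphere 0 1. h z = q z)" for q
  have Padd: "P (\<lambda>z. q z + r z)" if qr: "P q" "P r" for q r
  proof -
    obtain h k where "h \<in> laurent UNIV" "k \<in> laurent UNIV" "\<forall>z\<in>sphere 0 1. h z = q z" "\<forall>z\<in>sphere 0 1. k z = r z"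
      using qr unfolding P_def by blast
    then show ?thesis unfolding P_def by (intro bexI[OF _ laurent_add[of h _ k]]) auto
  qed
  have Pmult: "P (\<lambda>z. q z * r z)" if qr: "P q" "P r" for q r
  proof -
    obtain h k where hk: "h \<in> laurent UNIV" "k \<in> laurent UNIV" "\<forall>z\<in>sphere 0 1. h z = q z" "\<forall>z\<in>sphere 0 1. k z = r z"
      using qr unfolding P_def by blast
    obtain m where m: "m \<in> laurent UNIV" "\<And>z. z \<noteq> 0 \<Longrightarrow> m z = h z * k z"
      using laurent_mult[OF hk(1,2), of UNIV] by blast
    show ?thesis unfolding P_def
    proof (rule bexI[OF _ m(1)], safe)
      fix z :: complex assume z: "z \<in> sphere 0 1"
      then have "z \<noteq> 0" by auto
      with m(2)[of z] hk(3,4) z show "m z = q z * r z" by simp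
    qed
  qed
  have Pconst: "P (\<lambda>z. c)" for c
    unfolding P_def using laurent_term[of 0 UNIV c] by (intro bexI) auto
  have Preal: "P (\<lambda>z. of_real (q z))" if "real_polynomial_function q" for q
    using that
  proof (induction rule: real_polynomial_function.induct)
    case (linear q)
    interpret bounded_linear q by fact
    define a b where "a = complex_of_real (q 1)" and "b = complex_of_real (q \<i>)"
    have "of_real (q z) = ((a - \<i> * b) / 2) * z powi 1 + ((a + \<i> * b) / 2) * z powi (-1)"
      if z: "norm z = 1" for z
    proof -
      have "z = Re z *\<^sub>R 1 + Im z *\<^sub>R \<i>" by (simp add: complex_eq_iff)
      then have "q z = Re z * q 1 + Im z * q \<i>"
        by (metis add scaleR real_scaleR_def)
      moreover have "z powi (-1) = cnj z" using cnj_powi_circle[OF z, of 1] by simp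
      moreover have "of_real (Re z * q 1 + Im z * q \<i>) = ((a - \<i> * b) / 2) * z + ((a + \<i> * b) / 2) * cnj z"
        by (simp add: a_def b_def complex_eq_iff field_simps)
      ultimately show ?thesis by (simp only: power_int_1_right)
    qed
    moreover have "(\<lambda>z. ((a - \<i> * b) / 2) * z powi 1 + ((a + \<i> * b) / 2) * z powi (-1)) \<in> laurent UNIV"
      by (intro laurent_add laurent_term) auto
    ultimately show ?case unfolding P_def by (intro bexI) auto
  next
    case (const c)
    show ?case by (rule Pconst)
  next
    case (add q r)
    then show ?case using Padd by simp
  next
    case (mult q r)
    then show ?case using Pmult by simp
  qed
  have R: "real_polynomial_function (\<lambda>z. Re (p z))" "real_polynomial_function (\<lambda>z. Im (p z))"
    using p(1) bounded_linear_Re bounded_linear_Im unfolding polynomial_function_def by (auto simp: o_def)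
  have "P (\<lambda>z. of_real (Re (p z)) + \<i> * of_real (Im (p z)))"
    by (intro Padd Pmult Pconst Preal R)
  then have "P p" by (simp add: complex_eq[symmetric])
  then show ?thesis using p(2) unfolding P_def by metis
qed

text \<open>
  The vanishing of $\int f h$ extends from monomials $h$ to continuous functions by uniform
  approximation, to indicators of closed sets by dominated convergence, and to all Borel sets by
  Dynkin's lemma.
\<close>

lemma circle_fourier_unique:
  assumes f: "integrable \<T> f" and 0: "\<And>n. (\<integral>z. f z * z powi n \<partial>\<T>) = 0"
  shows "AE z in \<T>. f z = 0"
proof -
  have fm [measurable]: "f \<in> borel_measurable \<T>" using f by auto
  have int: "integrable \<T> (\<lambda>z. f z * h z)" if "h \<in> borel_measurable \<T>" "\<And>z. norm z = 1 \<Longrightarrow> norm (h z) \<le> B" for h B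
  proof (rule Bochner_Integration.integrable_bound)
    show "integrable \<T> (\<lambda>z. B * norm (f z))" using f by simp
    show "AE z in \<T>. norm (f z * h z) \<le> norm (B * norm (f z))"
    proof (rule AE_circleI)
      fix z :: complex assume z: "norm z = 1"
      have "0 \<le> B" using that(2)[OF z] norm_ge_zero order_trans by blast
      then show "norm (f z * h z) \<le> norm (B * norm (f z))"
        using that(2)[OF z] by (simp add: norm_mult mult.commute[of B] mult_left_mono)
    qed
  qed (use that(1) in measurable)
  have lau_int: "integrable \<T> (\<lambda>z. f z * h z)" if h: "h \<in> laurent UNIV" for h
  proof -
    obtain B where "\<forall>z\<in>sphere 0 1. norm (h z) \<le> B" using laurent_bounded[OF h, of 1] by auto
    then show ?thesis by (intro int[OF borel_imp_circle[OF laurent_borel[OF h]], of B]) auto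
  qed
  have lau: "(\<integral>z. f z * h z \<partial>\<T>) = 0" if "h \<in> laurent UNIV" for h
    using that
  proof (induction h rule: laurent.induct)
    case (step h i c)
    have "(\<integral>z. f z * (h z + c * z powi i) \<partial>\<T>) = (\<integral>z. f z * h z + c * (f z * z powi i) \<partial>\<T>)"
      by (simp add: algebra_simps)
    also have "\<dots> = 0"
      using step lau_int[OF step(1)] lau_int[OF laurent_powi[of i UNIV]]
      by (subst Bochner_Integration.integral_add) (auto simp: 0)
    finally show ?case .
  qed simp
  have cont: "(\<integral>z. f z * g z \<partial>\<T>) = 0" if g: "continuous_on (sphere 0 1) g" for g
  proof -
    define K where "K = (\<integral>z. norm (f z) \<partial>\<T>)"
    obtain B where B: "\<And>z. z \<in> sphere 0 1 \<Longrightarrow> norm (g z) \<le> B"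
      using continuous_circle_bounded[OF g] by blast
    have ig: "integrable \<T> (\<lambda>z. f z * g z)"
      by (rule int[OF continuous_imp_circle[OF g]]) (use B in auto)
    have K0: "K \<ge> 0" unfolding K_def by simp
    have "norm (\<integral>z. f z * g z \<partial>\<T>) \<le> e" if e: "e > 0" for e
    proof -
      have "e / (K + 1) > 0" using e K0 by simp
      then obtain h where h: "h \<in> laurent UNIV" "\<And>z. z \<in> sphere 0 1 \<Longrightarrow> norm (g z - h z) < e / (K + 1)"
        using circle_approx_laurent[OF g] by blast
      have "(\<integral>z. f z * g z \<partial>\<T>) = (\<integral>z. f z * g z - f z * h z \<partial>\<T>)"
        using ig lau_int[OF h(1)] lau[OF h(1)] by simp
      also have "norm \<dots> \<le> (\<integral>z. norm (f z * g z - f z * h z) \<partial>\<T>)" by (rule integral_norm_bound)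
      also have "\<dots> \<le> (\<integral>z. e / (K + 1) * norm (f z) \<partial>\<T>)"
      proof (rule integral_mono_AE)
        show "AE z in \<T>. norm (f z * g z - f z * h z) \<le> e / (K + 1) * norm (f z)"
        proof (rule AE_circleI)
          fix z :: complex assume z: "norm z = 1"
          have "norm (f z * g z - f z * h z) = norm (f z) * norm (g z - h z)"
            by (simp add: norm_mult[symmetric] right_diff_distrib)
          also have "\<dots> \<le> norm (f z) * (e / (K + 1))"
            using h(2)[of z] z by (intro mult_left_mono) auto
          finally show "norm (f z * g z - f z * h z) \<le> e / (K + 1) * norm (f z)" by (simp add: mult.commute)
        qed
      qed (use ig lau_int[OF h(1)] f in auto)
      also have "\<dots> = e * (K / (K + 1))" by (simp add: K_def)
      also have "\<dots> \<le> e * 1" using e K0 by (intro mult_left_mono) auto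
      finally show ?thesis by simp
    qed
    then have "norm (\<integral>z. f z * g z \<partial>\<T>) \<le> 0" by (intro field_le_epsilon[of _ 0]) simp
    then show ?thesis by simp
  qed
  have ind_int: "integrable \<T> (\<lambda>z. f z * indicator A z)" if "A \<in> sets borel" for A
    by (rule int[of _ 1]) (use that in \<open>auto intro: borel_imp_circle split: split_indicator\<close>)
  have closed: "(\<integral>z. f z * indicator C z \<partial>\<T>) = 0" if C: "closed C" for C
  proof (cases "C = {}")
    case False
    define g where "g n z = complex_of_real (max 0 (1 - real n * infdist z C))" for n z
    have gc: "continuous_on S (g n)" for n S
      unfolding g_def by (intro continuous_intros)
    have gm: "g n \<in> borel_measurable \<T>" for n by (rule continuous_imp_circle[OF gc])
    have lim: "(\<lambda>n. f z * g n z) \<longlonglongrightarrow> f z * indicator C z" for z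
    proof (cases "z \<in> C")
      case True
      then show ?thesis by (simp add: g_def)
    next
      case False
      then have pos: "infdist z C > 0"
        using C \<open>C \<noteq> {}\<close> by (simp add: infdist_pos_not_in_closed)
      have "eventually (\<lambda>n. f z * g n z = 0) sequentially"
        using eventually_ge_at_top[of "nat \<lceil>1 / infdist z C\<rceil>"]
      proof eventually_elim
        case (elim n)
        then have "1 / infdist z C \<le> real n" by linarith
        then show ?case using pos by (simp add: g_def field_simps)
      qed
      then show ?thesis using False by (auto intro: tendsto_eventually)
    qed
    have "(\<lambda>n. \<integral>z. f z * g n z \<partial>\<T>) \<longlonglongrightarrow> (\<integral>z. f z * indicator C z \<partial>\<T>)"
    proof (rule integral_dominated_convergence[where w = "\<lambda>z. norm (f z)"])
      show "AE z in \<T>. norm (f z * g n z) \<le> norm (f z)" for n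
        by (rule AE_circleI)
           (auto simp: g_def norm_mult infdist_nonneg max_def intro!: mult_left_le)
    qed (use f gm C lim ind_int[of C] in \<open>auto intro: borel_imp_circle\<close>)
    moreover have "(\<integral>z. f z * g n z \<partial>\<T>) = 0" for n by (rule cont[OF gc])
    ultimately show ?thesis by (simp add: LIMSEQ_const_iff)
  qed simp
  have bor: "(\<integral>z. f z * indicator A z \<partial>\<T>) = 0" if "A \<in> sets borel" for A
  proof -
    have "Int_stable (Collect closed :: complex set set)" "Collect closed \<subseteq> Pow (UNIV :: complex set)"
      "A \<in> sigma_sets UNIV (Collect closed)"
      using that by (auto simp: borel_eq_closed Int_stable_def)
    then show ?thesis
    proof (induction rule: sigma_sets_induct_disjoint)
      case (compl A)
      then have A: "A \<in> sets borel" by (simp add: borel_eq_closed)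
      have "(\<integral>z. f z * indicator (UNIV - A) z \<partial>\<T>) = (\<integral>z. f z * indicator UNIV z - f z * indicator A z \<partial>\<T>)"
        by (intro Bochner_Integration.integral_cong) (auto split: split_indicator)
      also have "\<dots> = 0"
        using compl closed[of UNIV] ind_int[OF A] ind_int[of UNIV] by (subst Bochner_Integration.integral_diff) auto
      finally show ?case .
    next
      case (union A)
      then have A: "A i \<in> sets borel" for i by (auto simp: borel_eq_closed)
      have "(\<lambda>z. f z * indicator (\<Union>i. A i) z) = (\<lambda>z. indicator (\<Union>i. A i) z *\<^sub>R f z)"
        by (auto split: split_indicator)
      have "(\<lambda>n. \<integral>z. f z * indicator (\<Union>i<n. A i) z \<partial>\<T>) \<longlonglongrightarrow> (\<integral>z. f z * indicator (\<Union>i. A i) z \<partial>\<T>)"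
      proof (rule integral_dominated_convergence[where w = "\<lambda>z. norm (f z)"])
        show "AE z in \<T>. (\<lambda>n. f z * indicator (\<Union>i<n. A i) z) \<longlonglongrightarrow> f z * indicator (\<Union>i. A i) z"
          by (intro AE_circleI tendsto_intros LIMSEQ_indicator_UN)
        show "(\<lambda>z. f z * indicator (\<Union>i. A i) z) \<in> borel_measurable \<T>"
          using ind_int[of "\<Union>i. A i"] A by auto
        show "(\<lambda>z. f z * indicator (\<Union>i<n. A i) z) \<in> borel_measurable \<T>" for n
          using ind_int[of "\<Union>i<n. A i"] A by auto
      qed (use f in \<open>auto split: split_indicator simp: norm_mult\<close>)
      moreover have "(\<integral>z. f z * indicator (\<Union>i<n. A i) z \<partial>\<T>) = 0" for n
      proof -
        have "(\<integral>z. f z * indicator (\<Union>i<n. A i) z \<partial>\<T>) = (\<integral>z. (\<Sum>i<n. f z * indicator (A i) z) \<partial>\<T>)"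
          using indicator_UN_disjoint[of "{..<n}" A] union(1)
          by (intro Bochner_Integration.integral_cong)
             (auto simp: sum_distrib_left[symmetric] disjoint_family_on_def)
        also have "\<dots> = 0" using union(3) ind_int[OF A] by (subst Bochner_Integration.integral_sum) auto
        finally show ?thesis .
      qed
      ultimately show ?case by (simp add: LIMSEQ_const_iff)
    qed (use closed in \<open>auto simp: Int_stable_def\<close>)
  qed
  show ?thesis
  proof (rule circle.density_zero[OF f])
    fix A assume "A \<in> sets \<T>"
    then obtain A' where A': "A' \<in> sets borel" "A = A' \<inter> sphere 0 1"
      by (auto simp: sets_circle sets_restrict_space)
    have "(LINT z:A|\<T>. f z) = (\<integral>z. f z * indicator A' z \<partial>\<T>)"
      unfolding set_lebesgue_integral_def A'(2)
      by (intro Bochner_Integration.integral_cong) (auto split: split_indicator)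
    then show "(LINT z:A|\<T>. f z) = 0" using bor[OF A'(1)] by simp
  qed
qed

lemma laurent_L2: assumes "f \<in> laurent I" shows "f \<in> L2 \<T>"
proof -
  obtain B where B: "\<forall>z\<in>sphere 0 1. norm (f z) \<le> B" using laurent_bounded[OF assms, of 1] by auto
  show ?thesis
    by (rule L2_bounded[OF finite_measure_circle borel_imp_circle[OF laurent_borel[OF assms]], of B])
       (use B in \<open>auto intro!: AE_circleI\<close>)
qed

lemma powi_L2: "(\<lambda>z. z powi n) \<in> L2 \<T>"
  by (rule laurent_L2[OF laurent_powi[of n UNIV]]) simp

lemma fourier_coeff_inner: "fourier_coeff f n = L2_inner \<T> f (\<lambda>z. z powi n)"
  by (simp add: fourier_coeff_def L2_inner_def)

lemma circle_integral_cong: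
  fixes f g :: "complex \<Rightarrow> 'b::{banach,second_countable_topology}"
  shows "(\<And>z. norm z = 1 \<Longrightarrow> f z = g z) \<Longrightarrow> (\<integral>z. f z \<partial>\<T>) = (\<integral>z. g z \<partial>\<T>)"
  by (rule Bochner_Integration.integral_cong) auto

lemma powi_add_circle: "norm z = 1 \<Longrightarrow> (z::complex) powi (m + n) = z powi m * z powi n"
  by (subst power_int_add) auto

lemma fourier_coeff_powi_integral: "fourier_coeff f n = (\<integral>z. f z * z powi (- n) \<partial>\<T>)"
  unfolding fourier_coeff_def by (rule circle_integral_cong) (simp add: cnj_powi_circle del: complex_cnj_power_int)

lemma fourier_coeff_powi: "fourier_coeff (\<lambda>z. z powi m) n = (if m = n then 1 else 0)"
proof -
  have "fourier_coeff (\<lambda>z. z powi m) n = (\<integral>z. z powi (m + - n) \<partial>\<T>)"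
    unfolding fourier_coeff_powi_integral by (rule circle_integral_cong) (rule powi_add_circle[symmetric])
  then show ?thesis by (simp add: circle_integral_powi)
qed

lemma L2_norm_powi_circle [simp]: "L2_norm \<T> (\<lambda>z. z powi n) = 1"
proof -
  have "complex_of_real ((L2_norm \<T> (\<lambda>z. z powi n))\<^sup>2) = of_real 1"
    unfolding L2_inner_self[symmetric] fourier_coeff_inner[symmetric] by (simp add: fourier_coeff_powi)
  then have "(L2_norm \<T> (\<lambda>z. z powi n))\<^sup>2 = 1" by (simp only: of_real_eq_iff)
  then show ?thesis by (smt (verit) L2_norm_nonneg power2_eq_1_iff)
qed

lemma fourier_coeff_add: "f \<in> L2 \<T> \<Longrightarrow> g \<in> L2 \<T> \<Longrightarrow>
    fourier_coeff (\<lambda>z. f z + g z) n = fourier_coeff f n + fourier_coeff g n"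
  unfolding fourier_coeff_inner by (rule L2_inner_add_left[OF _ _ powi_L2])

lemma fourier_coeff_diff: "f \<in> L2 \<T> \<Longrightarrow> g \<in> L2 \<T> \<Longrightarrow>
    fourier_coeff (\<lambda>z. f z - g z) n = fourier_coeff f n - fourier_coeff g n"
  unfolding fourier_coeff_inner by (rule L2_inner_diff_left[OF _ _ powi_L2])

lemma fourier_coeff_cmult: "fourier_coeff (\<lambda>z. c * f z) n = c * fourier_coeff f n"
  unfolding fourier_coeff_inner by (rule L2_inner_cmult_left)

lemma norm_fourier_coeff_le: "f \<in> L2 \<T> \<Longrightarrow> norm (fourier_coeff f n) \<le> L2_norm \<T> f"
  using L2_Cauchy_Schwarz[OF _ powi_L2, of f n] by (simp add: fourier_coeff_inner)

lemma fourier_coeff_laurent: "f \<in> laurent I \<Longrightarrow> n \<notin> I \<Longrightarrow> fourier_coeff f n = 0"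
proof (induction f rule: laurent.induct)
  case zero
  show ?case by (simp add: fourier_coeff_def)
next
  case (step f i c)
  have "fourier_coeff (\<lambda>z. f z + c * z powi i) n = fourier_coeff f n + fourier_coeff (\<lambda>z. c * z powi i) n"
    by (rule fourier_coeff_add[OF laurent_L2[OF step(1)] L2_cmult[OF powi_L2]])
  then show ?case using step by (auto simp: fourier_coeff_cmult fourier_coeff_powi)
qed

lemma laurent_subspace: "L2_subspace \<T> (laurent I)"
  unfolding L2_subspace_def by (auto intro: laurent_L2 laurent.zero laurent_add laurent_cmult)

lemma circle_L2_orth_all:
  assumes "r \<in> L2 \<T>" "\<And>n. fourier_coeff r n = 0"
  shows "AE z in \<T>. r z = 0"
proof (rule circle_fourier_unique)
  have "(\<lambda>x. 1) \<in> L2 \<T>" by (simp add: L2_def)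
  from L2_mult_integrable[OF assms(1) this] show "integrable \<T> r" by simp
  show "(\<integral>z. r z * z powi n \<partial>\<T>) = 0" for n
    using assms(2)[of "- n"] by (simp add: fourier_coeff_powi_integral)
qed

lemma circle_closure_laurent:
  assumes y: "y \<in> L2 \<T>" and 0: "\<And>n. n \<notin> I \<Longrightarrow> fourier_coeff y n = 0"
  shows "y \<in> L2_closure \<T> (laurent I)"
proof (rule L2_closure_if_orth[OF finite_measure_circle laurent_subspace, where W = "{\<lambda>z. z powi n |n. n \<notin> I}"])
  show "{\<lambda>z. z powi n |n. n \<notin> I} \<subseteq> L2 \<T>" using powi_L2 by auto
  show "L2_inner \<T> f g = 0" if "f \<in> laurent I" "g \<in> {\<lambda>z. z powi n |n. n \<notin> I}" for f g
    using that fourier_coeff_laurent[OF that(1)] by (auto simp: fourier_coeff_inner)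
  show "AE z in \<T>. r z = 0" if r: "r \<in> L2_orth \<T> (laurent I)" "r \<in> L2_orth \<T> {\<lambda>z. z powi n |n. n \<notin> I}" for r
  proof (rule circle_L2_orth_all)
    show "r \<in> L2 \<T>" using r by (simp add: L2_orth_def)
    show "fourier_coeff r n = 0" for n
      using r laurent_powi[of n I] by (cases "n \<in> I") (auto simp: L2_orth_def fourier_coeff_inner)
  qed
  show "y \<in> L2_orth \<T> {\<lambda>z. z powi n |n. n \<notin> I}"
    using y 0 by (auto simp: L2_orth_def fourier_coeff_inner)
qed

section \<open>Nehari's theorem\<close>

text \<open>
  Let $K$ be the set of functions bounded by $e$, and let $x$ be the point nearest to $\psi$ in
  the closure of the convex set $K + \{\mathrm{polynomials}\}$. For $y = \psi - x$ the variational
  inequality says that $y$ is orthogonal to all polynomials and, tested with $e\,\mathrm{sgn}\,y$,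
  that $e \|y\|_1 \le \mathrm{Re} \langle y, x\rangle$. So $\overline{y}$ is a limit of
  polynomials that vanish at $0$, and the hypothesis gives
  $|\langle \psi, y \rangle| \le e \|y\|_1$. Hence
  $\|y\|^2 = \mathrm{Re}\langle y, \psi\rangle - \mathrm{Re}\langle y, x\rangle \le 0$, that is,
  $\psi$ is a limit of sums $k + h$ with $k$ in $K$ and $h$ a polynomial. The $k$ that occur at
  distance at most $1/n$ form decreasing convex sets, and elements of almost minimal norm of these
  sets converge to the desired function.
\<close>

lemma nehari_L1:
  assumes \<psi>: "\<psi> \<in> L2 \<T>" and e: "e \<ge> 0"
    and bd: "\<And>f. f \<in> laurent {1..} \<Longrightarrow> norm (\<integral>z. \<psi> z * f z \<partial>\<T>) \<le> e * (\<integral>z. norm (f z) \<partial>\<T>)"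
  shows "\<exists>k\<in>borel_measurable \<T>. (AE z in \<T>. norm (k z) \<le> e) \<and>
    (\<forall>n<0. fourier_coeff (\<lambda>z. \<psi> z - k z) n = 0)"
proof -
  define K :: "(complex \<Rightarrow> complex) set" where "K = {k \<in> borel_measurable \<T>. AE z in \<T>. norm (k z) \<le> e}"
  have KL: "k \<in> L2 \<T>" if "k \<in> K" for k
    by (rule L2_bounded[OF finite_measure_circle, of _ e]) (use that in \<open>auto simp: K_def\<close>)
  have Kconv: "(\<lambda>z. a z + of_real t * (b z - a z)) \<in> K" if "a \<in> K" "b \<in> K" "0 \<le> t" "t \<le> 1" for a b t
  proof -
    have [measurable]: "a \<in> borel_measurable \<T>" "b \<in> borel_measurable \<T>" using that by (auto simp: K_def)
    have "AE z in \<T>. norm (a z) \<le> e" "AE z in \<T>. norm (b z) \<le> e" using that by (auto simp: K_def)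
    then have "AE z in \<T>. norm (a z + of_real t * (b z - a z)) \<le> e"
    proof eventually_elim
      case (elim z)
      have "a z + of_real t * (b z - a z) = of_real (1 - t) * a z + of_real t * b z"
        by (simp add: algebra_simps)
      also have "norm \<dots> \<le> (1 - t) * norm (a z) + t * norm (b z)"
        using norm_triangle_ineq[of "of_real (1 - t) * a z" "of_real t * b z"] that
        by (simp add: norm_mult del: of_real_diff)
      also have "\<dots> \<le> (1 - t) * e + t * e"
        using elim that by (intro add_mono mult_left_mono) auto
      finally show ?case by (simp add: algebra_simps)
    qed
    then show ?thesis by (simp add: K_def)
  qed
  have K0: "(\<lambda>z. 0) \<in> K" using e by (simp add: K_def)
  define C where "C = {\<lambda>z. k z + h z |k h. k \<in> K \<and> h \<in> laurent {0..}}"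
  have CI: "(\<lambda>z. k z + h z) \<in> C" if "k \<in> K" "h \<in> laurent {0..}" for k h
    using that by (auto simp: C_def)
  have CL: "C \<subseteq> L2 \<T>" using L2_add[OF KL laurent_L2] by (auto simp: C_def)
  have "\<exists>x\<in>L2_closure \<T> C. \<forall>y\<in>C. Re (L2_inner \<T> (\<lambda>t. \<psi> t - x t) (\<lambda>t. y t - x t)) \<le> 0"
  proof (rule L2_convex_nearest[OF finite_measure_circle \<psi> CL])
    show "C \<noteq> {}" using CI[OF K0 laurent.zero] by auto
    fix a b and t :: real assume ab: "a \<in> C" "b \<in> C" and t: "0 \<le> t" "t \<le> 1"
    then obtain k h k' h' where *: "k \<in> K" "h \<in> laurent {0..}" "k' \<in> K" "h' \<in> laurent {0..}"
      "a = (\<lambda>z. k z + h z)" "b = (\<lambda>z. k' z + h' z)" unfolding C_def by blast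
    have "(\<lambda>z. (k z + of_real t * (k' z - k z)) + (h z + of_real t * (h' z - h z))) \<in> C"
      by (intro CI Kconv * t laurent_add laurent_cmult laurent_diff)
    then show "(\<lambda>x. a x + of_real t * (b x - a x)) \<in> C"
      unfolding * by (simp add: algebra_simps)
  qed
  then obtain x where x: "x \<in> L2_closure \<T> C"
    and var: "\<And>c. c \<in> C \<Longrightarrow> Re (L2_inner \<T> (\<lambda>t. \<psi> t - x t) (\<lambda>t. c t - x t)) \<le> 0" by blast
  have xL: "x \<in> L2 \<T>" using x by (rule L2_closure_L2)
  define y where "y t = \<psi> t - x t" for t
  have y_eq: "y = (\<lambda>t. \<psi> t - x t)" by (rule ext) (rule y_def)
  have yL: "y \<in> L2 \<T>" unfolding y_eq by (intro L2_diff \<psi> xL)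
  have [measurable]: "y \<in> borel_measurable \<T>" using yL by measurable
  have var': "Re (L2_inner \<T> y c) \<le> Re (L2_inner \<T> y x)" if "c \<in> C" for c
  proof -
    have "c \<in> L2 \<T>" using CL that by auto
    from L2_inner_diff_right[OF this xL yL] show ?thesis
      using var[OF that] unfolding y_eq[symmetric] by simp
  qed
  have orth: "L2_inner \<T> y h = 0" if h: "h \<in> laurent {0..}" for h
  proof (rule Re_mult_bounded_imp_0)
    show "Re (cnj c * L2_inner \<T> y h) \<le> Re (L2_inner \<T> y x)" for c
      using var'[OF CI[OF K0 laurent_cmult[OF h, of c]]] by (simp add: L2_inner_cmult_right)
  qed
  define I1 where "I1 = (\<integral>z. norm (y z) \<partial>\<T>)"
  have int_y: "integrable \<T> (\<lambda>z. norm (y z))"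
    using L2_mult_integrable[OF yL, of "\<lambda>z. 1"] by (simp add: L2_def)
  have 2: "e * I1 \<le> Re (L2_inner \<T> y x)"
  proof -
    let ?k = "\<lambda>z. of_real e * sgn (y z)"
    have "?k \<in> K" using e by (auto simp: K_def norm_mult norm_sgn intro!: AE_circleI)
    from var'[OF CI[OF this laurent.zero]]
    have "Re (L2_inner \<T> y ?k) \<le> Re (L2_inner \<T> y x)" by simp
    also have "L2_inner \<T> y ?k = (\<integral>z. of_real (e * norm (y z)) \<partial>\<T>)"
      unfolding L2_inner_def
    proof (rule circle_integral_cong)
      fix z
      have "y z * cnj (sgn (y z)) = of_real (norm (y z))"
      proof (cases "y z = 0")
        case False
        have "y z * cnj (sgn (y z)) = (y z * cnj (y z)) / of_real (norm (y z))"
          by (simp add: sgn_eq)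
        also have "\<dots> = of_real (norm (y z))"
          using False unfolding complex_norm_square[symmetric] by (simp add: power2_eq_square)
        finally show ?thesis .
      qed simp
      then show "y z * cnj (of_real e * sgn (y z)) = of_real (e * norm (y z))"
        by (simp add: mult.left_commute)
    qed
    also have "\<dots> = of_real (e * I1)" unfolding I1_def by (simp only: integral_complex_of_real integral_mult_right_zero)
    finally show ?thesis by simp
  qed
  have 3: "norm (L2_inner \<T> \<psi> y) \<le> e * I1"
  proof -
    have cyL: "(\<lambda>z. cnj (y z)) \<in> L2 \<T>" by (rule L2_cnj[OF yL])
    have "(\<lambda>z. cnj (y z)) \<in> L2_closure \<T> (laurent {1..})"
    proof (rule circle_closure_laurent[OF cyL])
      fix n :: int assume n: "n \<notin> {1..}"
      have "fourier_coeff (\<lambda>z. cnj (y z)) n = (\<integral>z. cnj (y z * cnj (z powi (- n))) \<partial>\<T>)"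
        unfolding fourier_coeff_powi_integral by (rule circle_integral_cong) simp
      also have "\<dots> = cnj (L2_inner \<T> y (\<lambda>z. z powi (- n)))"
        unfolding L2_inner_def by (rule Bochner_Integration.integral_cnj)
      also have "\<dots> = 0" using orth[OF laurent_powi[of "- n"]] n by simp
      finally show "fourier_coeff (\<lambda>z. cnj (y z)) n = 0" .
    qed
    then obtain g where g: "\<And>n. g n \<in> laurent {1..}" "(\<lambda>n. L2_norm \<T> (\<lambda>z. g n z - cnj (y z))) \<longlonglongrightarrow> 0"
      using L2_closure_approx by blast
    have gL: "g n \<in> L2 \<T>" for n by (rule laurent_L2[OF g(1)])
    have l1: "(\<lambda>n. norm (\<integral>z. \<psi> z * g n z \<partial>\<T>)) \<longlonglongrightarrow> norm (L2_inner \<T> \<psi> y)"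
    proof -
      have "(\<lambda>n. L2_inner \<T> (g n) (\<lambda>z. cnj (\<psi> z))) \<longlonglongrightarrow> L2_inner \<T> (\<lambda>z. cnj (y z)) (\<lambda>z. cnj (\<psi> z))"
        by (rule L2_inner_tendsto_left[OF gL cyL L2_cnj[OF \<psi>] g(2)])
      then show ?thesis
        by (intro tendsto_norm) (simp add: L2_inner_def mult.commute)
    qed
    have l2: "(\<lambda>n. e * (I1 + L2_norm \<T> (\<lambda>z. g n z - cnj (y z)))) \<longlonglongrightarrow> e * (I1 + 0)"
      by (intro tendsto_intros g)
    have "norm (\<integral>z. \<psi> z * g n z \<partial>\<T>) \<le> e * (I1 + L2_norm \<T> (\<lambda>z. g n z - cnj (y z)))" for n
    proof -
      have dL: "(\<lambda>z. g n z - cnj (y z)) \<in> L2 \<T>" by (intro L2_diff gL cyL)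
      have int1: "integrable \<T> (\<lambda>z. norm (u z))" if "u \<in> L2 \<T>" for u
        using L2_mult_integrable[OF that, of "\<lambda>z. 1"] by (simp add: L2_def)
      have "(\<integral>z. norm (g n z) \<partial>\<T>) \<le> (\<integral>z. norm (y z) + norm (g n z - cnj (y z)) \<partial>\<T>)"
      proof (rule integral_mono)
        show "norm (g n z) \<le> norm (y z) + norm (g n z - cnj (y z))" for z
          using norm_triangle_ineq[of "cnj (y z)" "g n z - cnj (y z)"] by simp
      qed (use int1[OF gL] int1[OF dL] int_y in auto)
      also have "\<dots> = I1 + (\<integral>z. norm (g n z - cnj (y z)) \<partial>\<T>)"
        using int1[OF dL] int_y by (simp add: I1_def)
      also have "\<dots> \<le> I1 + L2_norm \<T> (\<lambda>z. g n z - cnj (y z))"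
        using L1_le_L2[OF prob_space_circle dL] by simp
      finally have "e * (\<integral>z. norm (g n z) \<partial>\<T>) \<le> e * (I1 + L2_norm \<T> (\<lambda>z. g n z - cnj (y z)))"
        using e by (rule mult_left_mono)
      with bd[OF g(1)[of n]] show ?thesis by linarith
    qed
    then have "norm (L2_inner \<T> \<psi> y) \<le> e * (I1 + 0)"
      by (intro LIMSEQ_le[OF l1 l2]) auto
    then show ?thesis by simp
  qed
  have "(L2_norm \<T> y)\<^sup>2 = Re (L2_inner \<T> y y)" by (simp add: L2_inner_self)
  also have "L2_inner \<T> y y = L2_inner \<T> y \<psi> - L2_inner \<T> y x"
    using L2_inner_diff_right[OF \<psi> xL yL] unfolding y_eq[symmetric] .
  also have "Re \<dots> \<le> norm (L2_inner \<T> \<psi> y) - Re (L2_inner \<T> y x)"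
    using complex_Re_le_cmod[of "L2_inner \<T> y \<psi>"] by (simp add: L2_inner_commute[of \<T> y \<psi>])
  also have "\<dots> \<le> 0" using 2 3 by simp
  finally have "L2_norm \<T> y = 0" by simp
  then have "AE z in \<T>. y z = 0" by (rule L2_norm_eq_0_AE[OF yL])
  then have \<psi>C: "\<psi> \<in> L2_closure \<T> C"
    by (intro L2_closure_cong_AE[OF CL x \<psi>]) (simp add: y_def)
  define S where "S n = {k \<in> K. \<exists>h\<in>laurent {0..}. L2_norm \<T> (\<lambda>z. \<psi> z - (k z + h z)) \<le> inverse (real (Suc n))}" for n
  have ndL: "(\<lambda>z. \<psi> z - (k z + h z)) \<in> L2 \<T>" if "k \<in> K" "h \<in> laurent {0..}" for k h
    by (rule L2_diff[OF \<psi> L2_add[OF KL[OF that(1)] laurent_L2[OF that(2)]]])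
  have Sne: "\<exists>k. k \<in> S n" for n
  proof -
    have "inverse (real (Suc n)) > 0" by simp
    then obtain c where "c \<in> C" "L2_norm \<T> (\<lambda>z. \<psi> z - c z) < inverse (real (Suc n))"
      using \<psi>C unfolding L2_closure_def by blast
    moreover from \<open>c \<in> C\<close> obtain k h where "k \<in> K" "h \<in> laurent {0..}" "c = (\<lambda>z. k z + h z)"
      unfolding C_def by blast
    ultimately show ?thesis unfolding S_def by (auto intro!: exI[of _ k] bexI[of _ h])
  qed
  have Kn: "L2_norm \<T> k \<le> e" if "k \<in> K" for k
  proof -
    have "L2_norm \<T> (\<lambda>z. k z * 1) \<le> e * L2_norm \<T> (\<lambda>z. 1)"
      by (rule L2_norm_mult_bounded) (use that e in \<open>auto simp: K_def L2_def\<close>)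
    also have "L2_norm \<T> (\<lambda>z. 1) = 1" using L2_norm_powi_circle[of 0] by simp
    finally show ?thesis by simp
  qed
  have "\<exists>k\<in>L2 \<T>. \<exists>xs. (\<forall>n. xs n \<in> S n) \<and> (\<lambda>n. L2_norm \<T> (\<lambda>t. xs n t - k t)) \<longlonglongrightarrow> 0 \<and>
    (\<forall>y. (\<forall>n. y \<in> S n) \<longrightarrow> L2_norm \<T> (\<lambda>t. 0 - k t) \<le> L2_norm \<T> (\<lambda>t. 0 - y t))"
  proof (rule L2_nearest_nested[OF finite_measure_circle L2_zero])
    show "S n \<subseteq> L2 \<T>" for n by (auto simp: S_def KL)
    show "S n \<noteq> {}" for n using Sne by auto
    show "S (Suc n) \<subseteq> S n" for n
    proof -
      have "inverse (real (Suc (Suc n))) \<le> inverse (real (Suc n))" by simp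
      then show ?thesis unfolding S_def by (blast intro: order_trans)
    qed
    show "\<exists>a\<in>S n. L2_norm \<T> (\<lambda>x. 0 - a x) \<le> e" for n
    proof -
      obtain a where a: "a \<in> S n" using Sne by blast
      have "L2_norm \<T> (\<lambda>x. 0 - a x) = L2_norm \<T> a" by (simp add: L2_norm_def)
      with a Kn[of a] show ?thesis by (auto simp: S_def)
    qed
    fix n a b assume ab: "a \<in> S n" "b \<in> S n"
    then obtain h h' where h: "h \<in> laurent {0..}" "h' \<in> laurent {0..}" and K: "a \<in> K" "b \<in> K" and
      le: "L2_norm \<T> (\<lambda>z. \<psi> z - (a z + h z)) \<le> inverse (real (Suc n))"
        "L2_norm \<T> (\<lambda>z. \<psi> z - (b z + h' z)) \<le> inverse (real (Suc n))"
      unfolding S_def by blast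
    have 1: "(\<lambda>x. (a x + b x) / 2) \<in> K"
      using Kconv[OF K, of "1/2"] by (simp add: field_simps)
    have 2: "(\<lambda>z. (1/2) * h z + (1/2) * h' z) \<in> laurent {0..}"
      by (intro laurent_add laurent_cmult h)
    have "L2_norm \<T> (\<lambda>z. \<psi> z - ((a z + b z) / 2 + ((1/2) * h z + (1/2) * h' z)))
        = L2_norm \<T> (\<lambda>z. (1/2) * (\<psi> z - (a z + h z)) + (1/2) * (\<psi> z - (b z + h' z)))"
      by (intro arg_cong[where f = "L2_norm \<T>"] ext) (simp add: field_simps)
    also have "\<dots> \<le> (1/2) * L2_norm \<T> (\<lambda>z. \<psi> z - (a z + h z)) + (1/2) * L2_norm \<T> (\<lambda>z. \<psi> z - (b z + h' z))"
      using L2_norm_triangle[OF L2_cmult[OF ndL[OF K(1) h(1)], of "1/2"] L2_cmult[OF ndL[OF K(2) h(2)], of "1/2"]]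
      by (simp only: L2_norm_cmult) simp
    also have "\<dots> \<le> inverse (real (Suc n))" using le by simp
    finally show "(\<lambda>x. (a x + b x) / 2) \<in> S n"
      unfolding S_def by (intro CollectI conjI 1 bexI[OF _ 2])
  qed
  then obtain k xs where k: "k \<in> L2 \<T>" and xs: "\<And>n. xs n \<in> S n"
    and lim: "(\<lambda>n. L2_norm \<T> (\<lambda>t. xs n t - k t)) \<longlonglongrightarrow> 0" by blast
  have xsK: "xs n \<in> K" for n using xs[of n] by (simp add: S_def)
  have "AE z in \<T>. norm (k z) \<le> e"
    by (rule L2_limit_bounded[OF KL[OF xsK] _ k lim]) (use xsK in \<open>auto simp: K_def\<close>)
  moreover have "fourier_coeff (\<lambda>z. \<psi> z - k z) n = 0" if n: "n < 0" for n
  proof -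
    have "norm (fourier_coeff (\<lambda>z. \<psi> z - k z) n) \<le> inverse (real (Suc m)) + L2_norm \<T> (\<lambda>t. xs m t - k t)" for m
    proof -
      obtain h where h: "h \<in> laurent {0..}" "L2_norm \<T> (\<lambda>z. \<psi> z - (xs m z + h z)) \<le> inverse (real (Suc m))"
        using xs[of m] unfolding S_def by blast
      have L: "(\<lambda>z. \<psi> z - (xs m z + h z)) \<in> L2 \<T>" "(\<lambda>z. xs m z - k z) \<in> L2 \<T>"
        using ndL[OF xsK h(1)] L2_diff[OF KL[OF xsK] k] by auto
      have "fourier_coeff (\<lambda>z. \<psi> z - k z) n =
          fourier_coeff (\<lambda>z. ((\<psi> z - (xs m z + h z)) + (xs m z - k z)) + h z) n"
        by (intro arg_cong[where f = "\<lambda>u. fourier_coeff u n"] ext) simp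
      also have "\<dots> = fourier_coeff (\<lambda>z. \<psi> z - (xs m z + h z)) n + fourier_coeff (\<lambda>z. xs m z - k z) n"
        using n by (simp only: fourier_coeff_add[OF L2_add[OF L] laurent_L2[OF h(1)]]
            fourier_coeff_add[OF L] fourier_coeff_laurent[OF h(1)]) (simp add: fourier_coeff_laurent[OF h(1)])
      finally show ?thesis
        using norm_triangle_ineq[of "fourier_coeff (\<lambda>z. \<psi> z - (xs m z + h z)) n" "fourier_coeff (\<lambda>z. xs m z - k z) n"]
          norm_fourier_coeff_le[OF L(1), of n] norm_fourier_coeff_le[OF L(2), of n] h(2) by simp
    qed
    moreover have "(\<lambda>m. inverse (real (Suc m)) + L2_norm \<T> (\<lambda>t. xs m t - k t)) \<longlonglongrightarrow> 0"
      using tendsto_add[OF LIMSEQ_inverse_real_of_nat lim] by simp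
    ultimately have "norm (fourier_coeff (\<lambda>z. \<psi> z - k z) n) \<le> 0"
      by (intro LIMSEQ_le_const) auto
    then show ?thesis by simp
  qed
  ultimately show ?thesis using k by (intro bexI[of _ k]) auto
qed

section \<open>Factorization in the disc algebra\<close>

text \<open>
  Cauchy's theorem for $u(z) z^m$, which is continuous up to the unit circle.
\<close>

lemma disc_algebra_fourier_coeff:
  assumes c: "continuous_on (cball 0 1) u" and h: "u holomorphic_on ball 0 1" and n: "n < 0"
  shows "fourier_coeff u n = 0"
proof -
  \<comment> \<open>on the circle $dz = iz\,dt$ supplies one more power of $z$\<close>
  define m where "m = nat (- n) - 1"
  have m: "- n = int (Suc m)" using n by (simp add: m_def)
  let ?f = "\<lambda>z. u z * z ^ m"
  have cu: "continuous_on (sphere 0 1) u" by (rule continuous_on_subset[OF c]) auto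
  have "(?f has_contour_integral 0) (circlepath 0 1)"
  proof (rule Cauchy_theorem_convex[where S = "cball 0 1" and K = "{}"])
    show "continuous_on (cball 0 1) ?f" by (intro continuous_intros c)
    show "?f field_differentiable at x" if "x \<in> interior (cball 0 1) - {}" for x
    proof (rule holomorphic_on_imp_differentiable_at)
      show "?f holomorphic_on ball 0 1" by (intro holomorphic_intros h)
    qed (use that in auto)
  qed auto
  then have "contour_integral (circlepath 0 1) ?f = 0" by (rule contour_integral_unique)
  then have 0: "integral {0..2*pi} (\<lambda>t. ?f (cis t) * (\<i> * cis t)) = 0"
    unfolding circlepath_def by (subst (asm) contour_integral_part_circlepath_eq) (auto simp: mult_ac)
  have cc: "continuous_on {0..2*pi} (\<lambda>t. u (cis t) * cis t powi (- n))"
    by (intro continuous_intros continuous_on_compose2[OF cu]) auto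
  have "fourier_coeff u n = 1/(2*pi) * (LBINT t:{0..2*pi}. u (cis t) * cis t powi (- n))"
    unfolding fourier_coeff_powi_integral
  proof (rule circle_integral)
    have "(\<lambda>z. z powi (- n)) \<in> borel_measurable \<T>"
      by (rule borel_imp_circle[OF laurent_borel[OF laurent_powi[of _ UNIV]]]) simp
    then show "(\<lambda>z. u z * z powi (- n)) \<in> borel_measurable \<T>"
      using continuous_imp_circle[OF cu] by measurable
  qed
  also have "(LBINT t:{0..2*pi}. u (cis t) * cis t powi (- n)) =
      integral {0..2*pi} (\<lambda>t. u (cis t) * cis t powi (- n))"
    by (rule set_borel_integral_eq_integral(2)) (use borel_integrable_compact[OF _ cc] in \<open>simp add: set_integrable_def scaleR_conv_of_real indicator_def\<close>)
  also have "\<dots> = integral {0..2*pi} (\<lambda>t. (- \<i>) * (?f (cis t) * (\<i> * cis t)))"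
    by (intro integral_cong) (simp add: m power_int_add power_int_of_nat algebra_simps)
  also have "\<dots> = (- \<i>) * integral {0..2*pi} (\<lambda>t. ?f (cis t) * (\<i> * cis t))"
    by (rule integral_mult_right)
  finally show ?thesis using 0 by simp
qed

text \<open>
  The branch point is included because a polynomial to be factorized may have zeros on the unit
  circle.
\<close>

lemma continuous_on_csqrt_right_half_plane: "continuous_on {w. 0 \<le> Re w} csqrt"
  unfolding continuous_on_eq_continuous_within
proof
  fix w :: complex assume "w \<in> {w. 0 \<le> Re w}"
  show "continuous (at w within {w. 0 \<le> Re w}) csqrt"
  proof (cases "w = 0")
    case True
    have "((\<lambda>z::complex. sqrt (norm z)) \<longlongrightarrow> sqrt (norm (0::complex))) (at 0)"
      by (intro tendsto_intros)
    then have "((\<lambda>z. norm (csqrt z)) \<longlongrightarrow> 0) (at 0)" by (simp add: norm_csqrt)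
    then have "(csqrt \<longlongrightarrow> 0) (at 0)" by (rule tendsto_norm_zero_cancel)
    then have "isCont csqrt 0" by (simp add: isCont_def)
    then show ?thesis using True continuous_at_imp_continuous_at_within by blast
  next
    case False
    then have "w \<notin> \<real>\<^sub>\<le>\<^sub>0"
      using \<open>w \<in> _\<close> by (auto simp: complex_nonpos_Reals_iff complex_eq_iff)
    then show ?thesis by (rule continuous_at_imp_continuous_at_within[OF continuous_at_csqrt])
  qed
qed

text \<open>
  On the unit circle $f$ is a product of two functions in the disc algebra between which $|f|$ is
  divided evenly.
\<close>

definition disc_factors :: "(complex \<Rightarrow> complex) \<Rightarrow> bool" where
  "disc_factors f \<longleftrightarrow> (\<exists>u v. continuous_on (cball 0 1) u \<and> u holomorphic_on ball 0 1 \<and>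
     continuous_on (cball 0 1) v \<and> v holomorphic_on ball 0 1 \<and>
     (\<forall>z. norm z = 1 \<longrightarrow> f z = u z * v z \<and> (norm (u z))\<^sup>2 = norm (f z) \<and> (norm (v z))\<^sup>2 = norm (f z)))"

lemma disc_factors_mult:
  assumes "disc_factors f" "disc_factors g"
  shows "disc_factors (\<lambda>z. f z * g z)"
proof -
  obtain u v u' v' where
    "continuous_on (cball 0 1) u" "u holomorphic_on ball 0 1" "continuous_on (cball 0 1) v" "v holomorphic_on ball 0 1"
    "continuous_on (cball 0 1) u'" "u' holomorphic_on ball 0 1" "continuous_on (cball 0 1) v'" "v' holomorphic_on ball 0 1"
    "\<And>z. norm z = 1 \<Longrightarrow> f z = u z * v z \<and> (norm (u z))\<^sup>2 = norm (f z) \<and> (norm (v z))\<^sup>2 = norm (f z)"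
    "\<And>z. norm z = 1 \<Longrightarrow> g z = u' z * v' z \<and> (norm (u' z))\<^sup>2 = norm (g z) \<and> (norm (v' z))\<^sup>2 = norm (g z)"
    using assms unfolding disc_factors_def by blast
  then show ?thesis unfolding disc_factors_def
    by (intro exI[of _ "\<lambda>z. u z * u' z"] exI[of _ "\<lambda>z. v z * v' z"])
       (auto intro!: continuous_intros holomorphic_intros simp: norm_mult power_mult_distrib)
qed

lemma norm_csqrt_sq: "(norm (csqrt z))\<^sup>2 = norm z"
  by (simp add: norm_power[symmetric])

lemma disc_factors_const: "disc_factors (\<lambda>z. c)"
  unfolding disc_factors_def
  by (intro exI[of _ "\<lambda>z. csqrt c"]) (auto simp: norm_csqrt_sq power2_eq_square[symmetric])

lemma csqrt_linear:
  assumes "norm b \<le> 1"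
  shows "continuous_on (cball 0 1) (\<lambda>z. csqrt (1 - b * z))" "(\<lambda>z. csqrt (1 - b * z)) holomorphic_on ball 0 1"
proof -
  have le: "Re (b * z) \<le> norm z" for z
    using complex_Re_le_cmod[of "b * z"] mult_right_mono[OF assms, of "norm z"] by (simp add: norm_mult)
  show "continuous_on (cball 0 1) (\<lambda>z. csqrt (1 - b * z))"
  proof (rule continuous_on_compose2[OF continuous_on_csqrt_right_half_plane])
    show "(\<lambda>z. 1 - b * z) ` cball 0 1 \<subseteq> {w. 0 \<le> Re w}"
    proof safe
      fix z :: complex assume "z \<in> cball 0 1"
      then show "0 \<le> Re (1 - b * z)" using le[of z] by (simp del: times_complex.sel)
    qed
  qed (intro continuous_intros)
  show "(\<lambda>z. csqrt (1 - b * z)) holomorphic_on ball 0 1"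
  proof (rule holomorphic_on_csqrt')
    fix z :: complex assume "z \<in> ball 0 1"
    then have "0 < Re (1 - b * z)" using le[of z] by (simp del: times_complex.sel)
    then show "1 - b * z \<notin> \<real>\<^sub>\<le>\<^sub>0" by (metis complex_nonpos_Reals_iff not_less)
  qed (intro holomorphic_intros)
qed

text \<open>
  If $|a| \ge 1$ then $z - a = -a(1 - z/a)$ has a square root in the disc algebra. If $|a| < 1$,
  the Blaschke factor $(z-a)/(1-\overline{a}z)$ has modulus one on the circle, and the quotient
  $1 - \overline{a}z$ has a square root.
\<close>

lemma disc_factors_linear: "disc_factors (\<lambda>z. z - a)"
proof (cases "norm a \<ge> 1")
  case True
  then have a: "a \<noteq> 0" "norm (1 / a) \<le> 1" by (auto simp: norm_divide divide_simps)
  let ?u = "\<lambda>z. csqrt (- a) * csqrt (1 - 1 / a * z)"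
  have sq: "(?u z)\<^sup>2 = z - a" for z
    using a(1) by (simp add: power_mult_distrib field_simps)
  show ?thesis unfolding disc_factors_def
  proof (intro exI[of _ ?u] conjI allI impI)
    show "z - a = ?u z * ?u z" for z using sq[of z] by (simp only: power2_eq_square)
    show "(norm (?u z))\<^sup>2 = norm (z - a)" "(norm (?u z))\<^sup>2 = norm (z - a)" for z
      using sq[of z] by (simp_all only: norm_power[symmetric])
  qed (intro continuous_intros holomorphic_intros csqrt_linear a)+
next
  case False
  then have a: "norm (cnj a) \<le> 1" by simp
  have nz: "1 - cnj a * z \<noteq> 0" if "norm z \<le> 1" for z
  proof
    assume "1 - cnj a * z = 0"
    then have "norm a * norm z = 1" by (metis complex_mod_cnj eq_iff_diff_eq_0 norm_mult norm_one)
    moreover have "norm a * norm z \<le> norm a * 1" using that by (intro mult_left_mono) auto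
    ultimately show False using False by simp
  qed
  let ?v = "\<lambda>z. csqrt (1 - cnj a * z)" and ?u = "\<lambda>z. (z - a) / (1 - cnj a * z) * csqrt (1 - cnj a * z)"
  have v2: "?v z * ?v z = 1 - cnj a * z" for z by (simp add: power2_eq_square[symmetric])
  have nn: "norm (1 - cnj a * z) = norm (z - a)" if z: "norm z = 1" for z
  proof -
    have "z * cnj z = 1" using complex_norm_square[of z] z by simp
    then have "z * cnj (1 - cnj a * z) = z - a"
      by (simp add: algebra_simps)
    then have "norm (z * cnj (1 - cnj a * z)) = norm (z - a)" by simp
    then show ?thesis using z by (simp only: norm_mult complex_mod_cnj mult_1)
  qed
  show ?thesis unfolding disc_factors_def
  proof (rule exI[of _ ?u], rule exI[of _ ?v], intro conjI allI impI)
    fix z :: complex assume z: "norm z = 1"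
    then have nz': "1 - cnj a * z \<noteq> 0" using nz by simp
    have "?u z * ?v z = (z - a) / (1 - cnj a * z) * (?v z * ?v z)" by (simp only: mult.assoc)
    also have "\<dots> = z - a" using nz' unfolding v2 by simp
    finally show "z - a = ?u z * ?v z" ..
    show v: "(norm (?v z))\<^sup>2 = norm (z - a)" using nn[OF z] by (simp add: norm_csqrt_sq)
    show "(norm (?u z))\<^sup>2 = norm (z - a)"
      unfolding norm_mult power_mult_distrib v norm_divide nn[OF z] using nn[OF z] nz' by simp
  next
    show "continuous_on (cball 0 1) ?u" "continuous_on (cball 0 1) ?v"
      using nz by (auto intro!: continuous_intros csqrt_linear a)
    show "?u holomorphic_on ball 0 1" "?v holomorphic_on ball 0 1"
      using nz by (auto intro!: holomorphic_intros csqrt_linear a)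
  qed
qed

lemma disc_factors_poly: "disc_factors (poly p)"
proof (induction "degree p" arbitrary: p)
  case 0
  then obtain c where "p = [:c:]" by (metis degree_eq_zeroE)
  then show ?case using disc_factors_const[of c] by (simp add: disc_factors_def)
next
  case (Suc n)
  then have "degree p > 0" by simp
  then obtain a where "poly p a = 0" using alg_closed_imp_poly_has_root[of p] by blast
  then obtain q where q: "p = [:- a, 1:] * q" by (meson dvdE poly_eq_0_iff_dvd)
  have "q \<noteq> 0" using q Suc(2) by auto
  then have "degree p = Suc (degree q)" unfolding q by (subst degree_mult_eq) auto
  then have "disc_factors (poly q)" using Suc by simp
  from disc_factors_mult[OF disc_factors_linear this, of a]
  show ?case unfolding disc_factors_def q by (simp add: algebra_simps)
qed

lemma laurent_nonneg_poly: "f \<in> laurent {0..} \<Longrightarrow> \<exists>p. f = poly p"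
proof (induction f rule: laurent.induct)
  case zero
  show ?case by (intro exI[of _ 0]) auto
next
  case (step f i c)
  then obtain p where "f = poly p" by blast
  then have "(\<lambda>z. f z + c * z powi i) = poly (p + monom c (nat i))"
    using step(2) by (auto simp: poly_monom power_int_def)
  then show ?case by blast
qed

text \<open>
  Approximate the two factors of $f = uv$ by polynomials and use
  $\|u\|^2 = \|v\|^2 = \|f\|_1$.
\<close>

lemma bilinear_bound_imp_L1_bound:
  assumes \<psi>: "\<psi> \<in> borel_measurable \<T>" "AE z in \<T>. norm (\<psi> z) \<le> B" "0 \<le> B"
    and bd: "\<And>p q. p \<in> laurent {0..} \<Longrightarrow> q \<in> laurent {0..} \<Longrightarrow>
      norm (\<integral>z. \<psi> z * p z * q z \<partial>\<T>) \<le> e * L2_norm \<T> p * L2_norm \<T> q"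
    and f: "f \<in> laurent {0..}"
  shows "norm (\<integral>z. \<psi> z * f z \<partial>\<T>) \<le> e * (\<integral>z. norm (f z) \<partial>\<T>)"
proof -
  obtain P where "f = poly P" using laurent_nonneg_poly[OF f] by blast
  then have "disc_factors f" using disc_factors_poly by simp
  then obtain u v where uv: "continuous_on (cball 0 1) u" "u holomorphic_on ball 0 1"
    "continuous_on (cball 0 1) v" "v holomorphic_on ball 0 1"
    "\<And>z. norm z = 1 \<Longrightarrow> f z = u z * v z" "\<And>z. norm z = 1 \<Longrightarrow> (norm (u z))\<^sup>2 = norm (f z)"
    "\<And>z. norm z = 1 \<Longrightarrow> (norm (v z))\<^sup>2 = norm (f z)"
    unfolding disc_factors_def by blast
  have approx: "w \<in> L2 \<T> \<and> w \<in> L2_closure \<T> (laurent {0..})"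
    if w: "continuous_on (cball 0 1) w" "w holomorphic_on ball 0 1" for w
  proof
    have cw: "continuous_on (sphere 0 1) w" by (rule continuous_on_subset[OF w(1)]) auto
    show L: "w \<in> L2 \<T>" by (rule continuous_circle_L2[OF cw])
    show "w \<in> L2_closure \<T> (laurent {0..})"
      by (rule circle_closure_laurent[OF L]) (use disc_algebra_fourier_coeff[OF w] in auto)
  qed
  have L: "u \<in> L2 \<T>" "v \<in> L2 \<T>" using approx uv by auto
  obtain p where p: "\<And>n. p n \<in> laurent {0..}" "(\<lambda>n. L2_norm \<T> (\<lambda>z. p n z - u z)) \<longlonglongrightarrow> 0"
    using L2_closure_approx approx[OF uv(1,2)] by blast
  obtain q where q: "\<And>n. q n \<in> laurent {0..}" "(\<lambda>n. L2_norm \<T> (\<lambda>z. q n z - v z)) \<longlonglongrightarrow> 0"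
    using L2_closure_approx approx[OF uv(3,4)] by blast
  note pL = laurent_L2[OF p(1)] and qL = laurent_L2[OF q(1)]
  have "(\<lambda>n. norm (\<integral>z. \<psi> z * p n z * q n z \<partial>\<T>)) \<longlonglongrightarrow> norm (\<integral>z. \<psi> z * u z * v z \<partial>\<T>)"
    by (intro tendsto_norm L2_bilinear_tendsto[OF \<psi> pL qL L p(2) q(2)])
  moreover have "(\<lambda>n. e * L2_norm \<T> (p n) * L2_norm \<T> (q n)) \<longlonglongrightarrow> e * L2_norm \<T> u * L2_norm \<T> v"
    by (intro tendsto_intros L2_norm_tendsto[OF pL L(1) p(2)] L2_norm_tendsto[OF qL L(2) q(2)])
  ultimately have "norm (\<integral>z. \<psi> z * u z * v z \<partial>\<T>) \<le> e * L2_norm \<T> u * L2_norm \<T> v"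
    by (rule LIMSEQ_le) (use bd p(1) q(1) in auto)
  also have "(\<integral>z. \<psi> z * u z * v z \<partial>\<T>) = (\<integral>z. \<psi> z * f z \<partial>\<T>)"
    by (rule circle_integral_cong) (simp add: uv(5) mult.assoc)
  also have "L2_norm \<T> u = sqrt (\<integral>z. norm (f z) \<partial>\<T>)"
    unfolding L2_norm_def by (intro arg_cong[where f = sqrt] circle_integral_cong uv)
  also have "L2_norm \<T> v = sqrt (\<integral>z. norm (f z) \<partial>\<T>)"
    unfolding L2_norm_def by (intro arg_cong[where f = sqrt] circle_integral_cong uv)
  finally show ?thesis by (simp add: mult.assoc)
qed

text \<open>
  Nehari's theorem applies to $z^{n-1}\psi$. Multiplication of the result by $z^{1-n}$ leaves
  only finitely many negative frequencies uncontrolled, and these are collected in \<open>g\<close>.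
\<close>

lemma hankel_form_small_imp_approx:
  assumes \<psi>: "\<psi> \<in> borel_measurable \<T>" "AE z in \<T>. norm (\<psi> z) \<le> B" "0 \<le> B" and e: "e \<ge> 0"
    and bd: "\<And>p q. p \<in> laurent {0..} \<Longrightarrow> q \<in> laurent {0..} \<Longrightarrow>
      norm (\<integral>z. \<psi> z * z powi n * p z * q z \<partial>\<T>) \<le> e * L2_norm \<T> p * L2_norm \<T> q"
  shows "\<exists>g\<in>laurent UNIV. \<exists>k\<in>borel_measurable \<T>. (AE z in \<T>. norm (k z) \<le> e) \<and>
    (\<forall>m<0. fourier_coeff \<psi> m = fourier_coeff g m + fourier_coeff k m)"
proof -
  have pm [measurable]: "(\<lambda>z. z powi m) \<in> borel_measurable \<T>" for m
    by (rule L2_measurable[OF powi_L2])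
  have shift: "(\<lambda>z. w z * z powi m) \<in> borel_measurable \<T> \<and> (AE z in \<T>. norm (w z * z powi m) \<le> b)"
    if "w \<in> borel_measurable \<T>" "AE z in \<T>. norm (w z) \<le> b" for w b m
  proof
    show "(\<lambda>z. w z * z powi m) \<in> borel_measurable \<T>" using that(1) by measurable
    have "AE z in \<T>. norm (z powi m) = 1" by (rule AE_circleI) (simp add: norm_power_int)
    with that(2) show "AE z in \<T>. norm (w z * z powi m) \<le> b"
      by eventually_elim (simp add: norm_mult)
  qed
  have coeff_shift: "fourier_coeff (\<lambda>z. w z * z powi m) j = fourier_coeff w (j - m)" for w m j
    unfolding fourier_coeff_powi_integral
    by (rule circle_integral_cong) (simp add: powi_add_circle[symmetric] mult.assoc)
  \<comment> \<open>the exponent \<open>n - 1\<close> leaves one factor \<open>z\<close> for the polynomials without constant term in \<open>nehari_L1\<close>\<close>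
  let ?\<psi>n = "\<lambda>z. \<psi> z * z powi n" and ?\<psi>' = "\<lambda>z. \<psi> z * z powi (n - 1)"
  have bL: "w \<in> L2 \<T>" if "w \<in> borel_measurable \<T>" "AE z in \<T>. norm (w z) \<le> b" for w b
    by (rule L2_bounded[OF finite_measure_circle that])
  have "\<exists>k\<in>borel_measurable \<T>. (AE z in \<T>. norm (k z) \<le> e) \<and>
    (\<forall>n<0. fourier_coeff (\<lambda>z. ?\<psi>' z - k z) n = 0)"
  proof (rule nehari_L1[OF _ e])
    show "?\<psi>' \<in> L2 \<T>" using shift[OF \<psi>(1,2)] bL by blast
    fix f assume f: "f \<in> laurent {1..}"
    obtain h where h: "h \<in> laurent ((\<lambda>i. i + (-1)) ` {1..})" "\<And>z. z \<noteq> 0 \<Longrightarrow> h z = f z * z powi (-1)"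
      using laurent_mult_powi[OF f] by blast
    have h0: "h \<in> laurent {0..}" by (rule laurent_mono[OF h(1)]) auto
    have hz: "h z = f z * z powi (-1)" if "norm z = 1" for z using h(2)[of z] that by (cases "z = 0") auto
    have "norm (\<integral>z. ?\<psi>n z * h z \<partial>\<T>) \<le> e * (\<integral>z. norm (h z) \<partial>\<T>)"
      by (rule bilinear_bound_imp_L1_bound[OF _ _ \<psi>(3) bd h0])
         (use shift[OF \<psi>(1,2), of n] in auto)
    also have "(\<integral>z. ?\<psi>n z * h z \<partial>\<T>) = (\<integral>z. ?\<psi>' z * f z \<partial>\<T>)"
    proof (rule circle_integral_cong)
      fix z :: complex assume z: "norm z = 1"
      have "z powi (n - 1) = z powi n * z powi (-1)" using powi_add_circle[OF z, of n "-1"] by simp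
      then show "?\<psi>n z * h z = ?\<psi>' z * f z" using hz[OF z] by (simp add: mult_ac)
    qed
    also have "(\<integral>z. norm (h z) \<partial>\<T>) = (\<integral>z. norm (f z) \<partial>\<T>)"
      by (rule circle_integral_cong) (simp add: hz norm_mult norm_power_int norm_inverse)
    finally show "norm (\<integral>z. ?\<psi>' z * f z \<partial>\<T>) \<le> e * (\<integral>z. norm (f z) \<partial>\<T>)" .
  qed
  then obtain k' where k': "k' \<in> borel_measurable \<T>" "AE z in \<T>. norm (k' z) \<le> e"
    and co: "\<And>j. j < 0 \<Longrightarrow> fourier_coeff (\<lambda>z. ?\<psi>' z - k' z) j = 0" by blast
  define k where "k z = k' z * z powi (1 - n)" for z
  have k: "k \<in> borel_measurable \<T>" "AE z in \<T>. norm (k z) \<le> e"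
    using shift[OF k', of "1 - n"] by (simp_all add: k_def[abs_def])
  have eq: "fourier_coeff \<psi> j = fourier_coeff k j" if "j < 1 - n" for j
  proof -
    have "0 = fourier_coeff ?\<psi>' (j + n - 1) - fourier_coeff k' (j + n - 1)"
      using co[of "j + n - 1"] that fourier_coeff_diff[OF bL bL[OF k'], of ?\<psi>' B] shift[OF \<psi>(1,2), of "n - 1"]
      by simp
    then show ?thesis
      using coeff_shift[of \<psi> "n - 1" "j + n - 1"] coeff_shift[of k' "1 - n" j]
      by (simp add: k_def[abs_def] algebra_simps)
  qed
  define g where "g z = (\<Sum>j\<in>{1 - n..<0}. (fourier_coeff \<psi> j - fourier_coeff k j) * z powi j)" for z
  have gl: "g \<in> laurent UNIV" unfolding g_def by (intro laurent_sum laurent_term) simp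
  have gc: "fourier_coeff g m = (if m \<in> {1 - n..<0} then fourier_coeff \<psi> m - fourier_coeff k m else 0)" for m
  proof -
    have "fourier_coeff (\<lambda>z. \<Sum>j\<in>F. c j * z powi j) m = (if m \<in> F then c m else 0)"
      if "finite F" for F :: "int set" and c
      using that
    proof (induction F rule: finite_induct)
      case (insert j F)
      have "fourier_coeff (\<lambda>z. c j * z powi j + (\<Sum>j\<in>F. c j * z powi j)) m
        = fourier_coeff (\<lambda>z. c j * z powi j) m + fourier_coeff (\<lambda>z. \<Sum>j\<in>F. c j * z powi j) m"
        by (intro fourier_coeff_add laurent_L2[where I = UNIV] laurent_sum laurent_term UNIV_I)
      then show ?case using insert by (auto simp: fourier_coeff_cmult fourier_coeff_powi)
    qed (simp add: fourier_coeff_def)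
    from this[of "{1 - n..<0}" "\<lambda>j. fourier_coeff \<psi> j - fourier_coeff k j"]
    show ?thesis unfolding g_def by simp
  qed
  have "fourier_coeff \<psi> m = fourier_coeff g m + fourier_coeff k m" if "m < 0" for m
    using eq[of m] gc[of m] that by (cases "m < 1 - n") auto
  then show ?thesis using gl k by blast
qed

section \<open>Fejer means and the space $H^\infty + C$\<close>

text \<open>
  The Cesaro mean of the Fourier series, written as a double sum: this exhibits its kernel as
  $\frac1N |\sum_{j<N} z^j \overline{w}^j|^2$.
\<close>

definition fejer_mean :: "nat \<Rightarrow> (complex \<Rightarrow> complex) \<Rightarrow> complex \<Rightarrow> complex" where
  "fejer_mean N f z = (\<Sum>j<N. \<Sum>l<N. fourier_coeff f (int j - int l) * z powi (int j - int l)) / of_nat N"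

lemma fejer_kernel:
  fixes z w :: complex
  assumes z: "norm z = 1" and w: "norm w = 1"
  shows "(\<Sum>j<N. \<Sum>l<N. z powi (int j - int l) * w powi (- (int j - int l)))
    = of_real ((norm (\<Sum>j<N. z powi int j * w powi (- int j)))\<^sup>2)"
proof -
  have c: "cnj (z powi int l * w powi (- int l)) = z powi (- int l) * w powi (int l)" for l
    using cnj_powi_circle[OF z, of "int l"] cnj_powi_circle[OF w, of "- int l"] by (simp only: complex_cnj_mult minus_minus)
  have t: "z powi (int j - int l) * w powi (- (int j - int l))
      = (z powi int j * w powi (- int j)) * cnj (z powi int l * w powi (- int l))" for j l
    unfolding c using powi_add_circle[OF z, of "int j" "- int l"] powi_add_circle[OF w, of "- int j" "int l"]
    by (simp add: mult_ac)
  have "(\<Sum>j<N. \<Sum>l<N. z powi (int j - int l) * w powi (- (int j - int l)))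
    = (\<Sum>j<N. z powi int j * w powi (- int j)) * cnj (\<Sum>j<N. z powi int j * w powi (- int j))"
    unfolding t cnj_sum sum_product ..
  then show ?thesis by (simp only: complex_norm_square)
qed

text \<open>
  The Fejer mean is an average of \<open>k\<close> against a nonnegative kernel of total mass one.
\<close>

lemma fejer_mean_bounded:
  assumes k: "k \<in> borel_measurable \<T>" "AE z in \<T>. norm (k z) \<le> e" and z: "norm z = 1" and N: "N > 0"
  shows "norm (fejer_mean N k z) \<le> e"
proof -
  have kL: "k \<in> L2 \<T>" by (rule L2_bounded[OF finite_measure_circle k])
  define Q where "Q w = (norm (\<Sum>j<N. z powi int j * w powi (- int j)))\<^sup>2" for w
  have Q: "of_real (Q w) = (\<Sum>j<N. \<Sum>l<N. z powi (int j - int l) * w powi (- (int j - int l)))" if "norm w = 1" for w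
    unfolding Q_def by (rule fejer_kernel[OF z that, symmetric])
  have Qlaur: "(\<lambda>w. \<Sum>j<N. \<Sum>l<N. z powi (int j - int l) * w powi (- (int j - int l))) \<in> laurent UNIV"
    by (intro laurent_sum laurent_term) simp
  have i1: "integrable \<T> (\<lambda>w. u w * w powi m)" if "u \<in> L2 \<T>" for u m
    by (rule L2_mult_integrable[OF that powi_L2])
  have one: "(\<lambda>x. 1) \<in> L2 \<T>" by (simp add: L2_def)
  have eq: "(\<integral>w. u w * of_real (Q w) \<partial>\<T>) = (\<Sum>j<N. \<Sum>l<N. z powi (int j - int l) * fourier_coeff u (int j - int l))"
    if "u \<in> L2 \<T>" for u
  proof -
    have "(\<integral>w. u w * of_real (Q w) \<partial>\<T>) = (\<integral>w. (\<Sum>j<N. \<Sum>l<N. z powi (int j - int l) * (u w * w powi (- (int j - int l)))) \<partial>\<T>)"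
      by (rule circle_integral_cong) (simp only: Q sum_distrib_left mult_ac)
    also have "\<dots> = (\<Sum>j<N. \<Sum>l<N. z powi (int j - int l) * fourier_coeff u (int j - int l))"
      unfolding fourier_coeff_powi_integral
      using i1[OF that] by (subst Bochner_Integration.integral_sum; simp add: Bochner_Integration.integral_sum)
    finally show ?thesis .
  qed
  have Qm: "Q \<in> borel_measurable \<T>"
  proof -
    have "(\<lambda>w. \<Sum>j<N. z powi int j * w powi (- int j)) \<in> laurent UNIV"
      by (intro laurent_sum laurent_term) simp
    from borel_imp_circle[OF laurent_borel[OF this]] show ?thesis unfolding Q_def by measurable
  qed
  obtain b where b: "\<And>w. norm w = 1 \<Longrightarrow> Q w \<le> b"
  proof -
    obtain b where "\<forall>w\<in>sphere 0 1. norm (\<Sum>j<N. \<Sum>l<N. z powi (int j - int l) * w powi (- (int j - int l))) \<le> b"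
      using laurent_bounded[OF Qlaur, of 1] by auto
    then have "norm (complex_of_real (Q w)) \<le> b" if "norm w = 1" for w using that Q by auto
    then have "Q w \<le> b" if "norm w = 1" for w using that by (fastforce simp: abs_le_iff)
    then show ?thesis using that by blast
  qed
  have Qi: "integrable \<T> Q"
  proof (rule Bochner_Integration.integrable_bound)
    show "integrable \<T> (\<lambda>w. b)" by simp
    show "AE w in \<T>. norm (Q w) \<le> norm b"
      by (rule AE_circleI) (use b in \<open>fastforce simp: Q_def\<close>)
  qed (rule Qm)
  have Q1: "(\<integral>w. Q w \<partial>\<T>) = real N"
  proof -
    have fc: "fourier_coeff (\<lambda>x. 1) m = (if m = 0 then 1 else 0)" for m
      using fourier_coeff_powi[of 0 m] by auto
    have "complex_of_real (\<integral>w. Q w \<partial>\<T>) = (\<integral>w. 1 * of_real (Q w) \<partial>\<T>)" by simp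
    also have "\<dots> = (\<Sum>j<N. \<Sum>l<N. if int j - int l = 0 then 1 else 0)"
      unfolding eq[OF one] by (intro sum.cong) (auto simp: fc)
    also have "\<dots> = (\<Sum>j<N. \<Sum>l<N. if l = j then 1 else 0)" by (intro sum.cong) auto
    also have "\<dots> = of_nat N" by (simp add: sum.delta)
    finally show ?thesis by (metis of_real_eq_iff of_real_of_nat_eq)
  qed
  have "of_nat N * fejer_mean N k z = (\<integral>w. k w * of_real (Q w) \<partial>\<T>)"
    unfolding eq[OF kL] fejer_mean_def using N by (simp add: mult.commute)
  then have "real N * norm (fejer_mean N k z) = norm (\<integral>w. k w * of_real (Q w) \<partial>\<T>)"
    by (metis norm_mult norm_of_nat)
  also have "\<dots> \<le> (\<integral>w. norm (k w * of_real (Q w)) \<partial>\<T>)" by (rule integral_norm_bound)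
  also have "\<dots> \<le> (\<integral>w. e * Q w \<partial>\<T>)"
  proof (rule integral_mono_AE)
    have "integrable \<T> (\<lambda>w. k w * (\<Sum>j<N. \<Sum>l<N. z powi (int j - int l) * w powi (- (int j - int l))))"
      by (rule L2_mult_integrable[OF kL laurent_L2[OF Qlaur]])
    then have "integrable \<T> (\<lambda>w. k w * of_real (Q w))"
      by (subst Bochner_Integration.integrable_cong[OF refl]) (auto simp: Q)
    then show "integrable \<T> (\<lambda>w. norm (k w * of_real (Q w)))" by (rule integrable_norm)
    show "AE w in \<T>. norm (k w * of_real (Q w)) \<le> e * Q w"
      using k(2)
    proof eventually_elim
      case (elim w)
      have Q0: "0 \<le> Q w" by (simp add: Q_def)
      then have "norm (k w * of_real (Q w)) = norm (k w) * Q w" by (simp add: norm_mult)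
      also have "\<dots> \<le> e * Q w" using elim Q0 by (rule mult_right_mono)
      finally show ?case .
    qed
  qed (use Qi in simp)
  also have "\<dots> = real N * e" using Q1 by simp
  finally show ?thesis using N by simp
qed

lemma fejer_mean_powi:
  "fejer_mean N (\<lambda>z. z powi i) z = of_nat (card {(j, l). j < N \<and> l < N \<and> int j - int l = i}) / of_nat N * z powi i"
proof -
  have "(\<Sum>j<N. \<Sum>l<N. fourier_coeff (\<lambda>z. z powi i) (int j - int l) * z powi (int j - int l))
     = (\<Sum>(j, l)\<in>{..<N} \<times> {..<N}. if int j - int l = i then z powi i else 0)"
    by (subst sum.cartesian_product) (auto intro!: sum.cong simp: fourier_coeff_powi)
  also have "\<dots> = (\<Sum>(j, l)\<in>{(j, l). j < N \<and> l < N \<and> int j - int l = i}. z powi i)"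
    by (rule sum.mono_neutral_cong_right) (auto split: if_splits)
  also have "\<dots> = of_nat (card {(j, l). j < N \<and> l < N \<and> int j - int l = i}) * z powi i"
    by (simp add: case_prod_unfold)
  finally show ?thesis by (simp add: fejer_mean_def)
qed

lemma card_diagonal: "real N - \<bar>of_int i\<bar> \<le> real (card {(j, l). j < N \<and> l < N \<and> int j - int l = i})"
  "card {(j, l). j < N \<and> l < N \<and> int j - int l = i} \<le> N"
proof -
  let ?A = "{(j, l). j < N \<and> l < N \<and> int j - int l = i}"
  have sub: "?A \<subseteq> {..<N} \<times> {..<N}" by auto
  have fin: "finite ?A" by (rule finite_subset[OF sub]) simp
  have "inj_on fst ?A" by (auto simp: inj_on_def)
  moreover have "fst ` ?A \<subseteq> {..<N}" by auto
  ultimately show "card ?A \<le> N" using card_inj_on_le[of fst ?A "{..<N}"] by simp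
  let ?f = "\<lambda>t. (t + nat i, t + nat (- i))"
  have "?f ` {..<N - nat \<bar>i\<bar>} \<subseteq> ?A" by auto
  moreover have "inj_on ?f {..<N - nat \<bar>i\<bar>}" by (auto simp: inj_on_def)
  ultimately have "N - nat \<bar>i\<bar> \<le> card ?A" using card_inj_on_le[OF _ _ fin, of ?f "{..<N - nat \<bar>i\<bar>}"] by simp
  then show "real N - \<bar>of_int i\<bar> \<le> real (card ?A)" by linarith
qed

lemma fejer_mean_converges:
  assumes "D \<in> laurent I" "\<delta> > 0"
  shows "eventually (\<lambda>N. \<forall>z. norm z = 1 \<longrightarrow> norm (D z - fejer_mean N D z) \<le> \<delta>) sequentially"
  using assms
proof (induction D arbitrary: \<delta> rule: laurent.induct)
  case zero
  then show ?case by (simp add: fejer_mean_def fourier_coeff_def)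
next
  case (step f i c)
  have add: "fejer_mean N (\<lambda>z. f z + c * z powi i) z = fejer_mean N f z + c * fejer_mean N (\<lambda>z. z powi i) z" for N z
    unfolding fejer_mean_def
    by (simp add: fourier_coeff_add[OF laurent_L2[OF step(1)] L2_cmult[OF powi_L2]] fourier_coeff_cmult
      distrib_right sum.distrib add_divide_distrib sum_distrib_left mult.assoc)
  define d where "d = \<delta> / 2 / (norm c + 1)"
  have d: "d > 0" unfolding d_def using step(4) by (auto intro!: divide_pos_pos add_nonneg_pos)
  have "eventually (\<lambda>N. \<forall>z. norm z = 1 \<longrightarrow> norm (f z - fejer_mean N f z) \<le> \<delta>/2) sequentially"
    using step(3)[of "\<delta>/2"] step(4) by simp
  moreover have "eventually (\<lambda>N. \<bar>of_int i\<bar> / d \<le> real N \<and> N > 0) sequentially"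
  proof (rule eventually_conj)
    show "eventually (\<lambda>N. \<bar>of_int i\<bar> / d \<le> real N) sequentially"
      using filterlim_real_sequentially by (simp add: filterlim_at_top)
  qed (rule eventually_gt_at_top)
  ultimately show ?case
  proof eventually_elim
    case (elim N)
    show ?case
    proof (intro allI impI)
      fix z :: complex assume z: "norm z = 1"
      let ?K = "real (card {(j, l). j < N \<and> l < N \<and> int j - int l = i})"
      have N: "N > 0" using elim by simp
      have "\<bar>1 - ?K / real N\<bar> = (real N - ?K) / real N"
        using card_diagonal(2)[of N i] N by (simp add: abs_if field_simps)
      also have "\<dots> \<le> \<bar>of_int i\<bar> / real N" using card_diagonal(1)[of N i] N by (intro divide_right_mono) auto
      also have "\<dots> \<le> d" using elim(2) d N by (simp add: field_simps)
      finally have 1: "\<bar>1 - ?K / real N\<bar> \<le> d" .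
      have "z powi i - fejer_mean N (\<lambda>z. z powi i) z = of_real (1 - ?K / real N) * z powi i"
        unfolding fejer_mean_powi by (simp add: left_diff_distrib)
      then have "norm (z powi i - fejer_mean N (\<lambda>z. z powi i) z) = \<bar>1 - ?K / real N\<bar>"
        using z by (simp only: norm_mult norm_of_real norm_power_int power_int_1_left mult_1_right)
      with 1 have 2: "norm (z powi i - fejer_mean N (\<lambda>z. z powi i) z) \<le> d" by simp
      have "(f z + c * z powi i) - fejer_mean N (\<lambda>z. f z + c * z powi i) z
        = (f z - fejer_mean N f z) + c * (z powi i - fejer_mean N (\<lambda>z. z powi i) z)"
        unfolding add by (simp add: algebra_simps)
      also have "norm \<dots> \<le> \<delta>/2 + norm c * d"
        using elim(1) z 2 by (intro order_trans[OF norm_triangle_ineq] add_mono) (auto simp: norm_mult intro!: mult_left_mono)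
      also have "norm c * d \<le> (norm c + 1) * d" using d by (intro mult_right_mono) auto
      also have "(norm c + 1) * d = \<delta>/2"
      proof -
        have "norm c + 1 \<noteq> 0" using norm_ge_zero[of c] by linarith
        then show ?thesis unfolding d_def by (simp add: divide_simps)
      qed
      finally show "norm ((f z + c * z powi i) - fejer_mean N (\<lambda>z. f z + c * z powi i) z) \<le> \<delta>" by simp
    qed
  qed
qed

text \<open>
  The Fejer means of \<open>D\<close> and \<open>k\<close> have the same negative frequencies, so their difference is
  an analytic polynomial. It differs from \<open>D\<close> by the error of the Fejer mean of \<open>D\<close> and the
  Fejer mean of \<open>k\<close>, which is bounded by \<open>e\<close>.
\<close>

lemma laurent_near_analytic:
  assumes D: "D \<in> laurent UNIV" and k: "k \<in> borel_measurable \<T>" "AE z in \<T>. norm (k z) \<le> e"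
    and eq: "\<And>m. m < 0 \<Longrightarrow> fourier_coeff D m = fourier_coeff k m" and \<delta>: "\<delta> > 0"
  shows "\<exists>a\<in>laurent {0..}. \<forall>z. norm z = 1 \<longrightarrow> norm (D z - a z) \<le> e + \<delta>"
proof -
  obtain N where N: "N > 0" "\<And>z. norm z = 1 \<Longrightarrow> norm (D z - fejer_mean N D z) \<le> \<delta>"
  proof -
    have "eventually (\<lambda>N. N > 0 \<and> (\<forall>z. norm z = 1 \<longrightarrow> norm (D z - fejer_mean N D z) \<le> \<delta>)) sequentially"
      by (intro eventually_conj eventually_gt_at_top fejer_mean_converges[OF D \<delta>])
    then show ?thesis using that by (auto simp: eventually_sequentially)
  qed
  define a where "a z = (\<Sum>j<N. \<Sum>l<N. (fourier_coeff D (int j - int l) - fourier_coeff k (int j - int l)) / of_nat N * z powi (int j - int l))" for z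
  have ae: "a z = fejer_mean N D z - fejer_mean N k z" for z
    unfolding a_def fejer_mean_def
    by (simp add: sum_subtractf[symmetric] diff_divide_distrib[symmetric] sum_divide_distrib left_diff_distrib)
  have "a \<in> laurent {0..}"
    unfolding a_def
  proof (intro laurent_sum)
    fix j l
    show "(\<lambda>z. (fourier_coeff D (int j - int l) - fourier_coeff k (int j - int l)) / of_nat N * z powi (int j - int l)) \<in> laurent {0..}"
    proof (cases "j < l")
      case True
      then show ?thesis using eq[of "int j - int l"] by (simp add: laurent.zero)
    next
      case False
      then show ?thesis by (intro laurent_term) simp
    qed
  qed
  moreover have "norm (D z - a z) \<le> e + \<delta>" if z: "norm z = 1" for z
  proof -
    have eq: "D z - a z = (D z - fejer_mean N D z) + fejer_mean N k z" unfolding ae by simp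
    have "norm (D z - a z) \<le> norm (D z - fejer_mean N D z) + norm (fejer_mean N k z)"
      unfolding eq by (rule norm_triangle_ineq)
    then show ?thesis
      using N(2)[OF z] fejer_mean_bounded[OF k z N(1)] by linarith
  qed
  ultimately show ?thesis by blast
qed

text \<open>
  This is the closedness of $H^\infty + C$. Take $\psi = g_n + k_n$ modulo functions without
  negative frequencies, with $|k_n| \le 2^{-n}$. Then $g_{n+1} - g_n$ has the negative frequencies of
  $k_n - k_{n+1}$, so an analytic polynomial $a_n$ is uniformly close to it. The series
  $g_0 + \sum_n (g_{n+1} - g_n - a_n)$ converges uniformly to a continuous function with the
  negative Fourier coefficients of $\psi$.
\<close>

lemma Hinfty_plus_C_I:
  assumes \<psi>: "\<psi> \<in> Linfty \<T>"
    and approx: "\<And>e. e > 0 \<Longrightarrow> \<exists>g\<in>laurent UNIV. \<exists>k\<in>borel_measurable \<T>. (AE z in \<T>. norm (k z) \<le> e) \<and>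
      (\<forall>m<0. fourier_coeff \<psi> m = fourier_coeff g m + fourier_coeff k m)"
  shows "\<psi> \<in> Hinfty_plus_C"
proof -
  have "\<forall>n. \<exists>g k. g \<in> laurent UNIV \<and> k \<in> borel_measurable \<T> \<and> (AE z in \<T>. norm (k z) \<le> (1/2)^n) \<and>
      (\<forall>m<0. fourier_coeff \<psi> m = fourier_coeff g m + fourier_coeff k m)"
    using approx[of "(1/2)^n" for n] by (metis zero_less_divide_1_iff zero_less_numeral zero_less_power)
  then obtain g k where g: "\<And>n. g n \<in> laurent UNIV" and k: "\<And>n. k n \<in> borel_measurable \<T>"
      "\<And>n. AE z in \<T>. norm (k n z) \<le> (1/2)^n"
    and co: "\<And>n m. m < 0 \<Longrightarrow> fourier_coeff \<psi> m = fourier_coeff (g n) m + fourier_coeff (k n) m"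
    by metis
  have kL: "k n \<in> L2 \<T>" for n by (rule L2_bounded[OF finite_measure_circle k])
  have "\<exists>a\<in>laurent {0..}. \<forall>z. norm z = 1 \<longrightarrow> norm ((g (Suc n) z - g n z) - a z) \<le> 2 * (1/2)^n + (1/2)^n" for n
  proof (rule laurent_near_analytic)
    show "(\<lambda>z. g (Suc n) z - g n z) \<in> laurent UNIV" by (intro laurent_diff g)
    show "(\<lambda>z. k n z - k (Suc n) z) \<in> borel_measurable \<T>" using k(1)[of n] k(1)[of "Suc n"] by measurable
    show "AE z in \<T>. norm (k n z - k (Suc n) z) \<le> 2 * (1/2)^n"
      using k(2)[of n] k(2)[of "Suc n"]
    proof eventually_elim
      case (elim z)
      have "(1/2::real)^Suc n \<le> (1/2)^n" by simp
      then show ?case using elim norm_triangle_ineq4[of "k n z" "k (Suc n) z"] by linarith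
    qed
    show "fourier_coeff (\<lambda>z. g (Suc n) z - g n z) m = fourier_coeff (\<lambda>z. k n z - k (Suc n) z) m" if "m < 0" for m
      using co[OF that, of n] co[OF that, of "Suc n"]
      by (simp add: fourier_coeff_diff[OF laurent_L2[OF g] laurent_L2[OF g]] fourier_coeff_diff[OF kL kL])
         (metis add_diff_cancel_left' add_diff_cancel_right' add_diff_eq diff_add_eq)
  qed simp
  then obtain a where a: "\<And>n. a n \<in> laurent {0..}"
    "\<And>n z. norm z = 1 \<Longrightarrow> norm ((g (Suc n) z - g n z) - a n z) \<le> 3 * (1/2)^n" by (metis mult.commute distrib_left numeral_plus_one semiring_norm(5) mult_1 distrib_right one_add_one numeral_Bit1)
  define d where "d n z = (g (Suc n) z - g n z) - a n z" for n z
  define G where "G z = g 0 z + (\<Sum>n. d n z)" for z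
  have sumb: "summable (\<lambda>n. 3 * (1/2::real)^n)" by (intro summable_mult summable_geometric) simp
  have ul: "uniform_limit (sphere 0 1) (\<lambda>n z. \<Sum>i<n. d i z) (\<lambda>z. \<Sum>n. d n z) sequentially"
    by (rule Weierstrass_m_test[OF _ sumb]) (use a(2) in \<open>auto simp: d_def\<close>)
  define P where "P n z = g 0 z + (\<Sum>i<n. d i z)" for n z
  have PG: "uniform_limit (sphere 0 1) P G sequentially"
    unfolding P_def G_def by (intro uniform_limit_intros ul)
  have Peq: "P n z = g n z - (\<Sum>i<n. a i z)" for n z
  proof -
    have "(\<Sum>i<n. d i z) = (\<Sum>i<n. g (Suc i) z - g i z) - (\<Sum>i<n. a i z)"
      by (simp add: d_def sum_subtractf)
    then show ?thesis unfolding P_def using sum_lessThan_telescope[of "\<lambda>i. g i z" n] by simp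
  qed
  have Pl: "P n \<in> laurent UNIV" for n
    unfolding Peq[abs_def] by (intro laurent_diff g laurent_sum laurent_mono[OF a(1)]) auto
  have Gc: "continuous_on (sphere 0 1) G"
  proof (rule uniform_limit_theorem[OF _ PG])
    show "\<forall>\<^sub>F n in sequentially. continuous_on (sphere 0 1) (P n)"
      by (intro always_eventually allI laurent_continuous[OF Pl]) simp
  qed simp
  obtain b where b: "\<forall>z\<in>sphere 0 1. norm (G z) \<le> b" using continuous_circle_bounded[OF Gc] by blast
  have GL: "G \<in> L2 \<T>" by (rule continuous_circle_L2[OF Gc])
  obtain B where B: "\<psi> \<in> borel_measurable \<T>" "AE z in \<T>. norm (\<psi> z) \<le> B" using \<psi> by (auto simp: Linfty_def)
  have \<psi>L: "\<psi> \<in> L2 \<T>" by (rule L2_bounded[OF finite_measure_circle B])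
  have sm: "L2_norm \<T> u \<le> e" if "u \<in> borel_measurable \<T>" "AE z in \<T>. norm (u z) \<le> e" "e \<ge> 0" for u e
  proof -
    have "L2_norm \<T> (\<lambda>z. u z * 1) \<le> e * L2_norm \<T> (\<lambda>z. 1)"
      by (rule L2_norm_mult_bounded) (use that in \<open>auto simp: L2_def\<close>)
    also have "L2_norm \<T> (\<lambda>z. 1) = 1" using L2_norm_powi_circle[of 0] by simp
    finally show ?thesis by simp
  qed
  define F where "F z = \<psi> z - G z" for z
  have FL: "F \<in> L2 \<T>" unfolding F_def by (rule L2_diff[OF \<psi>L GL])
  have "fourier_coeff F m = 0" if m: "m < 0" for m
  proof -
    have "norm (fourier_coeff F m) \<le> 0 + e" if e: "e > 0" for e
    proof -
      have "eventually (\<lambda>n. \<forall>z\<in>sphere 0 1. dist (P n z) (G z) < e/2) sequentially"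
        using uniform_limitD[OF PG, of "e/2"] e by simp
      moreover have "eventually (\<lambda>n. (1/2::real)^n < e/2) sequentially"
        by (rule order_tendstoD(2)[OF LIMSEQ_realpow_zero]) (use e in auto)
      ultimately have "eventually (\<lambda>n. (\<forall>z\<in>sphere 0 1. dist (P n z) (G z) < e/2) \<and> (1/2::real)^n < e/2) sequentially"
        by (rule eventually_conj)
      then obtain n where n: "\<forall>z\<in>sphere 0 1. dist (P n z) (G z) < e/2" "(1/2::real)^n < e/2"
        by (auto simp: eventually_sequentially)
      have PL: "P n \<in> L2 \<T>" by (rule laurent_L2[OF Pl])
      have al: "(\<lambda>z. \<Sum>i<n. a i z) \<in> laurent {0..}" by (intro laurent_sum a(1))
      have "fourier_coeff (P n) m = fourier_coeff (g n) m - fourier_coeff (\<lambda>z. \<Sum>i<n. a i z) m"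
        unfolding Peq[abs_def] by (rule fourier_coeff_diff[OF laurent_L2[OF g] laurent_L2[OF al]])
      also have "fourier_coeff (\<lambda>z. \<Sum>i<n. a i z) m = 0"
        using m by (intro fourier_coeff_laurent[OF al]) simp
      finally have 1: "fourier_coeff \<psi> m - fourier_coeff (P n) m = fourier_coeff (k n) m"
        using co[OF m, of n] by simp
      have "fourier_coeff F m = (fourier_coeff \<psi> m - fourier_coeff (P n) m) + fourier_coeff (\<lambda>z. P n z - G z) m"
        unfolding F_def fourier_coeff_diff[OF \<psi>L GL] fourier_coeff_diff[OF PL GL] by simp
      also have "norm \<dots> \<le> norm (fourier_coeff (k n) m) + norm (fourier_coeff (\<lambda>z. P n z - G z) m)"
        unfolding 1 by (rule norm_triangle_ineq)
      also have "norm (fourier_coeff (k n) m) \<le> (1/2)^n"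
        using norm_fourier_coeff_le[OF kL, of n m] sm[OF k(1) k(2), of n] by simp
      also have "norm (fourier_coeff (\<lambda>z. P n z - G z) m) \<le> e/2"
      proof (rule order_trans[OF norm_fourier_coeff_le[OF L2_diff[OF PL GL]] sm])
        show "AE z in \<T>. norm (P n z - G z) \<le> e/2"
          by (rule AE_circleI) (use n(1) in \<open>auto simp: dist_norm less_imp_le\<close>)
      qed (use L2_diff[OF PL GL] e in auto)
      finally show ?thesis using n(2) by simp
    qed
    then have "norm (fourier_coeff F m) \<le> 0" by (rule field_le_epsilon)
    then show ?thesis by simp
  qed
  moreover have "F \<in> Linfty \<T>"
  proof -
    have "AE z in \<T>. norm (F z) \<le> B + b"
      using B(2) AE_space[of \<T>]
    proof eventually_elim
      case (elim z)
      have "norm (F z) \<le> norm (\<psi> z) + norm (G z)" unfolding F_def by (rule norm_triangle_ineq4)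
      moreover have "norm (G z) \<le> b" using elim b by auto
      ultimately show ?case using elim by linarith
    qed
    then show ?thesis using L2_measurable[OF FL] unfolding Linfty_def by blast
  qed
  ultimately have "F \<in> Hinfty" by (simp add: Hinfty_def)
  then show ?thesis
    unfolding Hinfty_plus_C_def using \<psi> Gc by (auto intro!: bexI[of _ F] exI[of _ G] simp: F_def)
qed

section \<open>The boundary of the annulus\<close>

text \<open>
  Reversal of the angle turns the parametrization $R/z$ of the inner circle into $R e^{it}$.
\<close>

lemma distr_uniform_reflect: "distr \<U> \<U> (\<lambda>t. 2*pi - t) = \<U>"
proof (rule measure_eqI)
  have m: "(\<lambda>t::real. 2*pi - t) \<in> measurable \<U> \<U>"
    by (simp add: measurable_cong_sets[OF sets_uniform_angle sets_uniform_angle])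
  fix A assume "A \<in> sets (distr \<U> \<U> (\<lambda>t. 2*pi - t))"
  then have A: "A \<in> sets borel" by simp
  have pre: "(\<lambda>t. 2*pi - t) -` A \<in> sets borel"
    using measurable_sets[OF _ A, of "\<lambda>t. 2*pi - t" borel] by simp
  have "emeasure lborel ({0..2*pi} \<inter> (\<lambda>t. 2*pi - t) -` A) = (\<integral>\<^sup>+t. indicator ({0..2*pi} \<inter> A) (2*pi + (-1) * t) \<partial>lborel)"
  proof -
    have "emeasure lborel ({0..2*pi} \<inter> (\<lambda>t. 2*pi - t) -` A)
        = (\<integral>\<^sup>+t. indicator ({0..2*pi} \<inter> (\<lambda>t. 2*pi - t) -` A) t \<partial>lborel)"
      using pre by (subst nn_integral_indicator) auto
    also have "\<dots> = (\<integral>\<^sup>+t. indicator ({0..2*pi} \<inter> A) (2*pi + (-1) * t) \<partial>lborel)"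
      by (intro nn_integral_cong) (auto split: split_indicator)
    finally show ?thesis .
  qed
  also have "\<dots> = (\<integral>\<^sup>+t. indicator ({0..2*pi} \<inter> A) t \<partial>lborel)"
    using A by (subst (2) nn_integral_real_affine[where c = "-1" and t = "2*pi"]) auto
  also have "\<dots> = emeasure lborel ({0..2*pi} \<inter> A)"
    using A by (subst nn_integral_indicator) auto
  finally have "emeasure lborel ({0..2*pi} \<inter> (\<lambda>t. 2*pi - t) -` A) = emeasure lborel ({0..2*pi} \<inter> A)" .
  then show "emeasure (distr \<U> \<U> (\<lambda>t. 2*pi - t)) A = emeasure \<U> A"
    using A pre by (subst emeasure_distr[OF m]) (auto simp: emeasure_uniform_measure)
qed simp

locale annulus_radius =
  fixes R :: real
  assumes R0: "0 < R" and R1: "R < 1"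
begin

abbreviation \<nu> :: "complex measure" where "\<nu> \<equiv> annulus_measure R"

abbreviation Mb :: "complex measure" where "Mb \<equiv> restrict_space borel (annulus_boundary R)"

lemma sets_\<nu>: "sets \<nu> = sets Mb"
  by (simp add: annulus_measure_def)

lemma space_\<nu> [simp]: "space \<nu> = annulus_boundary R"
  by (simp add: annulus_measure_def space_restrict_space)

lemma annulus_boundary_iff: "z \<in> annulus_boundary R \<longleftrightarrow> norm z = 1 \<or> norm z = R"
  by (auto simp: annulus_boundary_def)

lemma measurable_\<nu>_iff: "f \<in> measurable \<nu> N \<longleftrightarrow> f \<in> measurable Mb N"
  by (simp only: measurable_cong_sets[OF sets_\<nu> refl])

lemma borel_imp_\<nu>: "f \<in> borel_measurable borel \<Longrightarrow> f \<in> borel_measurable \<nu>"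
  unfolding measurable_\<nu>_iff by (rule measurable_restrict_space1)

lemma ring_measurable: "r \<in> {1, R} \<Longrightarrow> (\<lambda>t. of_real r * cis t) \<in> measurable \<U> Mb"
  using R0 by (intro measurable_restrict_space2)
    (auto simp: measurable_cong_sets[OF sets_uniform_angle refl] annulus_boundary_iff norm_mult
      intro!: borel_measurable_continuous_onI continuous_intros)

lemma outer_measurable: "(\<lambda>z. z) \<in> measurable \<T> Mb"
  unfolding measurable_cong_sets[OF sets_circle refl]
  by (intro measurable_restrict_space2)
     (auto simp: space_restrict_space annulus_boundary_iff intro: measurable_restrict_space1)

lemma inner_measurable: "(\<lambda>z. of_real R / z) \<in> measurable \<T> Mb"
  unfolding measurable_cong_sets[OF sets_circle refl]
  using R0 by (intro measurable_restrict_space2)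
     (auto simp: space_restrict_space annulus_boundary_iff norm_divide intro: measurable_restrict_space1)

lemma distr_outer: "distr \<T> Mb (\<lambda>z. z) = distr \<U> Mb (\<lambda>t. of_real 1 * cis t)"
  unfolding circle_measure_def
  by (subst distr_distr) (use outer_measurable in \<open>simp_all add: measurable_cong_sets[OF sets_circle refl] cis_measurable_\<U> o_def\<close>)

lemma distr_inner: "distr \<T> Mb (\<lambda>z. of_real R / z) = distr \<U> Mb (\<lambda>t. of_real R * cis t)"
proof -
  have "distr \<T> Mb (\<lambda>z. of_real R / z) = distr \<U> Mb (\<lambda>t. of_real R / cis t)"
    unfolding circle_measure_def
    by (subst distr_distr) (use inner_measurable in \<open>simp_all add: measurable_cong_sets[OF sets_circle refl] cis_measurable_\<U> o_def\<close>)
  also have "(\<lambda>t. of_real R / cis t) = (\<lambda>t. of_real R * cis t) \<circ> (\<lambda>t. 2*pi - t)"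
  proof
    fix t :: real
    have "cis (2*pi - t) = cis (2*pi) / cis t" by (simp only: cis_divide)
    then show "of_real R / cis t = ((\<lambda>t. of_real R * cis t) \<circ> (\<lambda>t. 2*pi - t)) t" by simp
  qed
  also have "distr \<U> Mb \<dots> = distr (distr \<U> \<U> (\<lambda>t. 2*pi - t)) Mb (\<lambda>t. of_real R * cis t)"
    by (rule distr_distr[symmetric])
       (use ring_measurable[of R] in \<open>auto simp: measurable_cong_sets[OF sets_uniform_angle sets_uniform_angle]\<close>)
  finally show ?thesis by (simp only: distr_uniform_reflect)
qed

text \<open>
  Both circles are parametrized by the unit circle, the inner one by $R/z$ as in the definition of
  $\phi_{C_0}$, so that questions about $\partial A$ become pairs of questions about $\mathbb{T}$.
\<close>

lemma nn_integral_\<nu>: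
  assumes h: "h \<in> borel_measurable \<nu>"
  shows "(\<integral>\<^sup>+z. h z \<partial>\<nu>) = (\<integral>\<^sup>+z. h z \<partial>\<T>) + (\<integral>\<^sup>+z. h (of_real R / z) \<partial>\<T>)"
proof -
  interpret U: prob_space \<U> by (rule prob_space_\<U>)
  let ?p = "\<lambda>(r, t). of_real r * cis t :: complex"
  have p: "?p \<in> measurable (count_space {1, R} \<Otimes>\<^sub>M \<U>) Mb"
    by (rule annulus_param_measurable[OF R0])
  have h': "h \<in> borel_measurable Mb" using h by (simp add: measurable_\<nu>_iff)
  have "(\<integral>\<^sup>+z. h z \<partial>\<nu>) = (\<integral>\<^sup>+x. h (?p x) \<partial>(count_space {1, R} \<Otimes>\<^sub>M \<U>))"
    unfolding annulus_measure_def by (rule nn_integral_distr[OF p]) (use h' in simp)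
  also have "\<dots> = (\<integral>\<^sup>+r. \<integral>\<^sup>+t. h (?p (r, t)) \<partial>\<U> \<partial>count_space {1, R})"
    by (rule U.nn_integral_fst[symmetric]) (rule measurable_compose[OF p h'])
  also have "\<dots> = (\<Sum>r\<in>{1, R}. \<integral>\<^sup>+t. h (of_real r * cis t) \<partial>\<U>)"
    by (subst nn_integral_count_space_finite) auto
  also have "\<dots> = (\<Sum>r\<in>{1, R}. \<integral>\<^sup>+z. h z \<partial>distr \<U> Mb (\<lambda>t. of_real r * cis t))"
    by (intro sum.cong refl nn_integral_distr[symmetric] ring_measurable) (use h' in auto)
  also have "\<dots> = (\<integral>\<^sup>+z. h z \<partial>distr \<T> Mb (\<lambda>z. z)) + (\<integral>\<^sup>+z. h z \<partial>distr \<T> Mb (\<lambda>z. of_real R / z))"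
    using R1 by (simp add: distr_outer distr_inner)
  also have "\<dots> = (\<integral>\<^sup>+z. h z \<partial>\<T>) + (\<integral>\<^sup>+z. h (of_real R / z) \<partial>\<T>)"
    using h' by (simp add: nn_integral_distr[OF outer_measurable] nn_integral_distr[OF inner_measurable])
  finally show ?thesis .
qed

lemma outer_borel: "h \<in> borel_measurable \<nu> \<Longrightarrow> h \<in> borel_measurable \<T>"
  using measurable_compose[OF outer_measurable] by (simp add: measurable_\<nu>_iff)

lemma inner_borel: "h \<in> borel_measurable \<nu> \<Longrightarrow> (\<lambda>z. h (of_real R / z)) \<in> borel_measurable \<T>"
  using measurable_compose[OF inner_measurable] by (simp add: measurable_\<nu>_iff)

lemma integrable_\<nu>_iff:
  fixes h :: "complex \<Rightarrow> 'b::{banach,second_countable_topology}"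
  assumes h: "h \<in> borel_measurable \<nu>"
  shows "integrable \<nu> h \<longleftrightarrow> integrable \<T> h \<and> integrable \<T> (\<lambda>z. h (of_real R / z))"
  using nn_integral_\<nu>[of "\<lambda>z. ennreal (norm (h z))"] h outer_borel[OF h] inner_borel[OF h]
  by (auto simp: integrable_iff_bounded)

lemma integral_\<nu>_real:
  fixes h :: "complex \<Rightarrow> real"
  assumes h: "integrable \<nu> h"
  shows "(\<integral>z. h z \<partial>\<nu>) = (\<integral>z. h z \<partial>\<T>) + (\<integral>z. h (of_real R / z) \<partial>\<T>)"
proof -
  have hm: "h \<in> borel_measurable \<nu>" using h by auto
  have i: "integrable \<T> h" "integrable \<T> (\<lambda>z. h (of_real R / z))"
    using h integrable_\<nu>_iff[OF hm] by auto
  have fin: "(\<integral>\<^sup>+z. ennreal (g z) \<partial>\<T>) \<noteq> \<infinity>" if "integrable \<T> g" for g :: "complex \<Rightarrow> real"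
    using that by (auto simp: real_integrable_def)
  have "(\<integral>z. h z \<partial>\<nu>) = enn2real (\<integral>\<^sup>+z. ennreal (h z) \<partial>\<nu>) - enn2real (\<integral>\<^sup>+z. ennreal (- h z) \<partial>\<nu>)"
    by (rule real_lebesgue_integral_def[OF h])
  also have "(\<integral>\<^sup>+z. ennreal (h z) \<partial>\<nu>) = (\<integral>\<^sup>+z. ennreal (h z) \<partial>\<T>) + (\<integral>\<^sup>+z. ennreal (h (of_real R / z)) \<partial>\<T>)"
    by (rule nn_integral_\<nu>) (use hm in measurable)
  also have "(\<integral>\<^sup>+z. ennreal (- h z) \<partial>\<nu>) = (\<integral>\<^sup>+z. ennreal (- h z) \<partial>\<T>) + (\<integral>\<^sup>+z. ennreal (- h (of_real R / z)) \<partial>\<T>)"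
    by (rule nn_integral_\<nu>) (use hm in measurable)
  finally show ?thesis
    unfolding real_lebesgue_integral_def[OF i(1)] real_lebesgue_integral_def[OF i(2)]
    using fin[OF i(1)] fin[OF i(2)] fin[of "\<lambda>z. - h z"] fin[of "\<lambda>z. - h (of_real R / z)"] i
    by (simp add: enn2real_plus less_top)
qed

lemma integral_\<nu>:
  fixes h :: "complex \<Rightarrow> complex"
  assumes h: "integrable \<nu> h"
  shows "(\<integral>z. h z \<partial>\<nu>) = (\<integral>z. h z \<partial>\<T>) + (\<integral>z. h (of_real R / z) \<partial>\<T>)"
proof -
  have hm: "h \<in> borel_measurable \<nu>" using h by auto
  have i: "integrable \<T> h" "integrable \<T> (\<lambda>z. h (of_real R / z))"
    using h integrable_\<nu>_iff[OF hm] by auto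
  show ?thesis
    using integral_\<nu>_real[OF integrable_Re[OF h]] integral_\<nu>_real[OF integrable_Im[OF h]] h i
    by (simp add: complex_eq_iff integral_Re integral_Im)
qed

lemma AE_\<nu>D:
  assumes "AE z in \<nu>. P z"
  shows "AE z in \<T>. P z" "AE z in \<T>. P (of_real R / z)"
proof -
  obtain N where N: "N \<in> sets \<nu>" "emeasure \<nu> N = 0" "{z \<in> space \<nu>. \<not> P z} \<subseteq> N"
    using assms by (auto elim: AE_E)
  have ind: "(indicator N :: complex \<Rightarrow> ennreal) \<in> borel_measurable \<nu>" using N by simp
  have 0: "(\<integral>\<^sup>+z. indicator N z \<partial>\<T>) = 0" "(\<integral>\<^sup>+z. indicator N (of_real R / z) \<partial>\<T>) = 0"
    using nn_integral_\<nu>[OF ind] N by simp_all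
  have "AE z in \<T>. (indicator N z :: ennreal) = 0"
    using 0(1) outer_borel[OF ind] by (simp add: nn_integral_0_iff_AE)
  then show "AE z in \<T>. P z"
    using AE_space by eventually_elim (use N(3) in \<open>auto simp: annulus_boundary_iff split: split_indicator_asm\<close>)
  have "AE z in \<T>. (indicator N (of_real R / z) :: ennreal) = 0"
    using 0(2) inner_borel[OF ind] by (simp add: nn_integral_0_iff_AE)
  then show "AE z in \<T>. P (of_real R / z)"
    using AE_space
  proof eventually_elim
    case (elim z)
    then have "of_real R / z \<in> annulus_boundary R"
      using R0 by (auto simp: annulus_boundary_iff norm_divide)
    then show ?case using elim(1) N(3) by (auto split: split_indicator_asm)
  qed
qed

lemma AE_\<nu>I:
  assumes P: "Measurable.pred \<nu> P" and "AE z in \<T>. P z" "AE z in \<T>. P (of_real R / z)"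
  shows "AE z in \<nu>. P z"
proof -
  let ?h = "\<lambda>z. if P z then 0 else 1 :: ennreal"
  have h: "?h \<in> borel_measurable \<nu>" using P by measurable
  have "(\<integral>\<^sup>+z. ?h z \<partial>\<T>) = 0"
    using assms(2) outer_borel[OF h] by (subst nn_integral_0_iff_AE) auto
  moreover have "(\<integral>\<^sup>+z. ?h (of_real R / z) \<partial>\<T>) = 0"
    using assms(3) inner_borel[OF h] by (subst nn_integral_0_iff_AE) auto
  ultimately have "(\<integral>\<^sup>+z. ?h z \<partial>\<nu>) = 0" using nn_integral_\<nu>[OF h] by simp
  then have "AE z in \<nu>. ?h z = 0" using h by (simp add: nn_integral_0_iff_AE)
  then show ?thesis by eventually_elim (auto split: if_splits)
qed

lemma finite_measure_\<nu>: "finite_measure \<nu>"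
proof
  have one: "(\<integral>\<^sup>+z. 1 \<partial>\<T>) = 1" using circle.emeasure_space_1 by simp
  have "emeasure \<nu> (space \<nu>) = (\<integral>\<^sup>+z. 1 \<partial>\<nu>)" by simp
  also have "\<dots> = (\<integral>\<^sup>+z. 1 \<partial>\<T>) + (\<integral>\<^sup>+z. 1 \<partial>\<T>)" by (rule nn_integral_\<nu>) simp
  also have "\<dots> = 1 + 1" by (simp only: one)
  finally show "emeasure \<nu> (space \<nu>) \<noteq> \<infinity>" by simp
qed

lemma L2_\<nu>_iff:
  assumes h: "h \<in> borel_measurable \<nu>"
  shows "h \<in> L2 \<nu> \<longleftrightarrow> h \<in> L2 \<T> \<and> (\<lambda>z. h (of_real R / z)) \<in> L2 \<T>"
proof -
  have "(\<lambda>z. (norm (h z))\<^sup>2) \<in> borel_measurable \<nu>" using h by measurable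
  from integrable_\<nu>_iff[OF this] show ?thesis
    using h outer_borel[OF h] inner_borel[OF h] by (simp add: L2_def)
qed

lemma L2_\<nu>D: "h \<in> L2 \<nu> \<Longrightarrow> h \<in> L2 \<T>" "h \<in> L2 \<nu> \<Longrightarrow> (\<lambda>z. h (of_real R / z)) \<in> L2 \<T>"
  using L2_\<nu>_iff[OF L2_measurable] by auto

lemma L2_norm_\<nu>: "h \<in> L2 \<nu> \<Longrightarrow> (L2_norm \<nu> h)\<^sup>2 = (L2_norm \<T> h)\<^sup>2 + (L2_norm \<T> (\<lambda>z. h (of_real R / z)))\<^sup>2"
  unfolding L2_norm_sq by (rule integral_\<nu>_real[OF L2_integrable])

lemma laurent_L2_\<nu>: assumes "f \<in> laurent I" shows "f \<in> L2 \<nu>"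
proof -
  obtain B B' where B: "\<forall>z\<in>sphere 0 1. norm (f z) \<le> B" "\<forall>z\<in>sphere 0 R. norm (f z) \<le> B'"
    using laurent_bounded[OF assms] R0 by (meson zero_less_one)
  have "norm (f z) \<le> max B B'" if "z \<in> annulus_boundary R" for z
    using that B by (force simp: annulus_boundary_iff le_max_iff_disj)
  then show ?thesis
    by (intro L2_bounded[OF finite_measure_\<nu> borel_imp_\<nu>[OF laurent_borel[OF assms]], of "max B B'"])
       (auto intro!: AE_I2)
qed

lemma integral_\<nu>_cong:
  fixes f g :: "complex \<Rightarrow> 'b::{banach,second_countable_topology}"
  shows "(\<And>z. norm z = 1 \<or> norm z = R \<Longrightarrow> f z = g z) \<Longrightarrow> (\<integral>z. f z \<partial>\<nu>) = (\<integral>z. g z \<partial>\<nu>)"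
  by (rule Bochner_Integration.integral_cong) (auto simp: annulus_boundary_iff)

lemma L2_norm_\<nu>_cong: "(\<And>z. z \<noteq> 0 \<Longrightarrow> f z = g z) \<Longrightarrow> L2_norm \<nu> f = L2_norm \<nu> g"
proof -
  assume eq: "\<And>z. z \<noteq> 0 \<Longrightarrow> f z = g z"
  have "f z = g z" if "norm z = 1 \<or> norm z = R" for z
    using that R0 by (intro eq) auto
  then show "L2_norm \<nu> f = L2_norm \<nu> g"
    unfolding L2_norm_def by (intro arg_cong[where f = sqrt] integral_\<nu>_cong) auto
qed

section \<open>Density of the Laurent polynomials in the Hardy space\<close>

text \<open>
  Move the point radially towards the middle circle.
\<close>

lemma annulus_closure: "closure (annulus R) \<supseteq> {z. R \<le> norm z \<and> norm z \<le> 1}"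
proof safe
  fix z :: complex assume z: "R \<le> norm z" "norm z \<le> 1"
  define m where "m = (1 + R) / 2"
  have m: "R < m" "m < 1" unfolding m_def using R1 by auto
  have nz: "norm z > 0" using z R0 by linarith
  show "z \<in> closure (annulus R)"
    unfolding closure_approachable
  proof (intro allI impI)
    fix e :: real assume e: "e > 0"
    define s where "s = min 1 (e / 2)"
    have s: "0 < s" "s \<le> 1" "s < e" unfolding s_def using e by auto
    define c where "c = (1 - s) * norm z + s * m"
    define y where "y = of_real (c / norm z) * z"
    have "(1 - s) * R + s * R < c" unfolding c_def using m s z by (intro add_le_less_mono mult_left_mono) auto
    moreover have "c < (1 - s) * 1 + s * 1" unfolding c_def using m s z by (intro add_le_less_mono mult_left_mono) auto
    ultimately have c: "R < c" "c < 1" by (auto simp: algebra_simps)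
    have ny: "norm y = c" unfolding y_def using nz c R0 by (simp add: norm_mult norm_divide)
    have "y - z = of_real ((c - norm z) / norm z) * z"
      unfolding y_def using nz by (simp add: diff_divide_distrib left_diff_distrib)
    then have "norm (y - z) = \<bar>(c - norm z) / norm z\<bar> * norm z" by (simp only: norm_mult norm_of_real)
    also have "\<dots> = \<bar>c - norm z\<bar>" using nz by (simp add: abs_divide)
    also have "c - norm z = s * (m - norm z)" unfolding c_def by (simp add: algebra_simps)
    also have "\<bar>s * (m - norm z)\<bar> \<le> s * 1" unfolding abs_mult using s m z R0 by (intro mult_mono) auto
    finally have "dist y z < e" using s by (simp add: dist_norm)
    moreover have "y \<in> annulus R" using ny c by (simp add: annulus_def)
    ultimately show "\<exists>y\<in>annulus R. dist y z < e" by blast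
  qed
qed

definition laurent_approx :: "(complex \<Rightarrow> complex) \<Rightarrow> bool" where
  "laurent_approx f \<longleftrightarrow> (\<forall>e>0. \<exists>h\<in>laurent UNIV. \<forall>z\<in>annulus_boundary R. norm (f z - h z) < e)"

lemma laurent_boundary_bounded: "f \<in> laurent I \<Longrightarrow> \<exists>B>0. \<forall>z\<in>annulus_boundary R. norm (f z) \<le> B"
proof -
  assume f: "f \<in> laurent I"
  obtain B where B: "\<forall>z\<in>sphere 0 1. norm (f z) \<le> B" using laurent_bounded[OF f, of 1] by auto
  obtain B' where B': "\<forall>z\<in>sphere 0 R. norm (f z) \<le> B'" using laurent_bounded[OF f, of R] R0 by auto
  show ?thesis
  proof (intro exI conjI ballI)
    fix z assume z: "z \<in> annulus_boundary R"
    show "norm (f z) \<le> \<bar>B\<bar> + \<bar>B'\<bar> + 1"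
    proof (cases "norm z = 1")
      case True
      then have "norm (f z) \<le> B" using B by simp
      then show ?thesis by linarith
    next
      case False
      then have "norm (f z) \<le> B'" using B' z by (simp add: annulus_boundary_iff)
      then show ?thesis by linarith
    qed
  qed linarith
qed

lemma laurent_approx_laurent: "f \<in> laurent I \<Longrightarrow> laurent_approx f"
  unfolding laurent_approx_def using laurent_mono[of f I UNIV] by (auto intro!: bexI[of _ f])

lemma laurent_approx_cong: "laurent_approx f \<Longrightarrow> (\<And>z. z \<in> annulus_boundary R \<Longrightarrow> g z = f z) \<Longrightarrow> laurent_approx g"
  unfolding laurent_approx_def by simp

lemma laurent_approx_mult:
  assumes f: "laurent_approx f" and g: "laurent_approx g"
  shows "laurent_approx (\<lambda>z. f z * g z)"
  unfolding laurent_approx_def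
proof (intro allI impI)
  fix e :: real assume e: "e > 0"
  obtain g1 where g1: "g1 \<in> laurent UNIV" "\<And>z. z \<in> annulus_boundary R \<Longrightarrow> norm (g z - g1 z) < 1"
    using g unfolding laurent_approx_def by (metis zero_less_one)
  obtain b where b: "b > 0" "\<And>z. z \<in> annulus_boundary R \<Longrightarrow> norm (g1 z) \<le> b"
    using laurent_boundary_bounded[OF g1(1)] by blast
  have gb: "norm (g z) \<le> b + 1" if "z \<in> annulus_boundary R" for z
    using norm_triangle_sub[of "g z" "g1 z"] g1(2)[OF that] b(2)[OF that] by linarith
  have dpos: "e / 2 / (b + 1) > 0" using e b by simp
  then obtain f1 where f1: "f1 \<in> laurent UNIV" "\<And>z. z \<in> annulus_boundary R \<Longrightarrow> norm (f z - f1 z) < e / 2 / (b + 1)"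
    using f unfolding laurent_approx_def by blast
  obtain a where a: "a > 0" "\<And>z. z \<in> annulus_boundary R \<Longrightarrow> norm (f1 z) \<le> a"
    using laurent_boundary_bounded[OF f1(1)] by blast
  have "e / 2 / a > 0" using e a by simp
  then obtain g2 where g2: "g2 \<in> laurent UNIV" "\<And>z. z \<in> annulus_boundary R \<Longrightarrow> norm (g z - g2 z) < e / 2 / a"
    using g unfolding laurent_approx_def by blast
  obtain h where h: "h \<in> laurent UNIV" "\<And>z. z \<noteq> 0 \<Longrightarrow> h z = f1 z * g2 z"
    using laurent_mult[OF f1(1) g2(1), of UNIV] by blast
  show "\<exists>h\<in>laurent UNIV. \<forall>z\<in>annulus_boundary R. norm (f z * g z - h z) < e"
  proof (intro bexI[OF _ h(1)] ballI)
    fix z assume z: "z \<in> annulus_boundary R"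
    then have "z \<noteq> 0" using R0 by (auto simp: annulus_boundary_iff)
    then have "f z * g z - h z = (f z - f1 z) * g z + f1 z * (g z - g2 z)" by (simp add: h algebra_simps)
    also have "norm \<dots> \<le> norm (f z - f1 z) * norm (g z) + norm (f1 z) * norm (g z - g2 z)"
      using norm_triangle_ineq[of "(f z - f1 z) * g z" "f1 z * (g z - g2 z)"] by (simp add: norm_mult)
    also have "norm (f z - f1 z) * norm (g z) \<le> e / 2 / (b + 1) * (b + 1)"
      by (intro mult_mono less_imp_le[OF f1(2)[OF z]] gb[OF z] less_imp_le[OF dpos]) simp
    also have "norm (f1 z) * norm (g z - g2 z) \<le> a * norm (g z - g2 z)"
      using a(2)[OF z] by (intro mult_right_mono) auto
    also have "a * norm (g z - g2 z) < a * (e / 2 / a)"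
      using g2(2)[OF z] a by (intro mult_strict_left_mono) auto
    also have "e / 2 / (b + 1) * (b + 1) = e / 2" using b by (simp add: divide_simps)
    also have "a * (e / 2 / a) = e / 2" using a by simp
    finally show "norm (f z * g z - h z) < e" by simp
  qed
qed

lemma laurent_approx_geometric:
  assumes w: "w \<in> laurent UNIV" and c: "c < 1" "\<And>z. z \<in> annulus_boundary R \<Longrightarrow> norm (w z) \<le> c"
  shows "laurent_approx (\<lambda>z. 1 / (1 - w z))"
  unfolding laurent_approx_def
proof (intro allI impI)
  fix e :: real assume e: "e > 0"
  have c0: "0 \<le> c" using order_trans[OF norm_ge_zero c(2)[of 1]] by (simp add: annulus_boundary_iff)
  have pw: "\<exists>h\<in>laurent UNIV. \<forall>z. z \<noteq> 0 \<longrightarrow> h z = w z ^ n" for n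
  proof (induction n)
    case 0
    show ?case using laurent_powi[of 0 UNIV] by (intro bexI) auto
  next
    case (Suc n)
    then obtain h where h: "h \<in> laurent UNIV" "\<And>z. z \<noteq> 0 \<Longrightarrow> h z = w z ^ n" by blast
    obtain k where k: "k \<in> laurent UNIV" "\<And>z. z \<noteq> 0 \<Longrightarrow> k z = w z * h z"
      using laurent_mult[OF w h(1), of UNIV] by blast
    show ?case by (rule bexI[OF _ k(1)]) (use h k in auto)
  qed
  then obtain h where h: "\<And>n. h n \<in> laurent UNIV" "\<And>n z. z \<noteq> 0 \<Longrightarrow> h n z = w z ^ n" by metis
  have "(\<lambda>n. c ^ n) \<longlonglongrightarrow> 0" using c c0 by (intro LIMSEQ_realpow_zero)
  moreover have "e * (1 - c) > 0" using e c by simp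
  ultimately obtain n where n: "c ^ n < e * (1 - c)"
    using order_tendstoD(2)[of "\<lambda>n. c ^ n" 0 sequentially "e * (1 - c)"] by (auto simp: eventually_sequentially)
  show "\<exists>h\<in>laurent UNIV. \<forall>z\<in>annulus_boundary R. norm (1 / (1 - w z) - h z) < e"
  proof (rule bexI[of _ "\<lambda>z. \<Sum>i<n. h i z"], safe)
    show "(\<lambda>z. \<Sum>i<n. h i z) \<in> laurent UNIV" by (intro laurent_sum h)
    fix z assume z: "z \<in> annulus_boundary R"
    then have nz: "z \<noteq> 0" using R0 by (auto simp: annulus_boundary_iff)
    have wc: "norm (w z) \<le> c" by (rule c(2)[OF z])
    then have w1: "w z \<noteq> 1" using c by auto
    have "(\<Sum>i<n. h i z) = (1 - w z ^ n) / (1 - w z)"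
      using w1 h(2)[OF nz] by (simp add: sum_gp_strict)
    then have "1 / (1 - w z) - (\<Sum>i<n. h i z) = w z ^ n / (1 - w z)"
      by (simp add: diff_divide_distrib)
    also have "norm \<dots> \<le> c ^ n / (1 - c)"
      unfolding norm_divide norm_power
    proof (intro frac_le power_mono wc)
      show "1 - c \<le> norm (1 - w z)" using norm_triangle_ineq2[of 1 "w z"] wc by simp
    qed (use c c0 in auto)
    also have "\<dots> < e" using n c by (simp add: field_simps)
    finally show "norm (1 / (1 - w z) - (\<Sum>i<n. h i z)) < e" .
  qed
qed

text \<open>
  A geometric series in $z/a$ or in $a/z$.
\<close>

lemma laurent_approx_inverse_linear:
  assumes a: "norm a < R \<or> norm a > 1"
  shows "laurent_approx (\<lambda>z. 1 / (z - a))"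
proof (cases "norm a > 1")
  case True
  have "laurent_approx (\<lambda>z. (- 1 / a) * z powi 0)"
    by (rule laurent_approx_laurent[OF laurent_term[of 0 UNIV]]) simp
  moreover have "laurent_approx (\<lambda>z. 1 / (1 - (1 / a) * z powi 1))"
  proof (rule laurent_approx_geometric)
    show "(\<lambda>z. (1 / a) * z powi 1) \<in> laurent UNIV" by (rule laurent_term) simp
    show "norm ((1 / a) * z powi 1) \<le> 1 / norm a" if "z \<in> annulus_boundary R" for z
      using that R1 True by (auto simp: annulus_boundary_iff norm_mult norm_divide divide_simps)
    show "1 / norm a < 1" using True by (subst divide_less_eq_1_pos) auto
  qed
  ultimately have "laurent_approx (\<lambda>z. (- 1 / a) * z powi 0 * (1 / (1 - (1 / a) * z powi 1)))"
    by (rule laurent_approx_mult)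
  then show ?thesis
  proof (rule laurent_approx_cong)
    fix z assume "z \<in> annulus_boundary R"
    then have "z - a \<noteq> 0" "a \<noteq> 0" using True R1 by (auto simp: annulus_boundary_iff)
    then show "1 / (z - a) = (- 1 / a) * z powi 0 * (1 / (1 - (1 / a) * z powi 1))"
      by (simp add: divide_simps)
  qed
next
  case False
  then have a: "norm a < R" using a by simp
  have "laurent_approx (\<lambda>z. 1 * z powi (-1))"
    by (rule laurent_approx_laurent[OF laurent_term[of "-1" UNIV]]) simp
  moreover have "laurent_approx (\<lambda>z. 1 / (1 - a * z powi (-1)))"
  proof (rule laurent_approx_geometric)
    show "(\<lambda>z. a * z powi (-1)) \<in> laurent UNIV" by (rule laurent_term) simp
    show "norm (a * z powi (-1)) \<le> norm a / R" if "z \<in> annulus_boundary R" for z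
    proof -
      have "norm a * R \<le> norm a * 1" using R1 by (intro mult_left_mono) auto
      then have "norm a \<le> norm a / R" using R0 by (simp add: pos_le_divide_eq)
      moreover have "norm (a * z powi (-1)) = norm a / norm z"
        by (simp add: norm_mult norm_inverse norm_divide divide_inverse)
      ultimately show ?thesis using that by (auto simp: annulus_boundary_iff)
    qed
    show "norm a / R < 1" using a R0 by simp
  qed
  ultimately have "laurent_approx (\<lambda>z. 1 * z powi (-1) * (1 / (1 - a * z powi (-1))))"
    by (rule laurent_approx_mult)
  then show ?thesis
  proof (rule laurent_approx_cong)
    fix z assume "z \<in> annulus_boundary R"
    then have "z - a \<noteq> 0" "z \<noteq> 0" using a R0 R1 by (auto simp: annulus_boundary_iff)
    then show "1 / (z - a) = 1 * z powi (-1) * (1 / (1 - a * z powi (-1)))"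
      by (simp add: field_simps)
  qed
qed

lemma laurent_approx_inverse_poly:
  assumes "\<And>z. R \<le> norm z \<Longrightarrow> norm z \<le> 1 \<Longrightarrow> poly q z \<noteq> 0"
  shows "laurent_approx (\<lambda>z. 1 / poly q z)"
  using assms
proof (induction "degree q" arbitrary: q)
  case 0
  then obtain c where "q = [:c:]" by (metis degree_eq_zeroE)
  then show ?case
    using laurent_approx_laurent[OF laurent_term[of 0 UNIV "1 / c"]] by simp
next
  case (Suc n)
  then have "degree q > 0" by simp
  then obtain a where a: "poly q a = 0" using alg_closed_imp_poly_has_root[of q] by blast
  then obtain p where q: "q = [:- a, 1:] * p" by (meson dvdE poly_eq_0_iff_dvd)
  have "p \<noteq> 0" using q Suc(2) by auto
  then have "degree q = Suc (degree p)" unfolding q by (subst degree_mult_eq) auto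
  then have "laurent_approx (\<lambda>z. 1 / poly p z)"
    using Suc by (auto simp: q)
  moreover have "laurent_approx (\<lambda>z. 1 / (z - a))"
    by (rule laurent_approx_inverse_linear) (use Suc(3)[of a] a in force)
  ultimately have "laurent_approx (\<lambda>z. 1 / (z - a) * (1 / poly p z))" by (intro laurent_approx_mult)
  then show ?case by (rule laurent_approx_cong) (simp add: q algebra_simps)
qed

lemma poly_laurent: "(\<lambda>z. poly p z) \<in> laurent UNIV"
proof (induction p)
  case 0
  then show ?case by (simp add: laurent.zero)
next
  case (pCons a p)
  have sq: "\<exists>h\<in>laurent UNIV. \<forall>z. h z = z * f z" if "f \<in> laurent {0..}" for f
    using that
  proof (induction f rule: laurent.induct)
    case zero
    then show ?case by (intro bexI[OF _ laurent.zero]) auto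
  next
    case (step f i c)
    then obtain h where h: "h \<in> laurent UNIV" "\<And>z. h z = z * f z" by blast
    have "z * z powi i = z powi (i + 1)" for z :: complex
      using step(2) by (cases "z = 0") (auto simp: power_int_add power_int_0_left)
    then show ?case
      using h by (intro bexI[OF _ laurent.step[OF h(1), of "i + 1" c]]) (auto simp: algebra_simps)
  qed
  have pos: "(\<lambda>z. poly p z) \<in> laurent {0..}" for p :: "complex poly"
  proof -
    have "(\<lambda>z. \<Sum>i\<le>degree p. coeff p i * z powi int i) \<in> laurent {0..}"
      by (intro laurent_sum laurent_term) simp
    then show ?thesis by (simp add: poly_altdef)
  qed
  show ?case by (rule laurent_mono[OF pos]) simp
qed

text \<open>
  The denominator is a product of linear factors with zeros off the closed annulus, and uniform
  approximability is preserved by products.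
\<close>

lemma rational_L2_closure:
  assumes "f \<in> rational_functions_on (closure (annulus R))"
  shows "f \<in> L2_closure \<nu> (laurent UNIV)"
proof -
  obtain p q where pq: "\<And>z. z \<in> closure (annulus R) \<Longrightarrow> poly q z \<noteq> 0" "f = (\<lambda>z. poly p z / poly q z)"
    using assms unfolding rational_functions_on_def by blast
  have "laurent_approx (\<lambda>z. poly p z * (1 / poly q z))"
    using pq(1) annulus_closure
    by (intro laurent_approx_mult laurent_approx_inverse_poly laurent_approx_laurent[OF poly_laurent]) auto
  then have f: "laurent_approx f" unfolding pq(2) by simp
  have fm: "f \<in> borel_measurable \<nu>"
  proof (rule borel_imp_\<nu>)
    have "poly r \<in> borel_measurable borel" for r :: "complex poly"
      by (intro borel_measurable_continuous_onI continuous_intros)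
    then show "f \<in> borel_measurable borel" unfolding pq(2) by measurable
  qed
  interpret finite_measure \<nu> by (rule finite_measure_\<nu>)
  define c where "c = L2_norm \<nu> (\<lambda>z. 1)"
  have one: "(\<lambda>z. 1) \<in> L2 \<nu>" by (simp add: L2_def)
  obtain h0 where h0: "h0 \<in> laurent UNIV" "\<And>z. z \<in> annulus_boundary R \<Longrightarrow> norm (f z - h0 z) < 1"
    using f unfolding laurent_approx_def by (metis zero_less_one)
  have "(\<lambda>z. f z - h0 z) \<in> L2 \<nu>"
    by (rule L2_bounded[OF finite_measure_\<nu>, of _ 1])
       (use fm borel_imp_\<nu>[OF laurent_borel[OF h0(1)]] h0(2) in \<open>auto intro!: AE_I2 less_imp_le\<close>)
  from L2_add[OF this laurent_L2_\<nu>[OF h0(1)]] have fL: "f \<in> L2 \<nu>" by simp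
  show ?thesis unfolding L2_closure_def
  proof safe
    fix e :: real assume e: "e > 0"
    have "e / (c + 1) > 0" using e unfolding c_def by (intro divide_pos_pos add_nonneg_pos) auto
    then obtain h where h: "h \<in> laurent UNIV" "\<And>z. z \<in> annulus_boundary R \<Longrightarrow> norm (f z - h z) < e / (c + 1)"
      using f unfolding laurent_approx_def by blast
    have "L2_norm \<nu> (\<lambda>z. (f z - h z) * 1) \<le> e / (c + 1) * L2_norm \<nu> (\<lambda>z. 1)"
      by (rule L2_norm_mult_bounded[OF one])
         (use fm borel_imp_\<nu>[OF laurent_borel[OF h(1)]] h(2) \<open>e / (c + 1) > 0\<close> in \<open>auto intro!: AE_I2 less_imp_le\<close>)
    also have "\<dots> = e * (c / (c + 1))" by (simp add: c_def)
    also have "\<dots> < e * 1" using e by (intro mult_strict_left_mono) (auto simp: c_def add_nonneg_pos)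
    finally show "\<exists>g\<in>laurent UNIV. L2_norm \<nu> (\<lambda>z. f z - g z) < e" using h(1) by auto
  qed fact
qed

text \<open>
  Equality can fail at $0$, where negative powers and quotients with denominator zero are $0$ by
  convention.
\<close>

lemma laurent_eq_rational:
  "f \<in> laurent I \<Longrightarrow> \<exists>r\<in>rational_functions_on (closure (annulus R)). \<forall>z. z \<noteq> 0 \<longrightarrow> r z = f z"
proof -
  have nz: "z \<noteq> 0" if "z \<in> closure (annulus R)" for z
  proof -
    have "closure (annulus R) \<subseteq> {z. R \<le> norm z}"
      by (rule closure_minimal) (auto simp: annulus_def intro!: closed_Collect_le continuous_intros)
    then show ?thesis using that R0 by auto
  qed
  have "\<exists>p n. \<forall>z. z \<noteq> 0 \<longrightarrow> f z = poly p z / z ^ n" if "f \<in> laurent I" for f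
    using that
  proof (induction f rule: laurent.induct)
    case zero
    then show ?case by (intro exI[of _ 0]) auto
  next
    case (step f i c)
    then obtain p n where p: "\<And>z. z \<noteq> 0 \<Longrightarrow> f z = poly p z / z ^ n" by blast
    let ?m = "nat (- i)"
    show ?case
    proof (intro exI allI impI)
      fix z :: complex assume z: "z \<noteq> 0"
      have "z powi i = z ^ nat i / z ^ ?m"
        using z by (cases "i \<ge> 0") (auto simp: power_int_def divide_simps)
      then show "f z + c * z powi i = poly (p * monom 1 ?m + monom c (n + nat i)) z / z ^ (n + ?m)"
        using z p[OF z] by (simp add: poly_monom power_add field_simps)
    qed
  qed
  then show "f \<in> laurent I \<Longrightarrow> \<exists>r\<in>rational_functions_on (closure (annulus R)). \<forall>z. z \<noteq> 0 \<longrightarrow> r z = f z"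
  proof -
    assume f: "f \<in> laurent I"
    then obtain p n where p: "\<And>z. z \<noteq> 0 \<Longrightarrow> f z = poly p z / z ^ n"
      using \<open>\<And>f. f \<in> laurent I \<Longrightarrow> _\<close> by blast
    have "(\<lambda>z. poly p z / poly (monom 1 n) z) \<in> rational_functions_on (closure (annulus R))"
      unfolding rational_functions_on_def mem_Collect_eq
      by (rule exI[of _ p], rule exI[of _ "monom 1 n"]) (use nz in \<open>auto simp: poly_monom\<close>)
    then show ?thesis by (rule bexI[rotated]) (auto simp: poly_monom p)
  qed
qed

lemma H2_eq: "H2 R = L2_closure \<nu> (laurent UNIV)"
proof -
  have sub: "laurent UNIV \<subseteq> L2 \<nu>" using laurent_L2_\<nu> by auto
  have ratL: "rational_functions_on (closure (annulus R)) \<subseteq> L2 \<nu>"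
    using rational_L2_closure L2_closure_L2 by blast
  show ?thesis
  proof (intro equalityI subsetI)
    fix f assume f: "f \<in> H2 R"
    then obtain g where g: "\<And>n. g n \<in> rational_functions_on (closure (annulus R))" "(\<lambda>n. L2_norm \<nu> (\<lambda>x. g n x - f x)) \<longlonglongrightarrow> 0"
      unfolding H2_def using L2_closure_approx by blast
    show "f \<in> L2_closure \<nu> (laurent UNIV)"
      using f g by (intro L2_closure_limit[OF sub _ rational_L2_closure[OF g(1)] g(2)]) (auto simp: H2_def L2_closure_L2)
  next
    fix f assume f: "f \<in> L2_closure \<nu> (laurent UNIV)"
    then obtain g where g: "\<And>n. g n \<in> laurent UNIV" "(\<lambda>n. L2_norm \<nu> (\<lambda>x. g n x - f x)) \<longlonglongrightarrow> 0"
      using L2_closure_approx by blast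
    obtain r where r: "\<And>n. r n \<in> rational_functions_on (closure (annulus R))" "\<And>n z. z \<noteq> 0 \<Longrightarrow> r n z = g n z"
      using laurent_eq_rational[OF g(1)] by metis
    show "f \<in> H2 R" unfolding H2_def
    proof (rule L2_closureI[OF L2_closure_L2[OF f] r(1)])
      have "L2_norm \<nu> (\<lambda>x. r n x - f x) = L2_norm \<nu> (\<lambda>x. g n x - f x)" for n
        by (rule L2_norm_\<nu>_cong) (simp add: r(2))
      then show "(\<lambda>n. L2_norm \<nu> (\<lambda>x. r n x - f x)) \<longlonglongrightarrow> 0" using g(2) by simp
    qed
  qed
qed

section \<open>The orthogonal complement of the Hardy space and the Hankel form\<close>

text \<open>
  The sign $s$. Integration against it subtracts the mean over the inner circle from the mean over
  the outer one, which gives $0$ for Laurent polynomials.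
\<close>

definition sg :: "complex \<Rightarrow> complex" where
  "sg z = (if norm z = 1 then 1 else -1)"

lemma sg_simps [simp]: "norm z = 1 \<Longrightarrow> sg z = 1" "norm z = 1 \<Longrightarrow> sg (of_real R / z) = -1"
  "sg z * sg z = 1" "cnj (sg z) = sg z" "norm (sg z) = 1"
  using R0 R1 by (auto simp: sg_def norm_divide)

lemma sg_borel [measurable]: "sg \<in> borel_measurable borel"
  unfolding sg_def by measurable

lemma sg_mult_L2: "f \<in> L2 \<nu> \<Longrightarrow> (\<lambda>z. sg z * f z) \<in> L2 \<nu>"
  by (rule L2_mult_bounded[where B = 1]) (auto intro: borel_imp_\<nu> sg_borel)

lemma sg_cnj_L2: "f \<in> L2 \<nu> \<Longrightarrow> (\<lambda>z. sg z * cnj (f z)) \<in> L2 \<nu>"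
  by (intro sg_mult_L2 L2_cnj)

lemma L2_norm_sg_cnj: "L2_norm \<nu> (\<lambda>z. sg z * cnj (f z)) = L2_norm \<nu> f"
  by (simp add: L2_norm_def norm_mult)

lemma laurent_subspace_\<nu>: "L2_subspace \<nu> (laurent I)"
  unfolding L2_subspace_def by (auto intro: laurent_L2_\<nu> laurent.zero laurent_add laurent_cmult)

lemma laurent_sub_L2: "laurent I \<subseteq> L2 \<nu>" using laurent_L2_\<nu> by auto

lemma H2_subspace: "L2_subspace \<nu> (H2 R)"
  unfolding H2_eq by (rule L2_subspace_closure[OF laurent_subspace_\<nu>])

lemma laurent_H2: "f \<in> laurent I \<Longrightarrow> f \<in> H2 R"
  unfolding H2_eq using L2_closure_subset[OF laurent_sub_L2[of UNIV]] laurent_mono[of f I UNIV] by auto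

lemma H2_L2: "f \<in> H2 R \<Longrightarrow> f \<in> L2 \<nu>"
  using L2_subspaceD(1)[OF H2_subspace] .

lemma H2_perp_eq: "H2_perp R = L2_orth \<nu> (laurent UNIV)"
proof
  show "H2_perp R \<subseteq> L2_orth \<nu> (laurent UNIV)"
    unfolding H2_perp_def L2_orth_def using laurent_H2 by blast
  show "L2_orth \<nu> (laurent UNIV) \<subseteq> H2_perp R"
    unfolding H2_perp_def H2_eq using L2_orth_closure[OF laurent_sub_L2[of UNIV]] by blast
qed

lemma H2_perp_L2: "f \<in> H2_perp R \<Longrightarrow> f \<in> L2 \<nu>"
  by (simp add: H2_perp_def L2_orth_def)

lemma H2_perp_subspace: "L2_subspace \<nu> (H2_perp R)"
  unfolding H2_perp_eq by (rule L2_subspace_orth[OF laurent_sub_L2])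

lemma H2_perp_inner: "f \<in> H2_perp R \<Longrightarrow> g \<in> H2 R \<Longrightarrow> L2_inner \<nu> f g = 0" "f \<in> H2_perp R \<Longrightarrow> g \<in> H2 R \<Longrightarrow> L2_inner \<nu> g f = 0"
  by (auto simp: H2_perp_def L2_orth_def L2_inner_commute[of \<nu> g f])

lemma powi_ring: "(of_real R / z) powi n = of_real (R powi n) * (z :: complex) powi (- n)"
  by (simp add: divide_inverse power_int_mult_distrib power_int_inverse power_int_minus)

lemma integral_\<nu>_bounded:
  fixes h :: "complex \<Rightarrow> complex"
  assumes "h \<in> borel_measurable \<nu>" "\<And>z. z \<in> annulus_boundary R \<Longrightarrow> norm (h z) \<le> B"
  shows "integrable \<nu> h"
proof -
  interpret finite_measure \<nu> by (rule finite_measure_\<nu>)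
  show ?thesis by (rule integrable_const_bound[where B = B]) (use assms in \<open>auto intro!: AE_I2\<close>)
qed

lemma laurent_sg_integrable: "h \<in> laurent I \<Longrightarrow> integrable \<nu> (\<lambda>z. sg z * h z)"
proof -
  assume h: "h \<in> laurent I"
  obtain B where "\<forall>z\<in>annulus_boundary R. norm (h z) \<le> B" using laurent_boundary_bounded[OF h] by blast
  then show ?thesis
    by (intro integral_\<nu>_bounded[of _ B])
       (auto simp: norm_mult intro!: borel_imp_\<nu> borel_measurable_times sg_borel laurent_borel[OF h])
qed

lemma integral_sg:
  assumes h: "integrable \<nu> (\<lambda>z. sg z * h z)"
  shows "(\<integral>z. sg z * h z \<partial>\<nu>) = (\<integral>z. h z \<partial>\<T>) - (\<integral>z. h (of_real R / z) \<partial>\<T>)"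
proof -
  have "(\<integral>z. sg z * h z \<partial>\<T>) = (\<integral>z. h z \<partial>\<T>)" by (rule circle_integral_cong) simp
  moreover have "(\<integral>z. sg (of_real R / z) * h (of_real R / z) \<partial>\<T>) = (\<integral>z. - h (of_real R / z) \<partial>\<T>)"
    by (rule circle_integral_cong) simp
  ultimately show ?thesis using integral_\<nu>[OF h] by simp
qed

lemma integral_powi_ring: "(\<integral>z. (of_real R / z) powi n \<partial>\<T>) = (if n = 0 then 1 else 0)"
proof -
  have "(\<integral>z. (of_real R / z) powi n \<partial>\<T>) = (\<integral>z. of_real (R powi n) * z powi (- n) \<partial>\<T>)"
    by (rule circle_integral_cong) (rule powi_ring)
  then show ?thesis by (simp add: circle_integral_powi)
qed

lemma laurent_sg_integral: "h \<in> laurent I \<Longrightarrow> (\<integral>z. sg z * h z \<partial>\<nu>) = 0"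
proof (induction h rule: laurent.induct)
  case (step f i c)
  have i: "integrable \<nu> (\<lambda>z. sg z * f z)" "integrable \<nu> (\<lambda>z. sg z * z powi i)"
    using laurent_sg_integrable[OF step(1)] laurent_sg_integrable[OF laurent_powi[of i UNIV]] by auto
  have "(\<integral>z. sg z * (f z + c * z powi i) \<partial>\<nu>) = (\<integral>z. sg z * f z + c * (sg z * z powi i) \<partial>\<nu>)"
    by (simp add: algebra_simps)
  also have "\<dots> = (\<integral>z. sg z * f z \<partial>\<nu>) + c * (\<integral>z. sg z * z powi i \<partial>\<nu>)"
    using i by (subst Bochner_Integration.integral_add) auto
  also have "(\<integral>z. sg z * z powi i \<partial>\<nu>) = 0"
    by (simp only: integral_sg[OF i(2)] integral_powi_ring circle_integral_powi diff_self)
  finally show ?case using step by simp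
qed simp

lemma laurent_sg_mult_integral:
  assumes f: "f \<in> laurent UNIV" and g: "g \<in> laurent UNIV"
  shows "(\<integral>z. sg z * (f z * g z) \<partial>\<nu>) = 0"
proof -
  obtain h where h: "h \<in> laurent UNIV" "\<And>z. z \<noteq> 0 \<Longrightarrow> h z = f z * g z"
    using laurent_mult[OF f g, of UNIV] by blast
  have eq: "sg z * (f z * g z) = sg z * h z" if "norm z = 1 \<or> norm z = R" for z
  proof -
    have "z \<noteq> 0" using that R0 by auto
    then show ?thesis by (simp add: h(2))
  qed
  have "(\<integral>z. sg z * (f z * g z) \<partial>\<nu>) = (\<integral>z. sg z * h z \<partial>\<nu>)"
    by (rule integral_\<nu>_cong) (rule eq)
  then show ?thesis using laurent_sg_integral[OF h(1)] by simp
qed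

lemma laurent_inner_sg_cnj:
  assumes f: "f \<in> laurent UNIV" and g: "g \<in> laurent UNIV"
  shows "L2_inner \<nu> (\<lambda>z. sg z * cnj (f z)) g = 0"
proof -
  have "L2_inner \<nu> (\<lambda>z. sg z * cnj (f z)) g = (\<integral>z. cnj (sg z * (f z * g z)) \<partial>\<nu>)"
    unfolding L2_inner_def by (rule Bochner_Integration.integral_cong) auto
  also have "\<dots> = cnj (\<integral>z. sg z * (f z * g z) \<partial>\<nu>)" by (rule Bochner_Integration.integral_cnj)
  finally show ?thesis using laurent_sg_mult_integral[OF f g] by simp
qed

lemma sg_cnj_laurent_perp: "f \<in> laurent UNIV \<Longrightarrow> (\<lambda>z. sg z * cnj (f z)) \<in> H2_perp R"
  unfolding H2_perp_eq L2_orth_def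
  using laurent_inner_sg_cnj sg_cnj_L2[OF laurent_L2_\<nu>] by auto

text \<open>
  At each frequency the two hypotheses are linear equations for the Fourier coefficients of
  \<open>r\<close> on the two circles, with a determinant that is a multiple of $R^m + R^{-m}$.
\<close>

lemma orth_total:
  assumes r: "r \<in> L2 \<nu>" and a: "\<And>n. L2_inner \<nu> r (\<lambda>z. z powi n) = 0"
    and b: "\<And>n. L2_inner \<nu> r (\<lambda>z. sg z * cnj (z powi n)) = 0"
  shows "AE z in \<nu>. r z = 0"
proof -
  define c d where "c n = fourier_coeff r n" and "d n = fourier_coeff (\<lambda>z. r (of_real R / z)) n" for n
  note L = L2_\<nu>D[OF r]
  have pL: "(\<lambda>z. z powi n) \<in> L2 \<nu>" for n by (rule laurent_L2_\<nu>[OF laurent_powi[of n UNIV]]) simp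
  have A: "c n + of_real (R powi n) * d (- n) = 0" for n
  proof -
    have "L2_inner \<nu> r (\<lambda>z. z powi n) = (\<integral>z. r z * cnj (z powi n) \<partial>\<T>)
        + (\<integral>z. r (of_real R / z) * cnj ((of_real R / z) powi n) \<partial>\<T>)"
      unfolding L2_inner_def by (rule integral_\<nu>[OF L2_inner_integrable[OF r pL]])
    also have "(\<integral>z. r (of_real R / z) * cnj ((of_real R / z) powi n) \<partial>\<T>)
        = (\<integral>z. of_real (R powi n) * (r (of_real R / z) * cnj (z powi (- n))) \<partial>\<T>)"
      by (rule circle_integral_cong) (simp only: powi_ring complex_cnj_mult complex_cnj_complex_of_real mult_ac)
    also have "\<dots> = of_real (R powi n) * d (- n)" by (simp add: d_def fourier_coeff_def)
    finally show ?thesis using a[of n] by (simp add: c_def fourier_coeff_def)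
  qed
  have B: "c (- n) - of_real (R powi n) * d n = 0" for n
  proof -
    have "L2_inner \<nu> r (\<lambda>z. sg z * cnj (z powi n)) = (\<integral>z. sg z * (r z * z powi n) \<partial>\<nu>)"
      unfolding L2_inner_def by (rule Bochner_Integration.integral_cong) (auto simp: mult_ac)
    also have "\<dots> = (\<integral>z. r z * z powi n \<partial>\<T>) - (\<integral>z. r (of_real R / z) * (of_real R / z) powi n \<partial>\<T>)"
    proof (rule integral_sg)
      have "integrable \<nu> (\<lambda>z. (sg z * r z) * z powi n)"
        by (rule L2_mult_integrable[OF sg_mult_L2[OF r] pL])
      then show "integrable \<nu> (\<lambda>z. sg z * (r z * z powi n))" by (simp add: mult.assoc)
    qed
    also have "(\<integral>z. r (of_real R / z) * (of_real R / z) powi n \<partial>\<T>)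
        = (\<integral>z. of_real (R powi n) * (r (of_real R / z) * z powi (- n)) \<partial>\<T>)"
      by (rule circle_integral_cong) (simp only: powi_ring mult_ac)
    also have "\<dots> = of_real (R powi n) * d n" by (simp add: d_def fourier_coeff_powi_integral)
    finally show ?thesis using b[of n] by (simp add: c_def fourier_coeff_powi_integral)
  qed
  have d0: "d m = 0" for m
  proof -
    have "of_real (R powi (- m) + R powi m) * d m = 0"
      using A[of "- m"] B[of m] by (simp add: algebra_simps)
    moreover have "R powi (- m) + R powi m > 0" using R0 by (intro add_pos_pos zero_less_power_int)
    ultimately show ?thesis by (metis less_irrefl mult_eq_0_iff of_real_eq_0_iff)
  qed
  have c0: "c m = 0" for m using A[of m] d0 by simp
  have "AE z in \<T>. r z = 0" "AE z in \<T>. r (of_real R / z) = 0"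
    using circle_L2_orth_all[OF L(1)] circle_L2_orth_all[OF L(2)] c0 d0 by (auto simp: c_def d_def)
  moreover have "Measurable.pred \<nu> (\<lambda>z. r z = 0)" using r by measurable
  ultimately show ?thesis by (intro AE_\<nu>I)
qed

text \<open>
  The Laurent polynomials $f$ and the functions $s\,\overline{f}$ form orthogonal families, which
  together span a dense subspace by \<open>orth_total\<close>. As $y$ is orthogonal to the first family,
  $s\,\overline{y}$ is orthogonal to the second one, hence a limit of functions from the first.
\<close>

lemma sg_cnj_perp_H2:
  assumes y: "y \<in> H2_perp R"
  shows "(\<lambda>z. sg z * cnj (y z)) \<in> H2 R"
  unfolding H2_eq
proof (rule L2_closure_if_orth[OF finite_measure_\<nu> laurent_subspace_\<nu>, where W = "{\<lambda>z. sg z * cnj (f z) |f. f \<in> laurent UNIV}"])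
  have yL: "y \<in> L2 \<nu>" by (rule H2_perp_L2[OF y])
  show "{\<lambda>z. sg z * cnj (f z) |f. f \<in> laurent UNIV} \<subseteq> L2 \<nu>"
    using sg_cnj_L2[OF laurent_L2_\<nu>] by auto
  show "L2_inner \<nu> f g = 0" if "f \<in> laurent UNIV" "g \<in> {\<lambda>z. sg z * cnj (f z) |f. f \<in> laurent UNIV}" for f g
    using that laurent_inner_sg_cnj by (subst L2_inner_commute) auto
  show "AE z in \<nu>. r z = 0"
    if r: "r \<in> L2_orth \<nu> (laurent UNIV)" "r \<in> L2_orth \<nu> {\<lambda>z. sg z * cnj (f z) |f. f \<in> laurent UNIV}" for r
  proof (rule orth_total)
    show "r \<in> L2 \<nu>" using r(1) by (simp add: L2_orth_def)
    fix n
    have p: "(\<lambda>z. z powi n) \<in> laurent UNIV" by (rule laurent_powi) simp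
    then show "L2_inner \<nu> r (\<lambda>z. z powi n) = 0" using r(1) by (simp add: L2_orth_def)
    have "(\<lambda>z. sg z * cnj (z powi n)) \<in> {\<lambda>z. sg z * cnj (f z) |f. f \<in> laurent UNIV}"
      by (rule CollectI, rule exI[of _ "\<lambda>z. z powi n"]) (use p in simp)
    then show "L2_inner \<nu> r (\<lambda>z. sg z * cnj (z powi n)) = 0" using r(2) unfolding L2_orth_def by blast
  qed
  show "(\<lambda>z. sg z * cnj (y z)) \<in> L2_orth \<nu> {\<lambda>z. sg z * cnj (f z) |f. f \<in> laurent UNIV}"
    unfolding L2_orth_def
  proof (safe)
    show "(\<lambda>z. sg z * cnj (y z)) \<in> L2 \<nu>" by (rule sg_cnj_L2[OF yL])
    fix f assume f: "f \<in> laurent UNIV"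
    have "L2_inner \<nu> (\<lambda>z. sg z * cnj (y z)) (\<lambda>z. sg z * cnj (f z)) = L2_inner \<nu> f y"
      unfolding L2_inner_def
    proof (rule Bochner_Integration.integral_cong)
      fix z
      have "sg z * cnj (y z) * cnj (sg z * cnj (f z)) = (sg z * sg z) * (f z * cnj (y z))"
        by (simp only: complex_cnj_mult complex_cnj_cnj sg_simps(4) mult_ac)
      then show "sg z * cnj (y z) * cnj (sg z * cnj (f z)) = f z * cnj (y z)" by simp
    qed simp
    then show "L2_inner \<nu> (\<lambda>z. sg z * cnj (y z)) (\<lambda>z. sg z * cnj (f z)) = 0"
      using H2_perp_inner(2)[OF y laurent_H2[OF f]] by simp
  qed
qed

lemma hankel_props:
  assumes "(\<lambda>w. \<phi> w * f w) \<in> L2 \<nu>"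
  shows "hankel R \<phi> f \<in> H2_perp R" "\<exists>p\<in>H2 R. hankel R \<phi> f = (\<lambda>z. \<phi> z * f z - p z)"
proof -
  let ?g = "\<lambda>w. \<phi> w * f w"
  have "\<exists>x. x \<in> H2 R \<and> (\<lambda>z. ?g z - x z) \<in> L2_orth \<nu> (H2 R)"
    using L2_projection[OF finite_measure_\<nu> assms laurent_subspace_\<nu>[of UNIV]] unfolding H2_eq by blast
  then have "P_H2 R ?g \<in> H2 R \<and> (\<lambda>z. ?g z - P_H2 R ?g z) \<in> L2_orth \<nu> (H2 R)"
    unfolding P_H2_def L2_proj_def by (rule someI_ex)
  then show "hankel R \<phi> f \<in> H2_perp R" "\<exists>p\<in>H2 R. hankel R \<phi> f = (\<lambda>z. \<phi> z * f z - p z)"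
    unfolding hankel_def H2_perp_def by auto
qed

text \<open>
  The form $B$. By \<open>perp_inner_hankel_form\<close> its value is $\langle H_\phi f, w\rangle$ whenever
  $w = s\,\overline{g}$ lies in the complement of the Hardy space.
\<close>

definition hankel_form :: "(complex \<Rightarrow> complex) \<Rightarrow> (complex \<Rightarrow> complex) \<Rightarrow> (complex \<Rightarrow> complex) \<Rightarrow> complex" where
  "hankel_form \<phi> f g = (\<integral>z. (sg z * \<phi> z) * f z * g z \<partial>\<nu>)"

text \<open>
  The component in the Hardy space does not contribute to inner products with elements of the
  complement.
\<close>

lemma perp_inner_hankel_form:
  assumes x: "x = (\<lambda>z. \<phi> z * f z - p z)" "(\<lambda>z. \<phi> z * f z) \<in> L2 \<nu>" "p \<in> H2 R" and w: "w \<in> H2_perp R"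
  shows "L2_inner \<nu> x w = hankel_form \<phi> f (\<lambda>z. sg z * cnj (w z))"
proof -
  have "L2_inner \<nu> x w = L2_inner \<nu> (\<lambda>z. \<phi> z * f z) w - L2_inner \<nu> p w"
    unfolding x(1) by (rule L2_inner_diff_left[OF x(2) H2_L2[OF x(3)] H2_perp_L2[OF w]])
  also have "L2_inner \<nu> p w = 0" by (rule H2_perp_inner(2)[OF w x(3)])
  also have "L2_inner \<nu> (\<lambda>z. \<phi> z * f z) w = hankel_form \<phi> f (\<lambda>z. sg z * cnj (w z))"
    unfolding L2_inner_def hankel_form_def
  proof (rule Bochner_Integration.integral_cong)
    fix z
    have "sg z * \<phi> z * f z * (sg z * cnj (w z)) = (sg z * sg z) * (\<phi> z * f z * cnj (w z))"
      by (simp only: mult_ac)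
    then show "\<phi> z * f z * cnj (w z) = sg z * \<phi> z * f z * (sg z * cnj (w z))" by simp
  qed simp
  finally show ?thesis by simp
qed

lemma hankel_form_le:
  assumes \<phi>: "\<phi> \<in> borel_measurable \<nu>" "AE z in \<nu>. norm (\<phi> z) \<le> B" "0 \<le> B" and L: "f \<in> L2 \<nu>" "g \<in> L2 \<nu>"
  shows "norm (hankel_form \<phi> f g) \<le> B * L2_norm \<nu> f * L2_norm \<nu> g" "integrable \<nu> (\<lambda>z. (sg z * \<phi> z) * f z * g z)"
proof -
  have m: "(\<lambda>z. sg z * \<phi> z) \<in> borel_measurable \<nu>" using \<phi>(1) borel_imp_\<nu>[OF sg_borel] by measurable
  have b: "AE z in \<nu>. norm (sg z * \<phi> z) \<le> B" using \<phi>(2) by (simp add: norm_mult)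
  have *: "(\<lambda>z. (sg z * \<phi> z) * f z) \<in> L2 \<nu>" by (rule L2_mult_bounded[OF L(1) m b])
  show "integrable \<nu> (\<lambda>z. (sg z * \<phi> z) * f z * g z)" by (rule L2_mult_integrable[OF * L(2)])
  show "norm (hankel_form \<phi> f g) \<le> B * L2_norm \<nu> f * L2_norm \<nu> g"
    unfolding hankel_form_def by (rule L2_bounded_form_le[OF m b \<phi>(3) L])
qed

lemma hankel_form_split:
  assumes \<phi>: "\<phi> \<in> borel_measurable \<nu>" "AE z in \<nu>. norm (\<phi> z) \<le> B" "0 \<le> B" and L: "f \<in> L2 \<nu>" "g \<in> L2 \<nu>"
  shows "hankel_form \<phi> f g = (\<integral>z. \<phi> z * f z * g z \<partial>\<T>)
    - (\<integral>z. \<phi> (of_real R / z) * f (of_real R / z) * g (of_real R / z) \<partial>\<T>)"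
proof -
  have i: "integrable \<nu> (\<lambda>z. sg z * (\<phi> z * f z * g z))"
    using hankel_form_le(2)[OF assms] by (simp add: mult.assoc)
  have "hankel_form \<phi> f g = (\<integral>z. sg z * (\<phi> z * f z * g z) \<partial>\<nu>)"
    unfolding hankel_form_def by (simp add: mult.assoc)
  then show ?thesis using integral_sg[OF i] by simp
qed

section \<open>Compactness forces the symbols into $H^\infty + C$\<close>

lemma laurent_inner_powi_\<nu>:
  assumes "f \<in> laurent I" "i \<notin> I"
  shows "L2_inner \<nu> f (\<lambda>z. z powi i) = 0"
proof -
  have pL: "(\<lambda>z. z powi n) \<in> L2 \<nu>" for n by (rule laurent_L2_\<nu>[OF laurent_powi[of n UNIV]]) simp
  have mono: "L2_inner \<nu> (\<lambda>z. z powi j) (\<lambda>z. z powi i) = 0" if "j \<noteq> i" for j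
  proof -
    have "L2_inner \<nu> (\<lambda>z. z powi j) (\<lambda>z. z powi i) = (\<integral>z. z powi j * cnj (z powi i) \<partial>\<T>)
        + (\<integral>z. (of_real R / z) powi j * cnj ((of_real R / z) powi i) \<partial>\<T>)"
      unfolding L2_inner_def by (rule integral_\<nu>[OF L2_inner_integrable[OF pL pL]])
    also have "(\<integral>z. z powi j * cnj (z powi i) \<partial>\<T>) = 0"
      using fourier_coeff_powi[of j i] that unfolding fourier_coeff_def by simp
    also have "(\<integral>z. (of_real R / z) powi j * cnj ((of_real R / z) powi i) \<partial>\<T>)
       = (\<integral>z. of_real (R powi j * R powi i) * (z powi (- j) * cnj (z powi (- i))) \<partial>\<T>)"
      by (rule circle_integral_cong)
         (simp only: powi_ring complex_cnj_mult complex_cnj_complex_of_real of_real_mult mult_ac)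
    also have "\<dots> = of_real (R powi j * R powi i) * fourier_coeff (\<lambda>z. z powi (- j)) (- i)"
      unfolding fourier_coeff_def by simp
    also have "\<dots> = 0" using that by (simp add: fourier_coeff_powi)
    finally show ?thesis by simp
  qed
  show ?thesis
    using assms
  proof (induction f rule: laurent.induct)
    case zero
    show ?case by (simp add: L2_inner_def)
  next
    case (step f j c)
    have "L2_inner \<nu> (\<lambda>z. f z + c * z powi j) (\<lambda>z. z powi i)
      = L2_inner \<nu> f (\<lambda>z. z powi i) + c * L2_inner \<nu> (\<lambda>z. z powi j) (\<lambda>z. z powi i)"
      using L2_inner_add_left[OF laurent_L2_\<nu>[OF step(1)] L2_cmult[OF pL] pL] by (simp add: L2_inner_cmult_left)
    then show ?case using step mono[of j] by auto
  qed
qed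

text \<open>
  Otherwise there are normalized $f_n$ and $q_n$ with $|B(f_n, q_n)| > e$ and
  $B(f_n, q_n) = \langle H_\phi f_n, w_n \rangle$, where $w_n = s\,\overline{q_n}$ lies in the
  complement of the Hardy space. The frequencies of $q_n$ leave every finite set, so
  $\langle g, w_n\rangle \to 0$ for each fixed $g$ in the complement. Along a subsequence
  $H_\phi f_n$ converges in norm, and the inner products tend to $0$.
\<close>

lemma compact_imp_form_small:
  assumes comp: "compact_operator \<nu> (H2 R) (H2_perp R) (hankel R \<phi>)"
    and \<phi>: "\<phi> \<in> borel_measurable \<nu>" "AE z in \<nu>. norm (\<phi> z) \<le> B" "0 \<le> B"
    and J: "\<And>i. \<forall>\<^sub>F n in sequentially. i \<notin> J n" and e: "e > 0"
  shows "\<exists>n. \<forall>F\<in>laurent UNIV. \<forall>Q\<in>laurent (J n). norm (hankel_form \<phi> F Q) \<le> e * L2_norm \<nu> F * L2_norm \<nu> Q"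
proof (rule ccontr)
  assume "\<not> ?thesis"
  then have "\<forall>n. \<exists>F Q. F \<in> laurent UNIV \<and> Q \<in> laurent (J n) \<and>
      norm (hankel_form \<phi> F Q) > e * L2_norm \<nu> F * L2_norm \<nu> Q"
    by (meson not_le)
  then obtain F Q where F: "\<And>n. F n \<in> laurent UNIV" and Q: "\<And>n. Q n \<in> laurent (J n)"
    and big: "\<And>n. norm (hankel_form \<phi> (F n) (Q n)) > e * L2_norm \<nu> (F n) * L2_norm \<nu> (Q n)"
    by metis
  note FL = laurent_L2_\<nu>[OF F] and QL = laurent_L2_\<nu>[OF Q]
  have pos: "L2_norm \<nu> (F n) > 0" "L2_norm \<nu> (Q n) > 0" for n
  proof -
    have "norm (hankel_form \<phi> (F n) (Q n)) \<le> B * L2_norm \<nu> (F n) * L2_norm \<nu> (Q n)"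
      by (rule hankel_form_le(1)[OF \<phi> FL QL])
    with big[of n] have "L2_norm \<nu> (F n) \<noteq> 0" "L2_norm \<nu> (Q n) \<noteq> 0" by auto
    then show "L2_norm \<nu> (F n) > 0" "L2_norm \<nu> (Q n) > 0" by (simp_all add: less_le)
  qed
  define f q where "f n z = of_real (1 / L2_norm \<nu> (F n)) * F n z"
    and "q n z = of_real (1 / L2_norm \<nu> (Q n)) * Q n z" for n z
  have f: "f n \<in> laurent UNIV" and q: "q n \<in> laurent (J n)" for n
    unfolding f_def q_def by (intro laurent_cmult F Q)+
  have f1: "L2_norm \<nu> (f n) = 1" and q1: "L2_norm \<nu> (q n) = 1" for n
    unfolding f_def q_def L2_norm_cmult norm_of_real using pos[of n] by simp_all
  note fL = laurent_L2_\<nu>[OF f] and qL = laurent_L2_\<nu>[OF q]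
  have big1: "norm (hankel_form \<phi> (f n) (q n)) > e" for n
  proof -
    have "hankel_form \<phi> (f n) (q n) = (\<integral>z. of_real (1 / L2_norm \<nu> (F n) * (1 / L2_norm \<nu> (Q n))) * ((sg z * \<phi> z) * F n z * Q n z) \<partial>\<nu>)"
      unfolding hankel_form_def f_def q_def
      by (rule Bochner_Integration.integral_cong) (simp_all only: of_real_mult mult_ac)
    also have "\<dots> = of_real (1 / L2_norm \<nu> (F n) * (1 / L2_norm \<nu> (Q n))) * hankel_form \<phi> (F n) (Q n)"
      unfolding hankel_form_def by (rule integral_mult_right_zero)
    also have "norm \<dots> = norm (hankel_form \<phi> (F n) (Q n)) / (L2_norm \<nu> (F n) * L2_norm \<nu> (Q n))"
      using pos[of n] unfolding norm_mult norm_of_real by (simp add: abs_mult)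
    also have "\<dots> > e" using big[of n] pos[of n] by (simp add: pos_less_divide_eq mult.assoc)
    finally show ?thesis .
  qed
  obtain g s where g: "g \<in> H2_perp R" and s: "strict_mono s"
    and lim: "(\<lambda>n. L2_norm \<nu> (\<lambda>x. hankel R \<phi> (f (s n)) x - g x)) \<longlonglongrightarrow> 0"
  proof -
    have "(\<forall>n. f n \<in> H2 R) \<and> (\<exists>B. \<forall>n. L2_norm \<nu> (f n) \<le> B)"
      using laurent_H2[OF f] f1 by auto
    with comp show ?thesis using that unfolding compact_operator_def by blast
  qed
  have hp: "hankel R \<phi> (f n) \<in> H2_perp R" "\<exists>p\<in>H2 R. hankel R \<phi> (f n) = (\<lambda>z. \<phi> z * f n z - p z)" for n
    using hankel_props[OF L2_mult_bounded[OF fL \<phi>(1,2)]] by auto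
  define w where "w n z = sg z * cnj (q n z)" for n z
  have w: "w n \<in> H2_perp R" for n
    unfolding w_def by (rule sg_cnj_laurent_perp[OF laurent_mono[OF q]]) simp
  have w1: "L2_norm \<nu> (w n) = 1" for n unfolding w_def L2_norm_sg_cnj by (rule q1)
  note wL = H2_perp_L2[OF w]
  have cc: "sg z * cnj (w n z) = q n z" for n z
    unfolding w_def by (simp only: complex_cnj_mult complex_cnj_cnj sg_simps(4) mult.assoc[symmetric] sg_simps(3) mult_1)
  have ip: "L2_inner \<nu> (hankel R \<phi> (f n)) (w n) = hankel_form \<phi> (f n) (q n)" for n
  proof -
    obtain p where p: "p \<in> H2 R" "hankel R \<phi> (f n) = (\<lambda>z. \<phi> z * f n z - p z)" using hp(2) by blast
    show ?thesis
      using perp_inner_hankel_form[OF p(2) L2_mult_bounded[OF fL \<phi>(1,2)] p(1) w[of n]] by (simp add: cc)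
  qed
  define G where "G z = sg z * cnj (g z)" for z
  have G: "G \<in> H2 R" unfolding G_def by (rule sg_cnj_perp_H2[OF g])
  have gL: "g \<in> L2 \<nu>" by (rule H2_perp_L2[OF g])
  have gw: "L2_inner \<nu> g (w n) = L2_inner \<nu> (q n) G" for n
    unfolding L2_inner_def G_def w_def
    by (rule Bochner_Integration.integral_cong) (simp_all only: complex_cnj_mult complex_cnj_cnj sg_simps(4) mult_ac)
  have "(\<lambda>n. L2_inner \<nu> (q n) G) \<longlonglongrightarrow> 0"
  proof (rule tendstoI)
    fix r :: real assume r: "r > 0"
    obtain h where h: "h \<in> laurent UNIV" "L2_norm \<nu> (\<lambda>x. G x - h x) < r"
      using G r unfolding H2_eq L2_closure_def by blast
    have hL: "h \<in> L2 \<nu>" by (rule laurent_L2_\<nu>[OF h(1)])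
    have "\<forall>\<^sub>F n in sequentially. L2_inner \<nu> (q n) h = 0"
      using h(1)
    proof (induction h rule: laurent.induct)
      case zero
      show ?case by simp
    next
      case (step h i c)
      have pL: "(\<lambda>z. z powi i) \<in> L2 \<nu>" by (rule laurent_L2_\<nu>[OF laurent_powi[of i UNIV]]) simp
      from step(3) J[of i] show ?case
      proof eventually_elim
        case (elim n)
        have "L2_inner \<nu> (q n) (\<lambda>z. h z + c * z powi i) = L2_inner \<nu> (q n) h + cnj c * L2_inner \<nu> (q n) (\<lambda>z. z powi i)"
          using L2_inner_add_right[OF laurent_L2_\<nu>[OF step(1)] L2_cmult[OF pL] qL] by (simp add: L2_inner_cmult_right)
        then show ?case using elim laurent_inner_powi_\<nu>[OF q elim(2)] by simp
      qed
    qed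
    then show "\<forall>\<^sub>F n in sequentially. dist (L2_inner \<nu> (q n) G) 0 < r"
    proof eventually_elim
      case (elim n)
      have "L2_inner \<nu> (q n) G = L2_inner \<nu> (q n) (\<lambda>x. G x - h x)"
        using elim by (simp add: L2_inner_diff_right[OF H2_L2[OF G] hL qL])
      also have "norm \<dots> \<le> L2_norm \<nu> (q n) * L2_norm \<nu> (\<lambda>x. G x - h x)"
        by (rule L2_Cauchy_Schwarz[OF qL L2_diff[OF H2_L2[OF G] hL]])
      finally show ?case using h(2) q1 by simp
    qed
  qed
  then have lim0: "(\<lambda>n. L2_inner \<nu> g (w (s n))) \<longlonglongrightarrow> 0"
    unfolding gw using s by (rule LIMSEQ_subseq_LIMSEQ[unfolded o_def])
  have "(\<lambda>n. norm (hankel_form \<phi> (f (s n)) (q (s n)))) \<longlonglongrightarrow> 0"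
  proof (rule tendsto_sandwich0)
    fix n
    have dL: "(\<lambda>x. hankel R \<phi> (f (s n)) x - g x) \<in> L2 \<nu>" by (intro L2_diff H2_perp_L2[OF hp(1)] gL)
    have "hankel_form \<phi> (f (s n)) (q (s n)) = L2_inner \<nu> (\<lambda>x. hankel R \<phi> (f (s n)) x - g x) (w (s n)) + L2_inner \<nu> g (w (s n))"
      unfolding ip[symmetric] by (simp add: L2_inner_diff_left[OF H2_perp_L2[OF hp(1)] gL wL])
    then show "norm (hankel_form \<phi> (f (s n)) (q (s n))) \<le> L2_norm \<nu> (\<lambda>x. hankel R \<phi> (f (s n)) x - g x) + norm (L2_inner \<nu> g (w (s n)))"
      using norm_triangle_ineq[of "L2_inner \<nu> (\<lambda>x. hankel R \<phi> (f (s n)) x - g x) (w (s n))" "L2_inner \<nu> g (w (s n))"]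
        L2_Cauchy_Schwarz[OF dL wL, of "s n"] by (simp add: w1)
    show "(\<lambda>n. L2_norm \<nu> (\<lambda>x. hankel R \<phi> (f (s n)) x - g x) + norm (L2_inner \<nu> g (w (s n)))) \<longlonglongrightarrow> 0"
      using tendsto_add[OF lim tendsto_norm_zero[OF lim0]] by simp
  qed simp
  then have "\<forall>\<^sub>F n in sequentially. norm (hankel_form \<phi> (f (s n)) (q (s n))) < e"
    using e by (rule order_tendstoD(2))
  then show False using big1 by (auto simp: eventually_sequentially not_less[symmetric] dest: less_asym)
qed

text \<open>
  By orthogonality of the monomials both norms are sums over the coefficients, and the terms on the
  left carry the weights $R^{2i} \le 1$.
\<close>

lemma L2_norm_ring_le:
  assumes "p \<in> laurent {0..}"
  shows "L2_norm \<T> (\<lambda>z. p (of_real R / z)) \<le> L2_norm \<T> p"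
proof -
  have pars: "(L2_norm \<T> (\<lambda>z. \<Sum>i\<in>F. a i * z powi i))\<^sup>2 = (\<Sum>i\<in>F. (norm (a i))\<^sup>2)"
    if "finite F" for F :: "int set" and a
    using that
  proof (induction F rule: finite_induct)
    case empty
    show ?case by (simp add: L2_norm_def)
  next
    case (insert i F)
    have l: "(\<lambda>z. \<Sum>i\<in>F. a i * z powi i) \<in> laurent F" by (intro laurent_sum laurent_term)
    have "L2_inner \<T> (\<lambda>z. a i * z powi i) (\<lambda>z. \<Sum>i\<in>F. a i * z powi i) = 0"
      unfolding L2_inner_cmult_left
      by (subst L2_inner_commute) (simp add: fourier_coeff_inner[symmetric] fourier_coeff_laurent[OF l insert(2)])
    then show ?case
      using insert L2_norm_add_sq[OF L2_cmult[OF powi_L2] laurent_L2[OF l], of "a i" i]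
      by (simp add: L2_norm_cmult power_mult_distrib)
  qed
  obtain F a where F: "finite F" "F \<subseteq> {0..}" "p = (\<lambda>z. \<Sum>i\<in>F. a i * z powi i)"
    using laurent_sum_form[OF assms] by blast
  have "L2_norm \<T> (\<lambda>z. p (of_real R / z)) = L2_norm \<T> (\<lambda>z. \<Sum>i\<in>uminus ` F. (a (- i) * of_real (R powi (- i))) * z powi i)"
    unfolding L2_norm_def F(3)
  proof (intro arg_cong[where f = sqrt] circle_integral_cong)
    fix z :: complex assume z: "norm z = 1"
    have "(\<Sum>i\<in>F. a i * (of_real R / z) powi i) = (\<Sum>i\<in>uminus ` F. (a (- i) * of_real (R powi (- i))) * z powi i)"
      by (subst sum.reindex) (auto simp: powi_ring mult.assoc inj_on_def)
    then show "(norm (\<Sum>i\<in>F. a i * (of_real R / z) powi i))\<^sup>2 = (norm (\<Sum>i\<in>uminus ` F. (a (- i) * of_real (R powi (- i))) * z powi i))\<^sup>2"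
      by simp
  qed
  then have "(L2_norm \<T> (\<lambda>z. p (of_real R / z)))\<^sup>2 = (\<Sum>i\<in>uminus ` F. (norm (a (- i) * of_real (R powi (- i))))\<^sup>2)"
    using pars[of "uminus ` F" "\<lambda>i. a (- i) * of_real (R powi (- i))"] F(1) by simp
  also have "\<dots> = (\<Sum>i\<in>F. (norm (a i * of_real (R powi i)))\<^sup>2)"
    by (subst sum.reindex) (auto simp: inj_on_def)
  also have "\<dots> \<le> (\<Sum>i\<in>F. (norm (a i))\<^sup>2)"
  proof (intro sum_mono power_mono)
    fix i assume "i \<in> F"
    then have "0 \<le> i" using F by auto
    then have "\<bar>R powi i\<bar> \<le> 1" using R0 R1 by (simp add: power_int_def power_le_one)
    then show "norm (a i * of_real (R powi i)) \<le> norm (a i)"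
      unfolding norm_mult norm_of_real by (intro mult_left_le) auto
  qed simp
  also have "\<dots> = (L2_norm \<T> p)\<^sup>2" unfolding F(3) by (rule pars[OF F(1), symmetric])
  finally show ?thesis by (rule power2_le_imp_le) simp
qed

text \<open>
  The map \<open>\<tau>\<close> selects one of the two circles and \<open>\<tau>'\<close> the other; both maps are treated
  alike because $z \mapsto R/z$ is an involution. On the selected circle the test functions are
  $z^m p$ and $z^m q$, on the other one their norms are at most $R^m\|p\|$ and $R^m \|q\|$.
\<close>

lemma compact_imp_circle_form_small:
  fixes \<tau> \<tau>' :: "complex \<Rightarrow> complex"
  assumes comp: "compact_operator \<nu> (H2 R) (H2_perp R) (hankel R \<phi>)"
    and \<phi>: "\<phi> \<in> borel_measurable \<nu>" "AE z in \<nu>. norm (\<phi> z) \<le> B" "0 \<le> B"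
    and \<tau>: "\<tau> = (\<lambda>z. z) \<and> \<tau>' = (\<lambda>z. of_real R / z) \<or> \<tau> = (\<lambda>z. of_real R / z) \<and> \<tau>' = (\<lambda>z. z)" and e: "e > 0"
  shows "\<exists>n. \<forall>p\<in>laurent {0..}. \<forall>q\<in>laurent {0..}.
    norm (\<integral>z. \<phi> (\<tau> z) * z powi n * p z * q z \<partial>\<T>) \<le> e * L2_norm \<T> p * L2_norm \<T> q"
proof -
  have "(\<lambda>n. B * R ^ n) \<longlonglongrightarrow> 0"
    using R0 R1 by (intro tendsto_mult_right_zero LIMSEQ_realpow_zero) auto
  then have "\<forall>\<^sub>F n in sequentially. B * R ^ n < e / 2" by (rule order_tendstoD(2)) (use e in simp)
  then obtain m0 where m0: "B * R ^ m0 < e / 2" by (auto simp: eventually_sequentially)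
  \<comment> \<open>the shift by \<open>m0\<close> makes the other circle negligible as well\<close>
  define J where "J n = (if \<tau> = (\<lambda>z. z) then {int (n + m0)..} else {..- int (n + m0)})" for n
  have "\<forall>\<^sub>F n in sequentially. i \<notin> J n" for i
    using eventually_gt_at_top[of "nat \<bar>i\<bar>"] by eventually_elim (auto simp: J_def)
  moreover have "e / 4 > 0" using e by simp
  ultimately obtain n where n: "\<And>F Q. F \<in> laurent UNIV \<Longrightarrow> Q \<in> laurent (J n) \<Longrightarrow>
      norm (hankel_form \<phi> F Q) \<le> e / 4 * L2_norm \<nu> F * L2_norm \<nu> Q"
    using compact_imp_form_small[OF comp \<phi>] by blast
  define m where "m = n + m0"
  have \<tau>\<tau>: "\<tau> (\<tau> z) = z" "\<tau> (\<tau>' z) = of_real R / z" "\<tau> z \<noteq> 0" "\<tau>' z \<noteq> 0" if "norm z = 1" for z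
    using that \<tau> R0 by auto
  have \<phi>\<tau>: "(\<lambda>z. \<phi> (\<tau>' z)) \<in> borel_measurable \<T>" "AE z in \<T>. norm (\<phi> (\<tau>' z)) \<le> B"
    using \<tau> outer_borel[OF \<phi>(1)] inner_borel[OF \<phi>(1)] AE_\<nu>D[OF \<phi>(2)] by auto
  have L\<tau>: "(\<lambda>z. G (\<tau>' z)) \<in> L2 \<T>" and
    N\<tau>: "(L2_norm \<nu> G)\<^sup>2 = (L2_norm \<T> (\<lambda>z. G (\<tau> z)))\<^sup>2 + (L2_norm \<T> (\<lambda>z. G (\<tau>' z)))\<^sup>2" if "G \<in> L2 \<nu>" for G
    using \<tau> L2_\<nu>D[OF that] L2_norm_\<nu>[OF that] by auto
  have ex: "\<exists>F\<in>laurent (J n). \<forall>z. z \<noteq> 0 \<longrightarrow> F z = u (\<tau> z) * \<tau> z powi int m" if u: "u \<in> laurent {0..}" for u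
  proof -
    obtain h where h: "h \<in> laurent ((\<lambda>i. i + int m) ` {0..})" "\<And>z. z \<noteq> 0 \<Longrightarrow> h z = u z * z powi int m"
      using laurent_mult_powi[OF u] by blast
    have h': "h \<in> laurent {int m..}" by (rule laurent_mono[OF h(1)]) auto
    show ?thesis
    proof (cases "\<tau> = (\<lambda>z. z)")
      case True
      then show ?thesis using h' h(2) unfolding J_def m_def by (intro bexI[of _ h]) auto
    next
      case False
      then have t: "\<tau> = (\<lambda>z. of_real R / z)" using \<tau> by blast
      have "\<exists>k\<in>laurent {..- int m}. \<forall>z\<in>UNIV. k z = h (of_real R / z)"
      proof (rule laurent_compose[OF h'])
        fix i assume i: "i \<in> {int m..}"
        have "(\<lambda>z. of_real (R powi i) * z powi (- i)) \<in> laurent {..- int m}"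
          using i by (intro laurent_term) auto
        moreover have "of_real (R powi i) * z powi (- i) = (of_real R / z) powi i" for z :: complex
          by (rule powi_ring[symmetric])
        ultimately show "\<exists>k\<in>laurent {..- int m}. \<forall>z\<in>UNIV. k z = (of_real R / z) powi i" by (intro bexI) auto
      qed
      then obtain k where k: "k \<in> laurent {..- int m}" "\<And>z. k z = h (of_real R / z)" by blast
      show ?thesis
        using False k R0 by (intro bexI[of _ k]) (auto simp: J_def m_def h(2) t)
    qed
  qed
  have transport: "\<exists>F\<in>laurent (J n). (\<forall>z. norm z = 1 \<longrightarrow> F (\<tau> z) = u z * z powi int m) \<and>
      L2_norm \<nu> F \<le> sqrt 2 * L2_norm \<T> u \<and> L2_norm \<T> (\<lambda>z. F (\<tau>' z)) \<le> R ^ m * L2_norm \<T> u"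
    if u: "u \<in> laurent {0..}" for u
  proof -
    obtain F where F: "F \<in> laurent (J n)" "\<And>z. z \<noteq> 0 \<Longrightarrow> F z = u (\<tau> z) * \<tau> z powi int m" using ex[OF u] by blast
    have a: "F (\<tau> z) = u z * z powi int m" if "norm z = 1" for z using F(2)[OF \<tau>\<tau>(3)[OF that]] \<tau>\<tau>(1)[OF that] by simp
    have b: "norm (F (\<tau>' z)) = norm (of_real (R ^ m) * u (of_real R / z))" if "norm z = 1" for z
      using F(2)[OF \<tau>\<tau>(4)[OF that]] \<tau>\<tau>(2)[OF that] that R0
      by (simp add: norm_mult norm_divide norm_power mult.commute)
    have "L2_norm \<T> (\<lambda>z. F (\<tau> z)) = L2_norm \<T> u"
      unfolding L2_norm_def by (intro arg_cong[where f = sqrt] circle_integral_cong) (simp add: a norm_mult norm_power)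
    moreover have "L2_norm \<T> (\<lambda>z. F (\<tau>' z)) = L2_norm \<T> (\<lambda>z. of_real (R ^ m) * u (of_real R / z))"
      unfolding L2_norm_def by (intro arg_cong[where f = sqrt] circle_integral_cong) (simp only: b)
    then have c: "L2_norm \<T> (\<lambda>z. F (\<tau>' z)) \<le> R ^ m * L2_norm \<T> u"
      unfolding L2_norm_cmult norm_of_real using R0 L2_norm_ring_le[OF u] by (simp add: mult_left_mono)
    moreover have "R ^ m * L2_norm \<T> u \<le> L2_norm \<T> u"
      using R0 R1 by (intro mult_left_le_one_le) (auto intro: power_le_one)
    ultimately have "(L2_norm \<nu> F)\<^sup>2 \<le> (L2_norm \<T> u)\<^sup>2 + (L2_norm \<T> u)\<^sup>2"
      unfolding N\<tau>[OF laurent_L2_\<nu>[OF F(1)]] by (intro add_mono power_mono) auto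
    also have "\<dots> = (sqrt 2 * L2_norm \<T> u)\<^sup>2" by (simp add: power_mult_distrib)
    finally have "L2_norm \<nu> F \<le> sqrt 2 * L2_norm \<T> u" by (rule power2_le_imp_le) simp
    with F(1) a c show ?thesis by blast
  qed
  have "norm (\<integral>z. \<phi> (\<tau> z) * z powi (2 * int m) * p z * q z \<partial>\<T>) \<le> e * L2_norm \<T> p * L2_norm \<T> q"
    if p: "p \<in> laurent {0..}" and q: "q \<in> laurent {0..}" for p q
  proof -
    obtain F where F: "F \<in> laurent (J n)" "\<And>z. norm z = 1 \<Longrightarrow> F (\<tau> z) = p z * z powi int m"
      "L2_norm \<nu> F \<le> sqrt 2 * L2_norm \<T> p" "L2_norm \<T> (\<lambda>z. F (\<tau>' z)) \<le> R ^ m * L2_norm \<T> p"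
      using transport[OF p] by blast
    obtain Q where Q: "Q \<in> laurent (J n)" "\<And>z. norm z = 1 \<Longrightarrow> Q (\<tau> z) = q z * z powi int m"
      "L2_norm \<nu> Q \<le> sqrt 2 * L2_norm \<T> q" "L2_norm \<T> (\<lambda>z. Q (\<tau>' z)) \<le> R ^ m * L2_norm \<T> q"
      using transport[OF q] by blast
    note FL = laurent_L2_\<nu>[OF F(1)] and QL = laurent_L2_\<nu>[OF Q(1)]
    let ?I = "\<lambda>t. \<integral>z. \<phi> (t z) * F (t z) * Q (t z) \<partial>\<T>"
    have "norm (hankel_form \<phi> F Q) = norm (?I \<tau> - ?I \<tau>')"
      using \<tau> unfolding hankel_form_split[OF \<phi> FL QL] by (auto simp: norm_minus_commute)
    then have "norm (?I \<tau>) \<le> norm (hankel_form \<phi> F Q) + norm (?I \<tau>')"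
      using norm_triangle_sub[of "?I \<tau>" "?I \<tau>'"] by simp
    also have "norm (hankel_form \<phi> F Q) \<le> e / 4 * (sqrt 2 * L2_norm \<T> p) * (sqrt 2 * L2_norm \<T> q)"
      using e by (intro order_trans[OF n[OF laurent_mono[OF F(1)] Q(1)]] mult_mono F Q) auto
    also have "\<dots> = e / 2 * (L2_norm \<T> p * L2_norm \<T> q)" by (simp add: field_simps)
    also have "norm (?I \<tau>') \<le> B * L2_norm \<T> (\<lambda>z. F (\<tau>' z)) * L2_norm \<T> (\<lambda>z. Q (\<tau>' z))"
      by (rule L2_bounded_form_le[OF \<phi>\<tau> \<phi>(3) L\<tau>[OF FL] L\<tau>[OF QL]])
    also have "\<dots> \<le> B * (R ^ m * L2_norm \<T> p) * (R ^ m * L2_norm \<T> q)"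
      using \<phi>(3) R0 by (intro mult_mono F Q) auto
    also have "\<dots> = (B * R ^ m) * R ^ m * (L2_norm \<T> p * L2_norm \<T> q)" by (simp add: mult_ac)
    also have "\<dots> \<le> (e / 2) * 1 * (L2_norm \<T> p * L2_norm \<T> q)"
    proof (intro mult_mono mult_right_mono)
      have "R ^ m \<le> R ^ m0" unfolding m_def using R0 R1 by (intro power_decreasing) auto
      then have "B * R ^ m \<le> B * R ^ m0" using \<phi>(3) by (rule mult_left_mono)
      then show "B * R ^ m \<le> e / 2" using m0 by linarith
    qed (use R0 R1 e \<phi>(3) in \<open>auto intro: power_le_one\<close>)
    finally have "norm (?I \<tau>) \<le> e * L2_norm \<T> p * L2_norm \<T> q" by (simp add: field_simps)
    also have "?I \<tau> = (\<integral>z. \<phi> (\<tau> z) * z powi (2 * int m) * p z * q z \<partial>\<T>)"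
    proof (rule circle_integral_cong)
      fix z :: complex assume z: "norm z = 1"
      have "z powi (2 * int m) = z powi int m * z powi int m"
        using powi_add_circle[OF z, of "int m" "int m"] by simp
      then show "\<phi> (\<tau> z) * F (\<tau> z) * Q (\<tau> z) = \<phi> (\<tau> z) * z powi (2 * int m) * p z * q z"
        using F(2)[OF z] Q(2)[OF z] by (simp only: mult_ac)
    qed
    finally show ?thesis .
  qed
  then show ?thesis by blast
qed

lemma compact_imp_Hinfty_plus_C:
  fixes \<tau> :: "complex \<Rightarrow> complex"
  assumes comp: "compact_operator \<nu> (H2 R) (H2_perp R) (hankel R \<phi>)" and \<phi>: "\<phi> \<in> Linfty \<nu>"
    and \<tau>: "\<tau> = (\<lambda>z. z) \<or> \<tau> = (\<lambda>z. of_real R / z)"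
  shows "(\<lambda>z\<in>sphere 0 1. \<phi> (\<tau> z)) \<in> Hinfty_plus_C"
proof -
  let ?\<psi> = "\<lambda>z\<in>sphere 0 1. \<phi> (\<tau> z)"
  obtain B0 where B0: "\<phi> \<in> borel_measurable \<nu>" "AE z in \<nu>. norm (\<phi> z) \<le> B0" using \<phi> by (auto simp: Linfty_def)
  define B where "B = max 0 B0"
  have B: "0 \<le> B" "AE z in \<nu>. norm (\<phi> z) \<le> B" using B0(2) by (auto simp: B_def elim: eventually_mono)
  have m1: "(\<lambda>z. \<phi> (\<tau> z)) \<in> borel_measurable \<T>"
    using \<tau> outer_borel[OF B0(1)] inner_borel[OF B0(1)] by auto
  have m: "?\<psi> \<in> borel_measurable \<T>"
    using measurable_cong[of \<T> ?\<psi> "\<lambda>z. \<phi> (\<tau> z)" borel] m1 by simp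
  have "AE z in \<T>. norm (\<phi> (\<tau> z)) \<le> B" using \<tau> AE_\<nu>D[OF B(2)] by auto
  then have b: "AE z in \<T>. norm (?\<psi> z) \<le> B" using AE_space by eventually_elim auto
  show ?thesis
  proof (rule Hinfty_plus_C_I)
    show "?\<psi> \<in> Linfty \<T>" unfolding Linfty_def using m b by blast
    fix e :: real assume e: "e > 0"
    obtain \<tau>' :: "complex \<Rightarrow> complex" where "\<tau> = (\<lambda>z. z) \<and> \<tau>' = (\<lambda>z. of_real R / z) \<or> \<tau> = (\<lambda>z. of_real R / z) \<and> \<tau>' = (\<lambda>z. z)"
      using \<tau> by blast
    from compact_imp_circle_form_small[OF comp B0(1) B(2,1) this e] obtain n where
      n: "\<And>p q. p \<in> laurent {0..} \<Longrightarrow> q \<in> laurent {0..} \<Longrightarrow>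
        norm (\<integral>z. \<phi> (\<tau> z) * z powi n * p z * q z \<partial>\<T>) \<le> e * L2_norm \<T> p * L2_norm \<T> q" by blast
    have eq: "(\<integral>z. ?\<psi> z * z powi n * p z * q z \<partial>\<T>) = (\<integral>z. \<phi> (\<tau> z) * z powi n * p z * q z \<partial>\<T>)" for p q
      by (rule circle_integral_cong) simp
    show "\<exists>g\<in>laurent UNIV. \<exists>k\<in>borel_measurable \<T>. (AE z in \<T>. norm (k z) \<le> e) \<and>
      (\<forall>m<0. fourier_coeff ?\<psi> m = fourier_coeff g m + fourier_coeff k m)"
    proof (rule hankel_form_small_imp_approx[OF m b B(1), of e n])
      show "norm (\<integral>z. ?\<psi> z * z powi n * p z * q z \<partial>\<T>) \<le> e * L2_norm \<T> p * L2_norm \<T> q"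
        if "p \<in> laurent {0..}" "q \<in> laurent {0..}" for p q
        unfolding eq using that by (rule n)
    qed (use e in simp)
  qed
qed

end

section \<open>Symbols in $H^\infty + C$ give compact operators\<close>

lemma sum_power_tail:
  fixes \<rho> :: real
  assumes \<rho>: "0 \<le> \<rho>" "\<rho> < 1" and F: "finite F" "\<And>i. i \<in> F \<Longrightarrow> int L \<le> \<bar>i\<bar>"
  shows "(\<Sum>i\<in>F. \<rho> ^ nat \<bar>i\<bar>) \<le> 2 * \<rho> ^ L / (1 - \<rho>)"
proof -
  have s: "(\<lambda>k. \<rho> ^ (k + L)) sums (\<rho> ^ L * (1 / (1 - \<rho>)))"
    using sums_mult[OF geometric_sums[of \<rho>], of "\<rho> ^ L"] \<rho> by (simp add: power_add mult.commute)
  have half: "(\<Sum>i\<in>E. \<rho> ^ nat \<bar>i\<bar>) \<le> \<rho> ^ L / (1 - \<rho>)"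
    if E: "E \<subseteq> F" "inj_on (\<lambda>i. nat \<bar>i\<bar>) E" for E
  proof -
    have fE: "finite E" using E(1) F(1) by (rule finite_subset)
    let ?g = "\<lambda>i. nat \<bar>i\<bar> - L"
    have inj: "inj_on ?g E"
    proof (rule inj_onI)
      fix i j assume ij: "i \<in> E" "j \<in> E" "?g i = ?g j"
      have "int L \<le> \<bar>i\<bar>" "int L \<le> \<bar>j\<bar>" using F(2) E(1) ij(1,2) by auto
      then have "nat \<bar>i\<bar> = nat \<bar>j\<bar>" using ij(3) by linarith
      then show "i = j" using E(2) ij(1,2) by (auto dest: inj_onD)
    qed
    have "(\<Sum>i\<in>E. \<rho> ^ nat \<bar>i\<bar>) = (\<Sum>i\<in>E. \<rho> ^ (?g i + L))"
    proof (intro sum.cong refl)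
      fix i assume "i \<in> E"
      then have "int L \<le> \<bar>i\<bar>" using F(2) E(1) by auto
      then have "?g i + L = nat \<bar>i\<bar>" by linarith
      then show "\<rho> ^ nat \<bar>i\<bar> = \<rho> ^ (?g i + L)" by simp
    qed
    also have "\<dots> = (\<Sum>k\<in>?g ` E. \<rho> ^ (k + L))" by (subst sum.reindex[OF inj]) simp
    also have "\<dots> \<le> (\<Sum>k. \<rho> ^ (k + L))"
      by (rule sum_le_suminf) (use s fE \<rho> in \<open>auto simp: sums_iff\<close>)
    also have "\<dots> = \<rho> ^ L / (1 - \<rho>)" using s by (simp add: sums_iff)
    finally show ?thesis .
  qed
  have "(\<Sum>i\<in>F. \<rho> ^ nat \<bar>i\<bar>) = (\<Sum>i\<in>{i\<in>F. 0 \<le> i}. \<rho> ^ nat \<bar>i\<bar>) + (\<Sum>i\<in>{i\<in>F. \<not> 0 \<le> i}. \<rho> ^ nat \<bar>i\<bar>)"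
    using F(1) by (subst sum.union_disjoint[symmetric]) (auto intro!: sum.cong)
  also have "\<dots> \<le> \<rho> ^ L / (1 - \<rho>) + \<rho> ^ L / (1 - \<rho>)"
    by (intro add_mono half) (auto simp: inj_on_def)
  finally show ?thesis by simp
qed

context annulus_radius
begin

abbreviation monomial_norm :: "int \<Rightarrow> real" where "monomial_norm i \<equiv> L2_norm \<nu> (\<lambda>z. z powi i)"

lemma powi_L2_\<nu>: "(\<lambda>z. z powi i) \<in> L2 \<nu>"
  by (rule laurent_L2_\<nu>[OF laurent_powi[of i UNIV]]) simp

lemma monomial_norm_sq: "(monomial_norm i)\<^sup>2 = 1 + (R powi i)\<^sup>2"
proof -
  have "L2_norm \<T> (\<lambda>z. (of_real R / z) powi i) = L2_norm \<T> (\<lambda>z. of_real (R powi i) * z powi (- i))"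
    unfolding L2_norm_def by (intro arg_cong[where f = sqrt] circle_integral_cong) (simp only: powi_ring)
  also have "\<dots> = \<bar>R powi i\<bar>" unfolding L2_norm_cmult norm_of_real by simp
  finally show ?thesis unfolding L2_norm_\<nu>[OF powi_L2_\<nu>] by simp
qed

lemma monomial_norm_ge: "1 \<le> monomial_norm i" "R powi i \<le> monomial_norm i"
proof -
  show "1 \<le> monomial_norm i" by (rule power2_le_imp_le) (simp_all add: monomial_norm_sq)
  show "R powi i \<le> monomial_norm i" by (rule power2_le_imp_le) (simp_all add: monomial_norm_sq)
qed

text \<open>
  The powers of $\sqrt R$ on the left multiply when degrees are added. This makes the weighted
  norms on the right strong enough to bound the entries of Hankel matrices, which depend on the sum of
  the degrees only.
\<close>

lemma monomial_norm_weight: "sqrt R powi i \<le> monomial_norm i * sqrt R ^ nat \<bar>i\<bar>"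
proof (cases "0 \<le> i")
  case True
  then have "sqrt R powi i = 1 * sqrt R ^ nat \<bar>i\<bar>" by (simp add: power_int_def)
  also have "\<dots> \<le> monomial_norm i * sqrt R ^ nat \<bar>i\<bar>" using R0 monomial_norm_ge(1) by (intro mult_right_mono) auto
  finally show ?thesis .
next
  case False
  have "R = sqrt R powi 2" using R0 by simp
  then have "R powi i = sqrt R powi (2 * i)" by (metis power_int_mult)
  moreover have "sqrt R ^ nat \<bar>i\<bar> = sqrt R powi (- i)" using False by (simp add: power_int_def)
  ultimately have "R powi i * sqrt R ^ nat \<bar>i\<bar> = sqrt R powi i"
    using R0 by (simp add: power_int_add[symmetric])
  moreover have "R powi i * sqrt R ^ nat \<bar>i\<bar> \<le> monomial_norm i * sqrt R ^ nat \<bar>i\<bar>"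
    using R0 monomial_norm_ge(2) by (intro mult_right_mono) auto
  ultimately show ?thesis by simp
qed

lemma laurent_sum_inner:
  assumes "finite F" "i \<in> F"
  shows "L2_inner \<nu> (\<lambda>z. \<Sum>j\<in>F. a j * z powi j) (\<lambda>z. z powi i) = a i * of_real ((monomial_norm i)\<^sup>2)"
proof -
  have l: "(\<lambda>z. \<Sum>j\<in>F - {i}. a j * z powi j) \<in> laurent (F - {i})" by (intro laurent_sum laurent_term)
  have "(\<lambda>z. \<Sum>j\<in>F. a j * z powi j) = (\<lambda>z. a i * z powi i + (\<Sum>j\<in>F - {i}. a j * z powi j))"
    using assms by (simp add: sum.remove)
  then have "L2_inner \<nu> (\<lambda>z. \<Sum>j\<in>F. a j * z powi j) (\<lambda>z. z powi i)
     = a i * L2_inner \<nu> (\<lambda>z. z powi i) (\<lambda>z. z powi i)"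
    using L2_inner_add_left[OF L2_cmult[OF powi_L2_\<nu>] laurent_L2_\<nu>[OF l] powi_L2_\<nu>, of "a i" i i]
      laurent_inner_powi_\<nu>[OF l, of i] by (simp add: L2_inner_cmult_left)
  then show ?thesis by (simp only: L2_inner_self)
qed

lemma hankel_form_powi:
  assumes \<phi>: "\<phi> \<in> borel_measurable \<nu>" "AE z in \<nu>. norm (\<phi> z) \<le> M" "0 \<le> M"
  shows "hankel_form \<phi> (\<lambda>z. z powi i) (\<lambda>z. z powi j) =
    fourier_coeff \<phi> (- (i + j)) - of_real (R powi (i + j)) * fourier_coeff (\<lambda>z. \<phi> (of_real R / z)) (i + j)"
proof -
  have "(\<integral>z. \<phi> z * z powi i * z powi j \<partial>\<T>) = fourier_coeff \<phi> (- (i + j))"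
    unfolding fourier_coeff_powi_integral
    by (rule circle_integral_cong) (simp add: powi_add_circle)
  moreover have "(\<integral>z. \<phi> (of_real R / z) * (of_real R / z) powi i * (of_real R / z) powi j \<partial>\<T>)
     = (\<integral>z. of_real (R powi (i + j)) * (\<phi> (of_real R / z) * z powi (- (i + j))) \<partial>\<T>)"
  proof (rule circle_integral_cong)
    fix z :: complex assume z: "norm z = 1"
    have "(of_real R / z) powi i * (of_real R / z) powi j = (of_real R / z) powi (i + j)"
      using z R0 by (subst power_int_add) auto
    also have "\<dots> = of_real (R powi (i + j)) * z powi (- (i + j))" by (rule powi_ring)
    finally show "\<phi> (of_real R / z) * (of_real R / z) powi i * (of_real R / z) powi j
        = of_real (R powi (i + j)) * (\<phi> (of_real R / z) * z powi (- (i + j)))"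
      by (simp add: mult_ac)
  qed
  ultimately show ?thesis
    unfolding hankel_form_split[OF \<phi> powi_L2_\<nu> powi_L2_\<nu>]
    by (simp add: fourier_coeff_powi_integral[of "\<lambda>z. \<phi> (of_real R / z)"])
qed

text \<open>
  With $c$ and $d$ the Fourier coefficients on the two circles, the entry of the form at $z^i$ and
  $z^j$ is $c_{-(i+j)} - R^{i+j} d_{i+j}$. The first term vanishes unless $i + j \le k$ and the
  second unless $i + j \ge -k$. In both cases \<open>monomial_norm_weight\<close> bounds it by a constant times
  $u_i u_j$, where $u_i$ is the norm of $z^i$ times $R^{|i|/2}$. The coefficient of $z^i$ in $f$ times
  the norm of $z^i$ is at most $\|f\|$, so the terms with $|i| > L$ add up to a small multiple of
  $\|f\| \|g\|$.
\<close>

lemma hankel_form_laurent_bound: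
  assumes \<phi>: "\<phi> \<in> borel_measurable \<nu>" "AE z in \<nu>. norm (\<phi> z) \<le> M" "0 \<le> M"
    and c: "\<And>n. n < - k \<Longrightarrow> fourier_coeff \<phi> n = 0"
    and d: "\<And>n. n < - k \<Longrightarrow> fourier_coeff (\<lambda>z. \<phi> (of_real R / z)) n = 0"
    and \<delta>: "\<delta> > 0"
  shows "\<exists>C L. C \<ge> 0 \<and> (\<forall>f\<in>laurent UNIV. \<forall>g\<in>laurent UNIV. norm (hankel_form \<phi> f g) \<le>
    (C * (\<Sum>i\<in>{- L..L}. norm (L2_inner \<nu> f (\<lambda>z. z powi i))) + \<delta> * L2_norm \<nu> f) * L2_norm \<nu> g)"
proof -
  define \<rho> where "\<rho> = sqrt R"
  have \<rho>: "0 < \<rho>" "\<rho> < 1" "\<rho>\<^sup>2 = R" unfolding \<rho>_def using R0 R1 by auto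
  define u where "u i = monomial_norm i * \<rho> ^ nat \<bar>i\<bar>" for i
  have u: "\<rho> powi i \<le> u i" "0 \<le> u i" for i
    using monomial_norm_weight[of i] \<rho> by (auto simp: u_def \<rho>_def)
  have uu: "\<rho> powi (i + j) \<le> u i * u j" for i j
    using mult_mono[OF u(1)[of i] u(1)[of j]] u(2)[of i] \<rho> by (simp add: power_int_add)
  define K where "K = 2 * M * \<rho> powi (- k)"
  have K0: "0 \<le> K" unfolding K_def using \<phi>(3) \<rho> by simp
  have cL: "\<phi> \<in> L2 \<T>" "(\<lambda>z. \<phi> (of_real R / z)) \<in> L2 \<T>"
    using L2_\<nu>D[OF L2_bounded[OF finite_measure_\<nu> \<phi>(1,2)]] by auto
  have sm: "norm (fourier_coeff w n) \<le> M" if "w \<in> L2 \<T>" "AE z in \<T>. norm (w z) \<le> M" for w n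
  proof -
    have "norm (\<integral>z. w z * 1 * z powi (- n) \<partial>\<T>) \<le> M * L2_norm \<T> (\<lambda>z. 1) * L2_norm \<T> (\<lambda>z. z powi (- n))"
      by (rule L2_bounded_form_le[OF L2_measurable[OF that(1)] that(2) \<phi>(3) _ powi_L2]) (simp add: L2_def)
    also have "L2_norm \<T> (\<lambda>z. 1) = 1" using L2_norm_powi_circle[of 0] by simp
    finally show ?thesis by (simp add: fourier_coeff_powi_integral)
  qed
  have cb: "norm (fourier_coeff \<phi> n) \<le> M" "norm (fourier_coeff (\<lambda>z. \<phi> (of_real R / z)) n) \<le> M" for n
    using sm[OF cL(1)] sm[OF cL(2)] AE_\<nu>D[OF \<phi>(2)] by auto
  have entry: "norm (hankel_form \<phi> (\<lambda>z. z powi i) (\<lambda>z. z powi j)) \<le> K * (u i * u j)" for i j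
  proof -
    define W where "W = \<rho> powi (- k) * (u i * u j)"
    have W0: "0 \<le> W" unfolding W_def using u \<rho> by simp
    have mono: "\<rho> powi b \<le> \<rho> powi a" if "a \<le> b" for a b :: int
      using \<rho> that by (intro power_int_decreasing) auto
    have W1: "\<rho> powi (- k) * \<rho> powi (i + j) \<le> W"
      unfolding W_def using uu \<rho> by (intro mult_left_mono) auto
    have "norm (fourier_coeff \<phi> (- (i + j))) \<le> M * W"
    proof (cases "i + j \<le> k")
      case True
      have "1 = \<rho> powi (- k) * \<rho> powi k" using \<rho> by (simp add: power_int_minus)
      also have "\<dots> \<le> \<rho> powi (- k) * \<rho> powi (i + j)" using mono[OF True] \<rho> by (intro mult_left_mono) auto
      finally have "1 \<le> W" using W1 by linarith
      then have "M * 1 \<le> M * W" using \<phi>(3) by (intro mult_left_mono)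
      then show ?thesis using cb(1)[of "- (i + j)"] by linarith
    next
      case False
      then show ?thesis using c[of "- (i + j)"] W0 \<phi>(3) by simp
    qed
    moreover have "norm (of_real (R powi (i + j)) * fourier_coeff (\<lambda>z. \<phi> (of_real R / z)) (i + j)) \<le> M * W"
    proof (cases "- k \<le> i + j")
      case True
      have "R powi (i + j) = (\<rho> * \<rho>) powi (i + j)"
        using \<rho>(3) by (simp only: power2_eq_square)
      also have "\<dots> = \<rho> powi (i + j) * \<rho> powi (i + j)" by (rule power_int_mult_distrib)
      also have "\<dots> \<le> \<rho> powi (- k) * \<rho> powi (i + j)" using mono[OF True] \<rho> by (intro mult_right_mono) auto
      also have "\<dots> \<le> W" by (rule W1)
      finally have "R powi (i + j) * norm (fourier_coeff (\<lambda>z. \<phi> (of_real R / z)) (i + j)) \<le> W * M"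
        using cb(2) W0 R0 by (intro mult_mono) auto
      then show ?thesis unfolding norm_mult norm_of_real using R0 by (simp add: mult.commute)
    next
      case False
      then show ?thesis using d[of "i + j"] W0 \<phi>(3) by simp
    qed
    ultimately show ?thesis
      unfolding hankel_form_powi[OF \<phi>] K_def W_def
      using norm_triangle_ineq4[of "fourier_coeff \<phi> (- (i + j))" "of_real (R powi (i + j)) * fourier_coeff (\<lambda>z. \<phi> (of_real R / z)) (i + j)"]
      by (simp add: mult_ac)
  qed
  define S where "S = 2 / (1 - \<rho>)"
  have S0: "0 < S" unfolding S_def using \<rho> by simp
  have "(\<lambda>n. (K * S * S) * \<rho> ^ n) \<longlonglongrightarrow> 0"
    using \<rho> by (intro tendsto_mult_right_zero LIMSEQ_realpow_zero) auto
  then have "\<forall>\<^sub>F n in sequentially. (K * S * S) * \<rho> ^ n < \<delta>" using \<delta> by (rule order_tendstoD(2))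
  then obtain L where L: "(K * S * S) * \<rho> ^ L < \<delta>" by (auto simp: eventually_sequentially)
  have main: "norm (hankel_form \<phi> f g) \<le>
    (K * S * (\<Sum>i\<in>{- int L..int L}. norm (L2_inner \<nu> f (\<lambda>z. z powi i))) + \<delta> * L2_norm \<nu> f) * L2_norm \<nu> g"
    if f: "f \<in> laurent UNIV" and g: "g \<in> laurent UNIV" for f g
  proof -
    obtain F a where F: "finite F" "f = (\<lambda>z. \<Sum>i\<in>F. a i * z powi i)" using laurent_sum_form[OF f] by blast
    obtain G b where G: "finite G" "g = (\<lambda>z. \<Sum>i\<in>G. b i * z powi i)" using laurent_sum_form[OF g] by blast
    note fL = laurent_L2_\<nu>[OF f] and gL = laurent_L2_\<nu>[OF g]
    have int: "integrable \<nu> (\<lambda>z. (sg z * \<phi> z) * z powi i * z powi j)" for i j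
      by (rule hankel_form_le(2)[OF \<phi> powi_L2_\<nu> powi_L2_\<nu>])
    have "hankel_form \<phi> f g = (\<integral>z. (\<Sum>i\<in>F. \<Sum>j\<in>G. (a i * b j) * ((sg z * \<phi> z) * z powi i * z powi j)) \<partial>\<nu>)"
      unfolding hankel_form_def F(2) G(2)
    proof (rule Bochner_Integration.integral_cong)
      fix z
      have "sg z * \<phi> z * (\<Sum>i\<in>F. a i * z powi i) * (\<Sum>j\<in>G. b j * z powi j)
         = sg z * \<phi> z * (\<Sum>i\<in>F. \<Sum>j\<in>G. (a i * z powi i) * (b j * z powi j))"
        by (simp only: sum_product mult.assoc)
      also have "\<dots> = (\<Sum>i\<in>F. \<Sum>j\<in>G. (a i * b j) * ((sg z * \<phi> z) * z powi i * z powi j))"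
        by (simp only: sum_distrib_left mult_ac)
      finally show "sg z * \<phi> z * (\<Sum>i\<in>F. a i * z powi i) * (\<Sum>j\<in>G. b j * z powi j)
         = (\<Sum>i\<in>F. \<Sum>j\<in>G. (a i * b j) * ((sg z * \<phi> z) * z powi i * z powi j))" .
    qed simp
    also have "\<dots> = (\<Sum>i\<in>F. \<Sum>j\<in>G. (a i * b j) * hankel_form \<phi> (\<lambda>z. z powi i) (\<lambda>z. z powi j))"
      unfolding hankel_form_def using int
      by (simp add: Bochner_Integration.integral_sum)
    finally have "norm (hankel_form \<phi> f g) \<le> (\<Sum>i\<in>F. norm (\<Sum>j\<in>G. (a i * b j) * hankel_form \<phi> (\<lambda>z. z powi i) (\<lambda>z. z powi j)))"
      by (simp add: norm_sum)
    also have "\<dots> \<le> (\<Sum>i\<in>F. \<Sum>j\<in>G. K * ((norm (a i) * u i) * (norm (b j) * u j)))"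
    proof (intro sum_mono order_trans[OF norm_sum])
      fix i j
      show "norm (a i * b j * hankel_form \<phi> (\<lambda>z. z powi i) (\<lambda>z. z powi j)) \<le> K * ((norm (a i) * u i) * (norm (b j) * u j))"
        using mult_left_mono[OF entry[of i j], of "norm (a i) * norm (b j)"] by (simp add: norm_mult mult_ac)
    qed
    also have "\<dots> = K * ((\<Sum>i\<in>F. norm (a i) * u i) * (\<Sum>j\<in>G. norm (b j) * u j))"
      unfolding sum_product by (simp only: sum_distrib_left)
    finally have 1: "norm (hankel_form \<phi> f g) \<le> K * ((\<Sum>i\<in>F. norm (a i) * u i) * (\<Sum>j\<in>G. norm (b j) * u j))" .
    have coef: "norm (e i) * monomial_norm i \<le> norm (L2_inner \<nu> h (\<lambda>z. z powi i))" "norm (e i) * monomial_norm i \<le> L2_norm \<nu> h"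
      if h: "h \<in> L2 \<nu>" "finite E" "h = (\<lambda>z. \<Sum>i\<in>E. e i * z powi i)" "i \<in> E" for h E e i
    proof -
      have eq: "norm (L2_inner \<nu> h (\<lambda>z. z powi i)) = (norm (e i) * monomial_norm i) * monomial_norm i"
        unfolding h(3) laurent_sum_inner[OF h(2,4)] norm_mult norm_of_real by (simp add: power2_eq_square)
      have "(norm (e i) * monomial_norm i) * 1 \<le> (norm (e i) * monomial_norm i) * monomial_norm i"
        using monomial_norm_ge(1)[of i] by (intro mult_left_mono) auto
      then show "norm (e i) * monomial_norm i \<le> norm (L2_inner \<nu> h (\<lambda>z. z powi i))" unfolding eq by simp
      have "(norm (e i) * monomial_norm i) * monomial_norm i \<le> L2_norm \<nu> h * monomial_norm i"
        unfolding eq[symmetric] by (rule L2_Cauchy_Schwarz[OF h(1) powi_L2_\<nu>])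
      then show "norm (e i) * monomial_norm i \<le> L2_norm \<nu> h" using monomial_norm_ge(1)[of i] by simp
    qed
    have 2: "(\<Sum>j\<in>G. norm (b j) * u j) \<le> L2_norm \<nu> g * S"
    proof -
      have "(\<Sum>j\<in>G. norm (b j) * u j) \<le> (\<Sum>j\<in>G. L2_norm \<nu> g * \<rho> ^ nat \<bar>j\<bar>)"
        unfolding u_def mult.assoc[symmetric] using \<rho> by (intro sum_mono mult_right_mono coef(2)[OF gL G]) auto
      also have "\<dots> = L2_norm \<nu> g * (\<Sum>j\<in>G. \<rho> ^ nat \<bar>j\<bar>)" by (simp add: sum_distrib_left)
      also have "\<dots> \<le> L2_norm \<nu> g * S"
        using sum_power_tail[of \<rho> G 0] \<rho> G(1) by (intro mult_left_mono) (auto simp: S_def)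
      finally show ?thesis .
    qed
    let ?T = "\<Sum>i\<in>{- int L..int L}. norm (L2_inner \<nu> f (\<lambda>z. z powi i))"
    have 3: "(\<Sum>i\<in>F. norm (a i) * u i) \<le> ?T + L2_norm \<nu> f * (S * \<rho> ^ L)"
    proof -
      let ?F1 = "F \<inter> {- int L..int L}" and ?F2 = "F - {- int L..int L}"
      have "(\<Sum>i\<in>F. norm (a i) * u i) = (\<Sum>i\<in>?F1. norm (a i) * u i) + (\<Sum>i\<in>?F2. norm (a i) * u i)"
        by (rule sum.Int_Diff[OF F(1)])
      also have "(\<Sum>i\<in>?F1. norm (a i) * u i) \<le> (\<Sum>i\<in>?F1. norm (L2_inner \<nu> f (\<lambda>z. z powi i)))"
      proof (rule sum_mono)
        fix i assume "i \<in> ?F1"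
        then have i: "i \<in> F" by simp
        have "\<rho> ^ nat \<bar>i\<bar> \<le> 1" using \<rho> by (intro power_le_one) auto
        then have "(norm (a i) * monomial_norm i) * \<rho> ^ nat \<bar>i\<bar> \<le> norm (a i) * monomial_norm i"
          by (intro mult_left_le) auto
        with coef(1)[OF fL F i] show "norm (a i) * u i \<le> norm (L2_inner \<nu> f (\<lambda>z. z powi i))"
          by (simp add: u_def mult.assoc)
      qed
      also have "\<dots> \<le> ?T" by (rule sum_mono2) auto
      also have "(\<Sum>i\<in>?F2. norm (a i) * u i) \<le> (\<Sum>i\<in>?F2. L2_norm \<nu> f * \<rho> ^ nat \<bar>i\<bar>)"
        unfolding u_def mult.assoc[symmetric] using \<rho> by (intro sum_mono mult_right_mono coef(2)[OF fL F]) auto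
      also have "\<dots> = L2_norm \<nu> f * (\<Sum>i\<in>?F2. \<rho> ^ nat \<bar>i\<bar>)" by (simp add: sum_distrib_left)
      also have "\<dots> \<le> L2_norm \<nu> f * (S * \<rho> ^ L)"
      proof (rule mult_left_mono)
        have "(\<Sum>i\<in>?F2. \<rho> ^ nat \<bar>i\<bar>) \<le> 2 * \<rho> ^ L / (1 - \<rho>)"
        proof (rule sum_power_tail)
          show "int L \<le> \<bar>i\<bar>" if "i \<in> ?F2" for i using that by auto
        qed (use \<rho> F(1) in auto)
        then show "(\<Sum>i\<in>?F2. \<rho> ^ nat \<bar>i\<bar>) \<le> S * \<rho> ^ L" by (simp add: S_def)
      qed simp
      finally show ?thesis by simp
    qed
    have T0: "0 \<le> ?T" by (rule sum_nonneg) simp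
    have "K * ((\<Sum>i\<in>F. norm (a i) * u i) * (\<Sum>j\<in>G. norm (b j) * u j))
       \<le> K * ((?T + L2_norm \<nu> f * (S * \<rho> ^ L)) * (L2_norm \<nu> g * S))"
      using K0 u(2) T0 S0 \<rho> by (intro mult_left_mono mult_mono 2 3) (auto intro!: sum_nonneg mult_nonneg_nonneg add_nonneg_nonneg)
    also have "\<dots> = (K * S * ?T + (K * S * S) * \<rho> ^ L * L2_norm \<nu> f) * L2_norm \<nu> g"
      by (simp add: algebra_simps)
    also have "\<dots> \<le> (K * S * ?T + \<delta> * L2_norm \<nu> f) * L2_norm \<nu> g"
      using L by (intro mult_right_mono add_left_mono) auto
    finally show ?thesis using 1 by linarith
  qed
  have "0 \<le> K * S" using K0 S0 by simp
  with main show ?thesis by (intro exI[of _ "K * S"] exI[of _ "int L"]) blast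
qed

lemma hankel_form_H2_bound:
  assumes \<phi>: "\<phi> \<in> borel_measurable \<nu>" "AE z in \<nu>. norm (\<phi> z) \<le> M" "0 \<le> M"
    and bd: "\<And>f g. f \<in> laurent UNIV \<Longrightarrow> g \<in> laurent UNIV \<Longrightarrow> norm (hankel_form \<phi> f g) \<le>
      (C * (\<Sum>i\<in>{- L..L}. norm (L2_inner \<nu> f (\<lambda>z. z powi i))) + \<delta> * L2_norm \<nu> f) * L2_norm \<nu> g"
    and f: "f \<in> H2 R" and g: "g \<in> H2 R"
  shows "norm (hankel_form \<phi> f g) \<le>
      (C * (\<Sum>i\<in>{- L..L}. norm (L2_inner \<nu> f (\<lambda>z. z powi i))) + \<delta> * L2_norm \<nu> f) * L2_norm \<nu> g"
proof -
  obtain p where p: "\<And>n. p n \<in> laurent UNIV" "(\<lambda>n. L2_norm \<nu> (\<lambda>z. p n z - f z)) \<longlonglongrightarrow> 0"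
    using f L2_closure_approx unfolding H2_eq by blast
  obtain q where q: "\<And>n. q n \<in> laurent UNIV" "(\<lambda>n. L2_norm \<nu> (\<lambda>z. q n z - g z)) \<longlonglongrightarrow> 0"
    using g L2_closure_approx unfolding H2_eq by blast
  note pL = laurent_L2_\<nu>[OF p(1)] and qL = laurent_L2_\<nu>[OF q(1)] and fL = H2_L2[OF f] and gL = H2_L2[OF g]
  have m: "(\<lambda>z. sg z * \<phi> z) \<in> borel_measurable \<nu>" using \<phi>(1) borel_imp_\<nu>[OF sg_borel] by measurable
  have b: "AE z in \<nu>. norm (sg z * \<phi> z) \<le> M" using \<phi>(2) by (simp add: norm_mult)
  have "(\<lambda>n. norm (hankel_form \<phi> (p n) (q n))) \<longlonglongrightarrow> norm (hankel_form \<phi> f g)"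
    unfolding hankel_form_def by (intro tendsto_norm L2_bilinear_tendsto[OF m b \<phi>(3) pL qL fL gL p(2) q(2)])
  moreover have "(\<lambda>n. (C * (\<Sum>i\<in>{- L..L}. norm (L2_inner \<nu> (p n) (\<lambda>z. z powi i))) + \<delta> * L2_norm \<nu> (p n)) * L2_norm \<nu> (q n))
     \<longlonglongrightarrow> (C * (\<Sum>i\<in>{- L..L}. norm (L2_inner \<nu> f (\<lambda>z. z powi i))) + \<delta> * L2_norm \<nu> f) * L2_norm \<nu> g"
    by (intro tendsto_intros L2_norm_tendsto[OF pL fL p(2)] L2_norm_tendsto[OF qL gL q(2)]
        L2_inner_tendsto_left[OF pL fL powi_L2_\<nu> p(2)])
  ultimately show ?thesis by (rule LIMSEQ_le) (use bd p(1) q(1) in auto)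
qed

end

lemma Hinfty_plus_C_approx:
  assumes h: "h \<in> Hinfty_plus_C" and e: "e > 0"
  shows "\<exists>u\<in>borel_measurable \<T>. \<exists>M k. (AE z in \<T>. norm (u z) \<le> M) \<and> (AE z in \<T>. norm (h z - u z) \<le> e) \<and>
    (\<forall>n. n < - k \<longrightarrow> fourier_coeff u n = 0)"
proof -
  obtain f g where f: "f \<in> Hinfty" and g: "continuous_on (sphere 0 1) g" and hfg: "AE z in \<T>. h z = f z + g z"
    using h unfolding Hinfty_plus_C_def by blast
  obtain B where B: "f \<in> borel_measurable \<T>" "AE z in \<T>. norm (f z) \<le> B" and f0: "\<And>n. n < 0 \<Longrightarrow> fourier_coeff f n = 0"
    using f by (auto simp: Hinfty_def Linfty_def)
  obtain t where t: "t \<in> laurent UNIV" "\<And>z. z \<in> sphere 0 1 \<Longrightarrow> norm (g z - t z) < e"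
    using circle_approx_laurent[OF g e] by blast
  obtain F a where F: "finite F" "t = (\<lambda>z. \<Sum>i\<in>F. a i * z powi i)" using laurent_sum_form[OF t(1)] by blast
  have tF: "t \<in> laurent F" unfolding F(2) by (intro laurent_sum laurent_term)
  obtain b where b: "\<forall>z\<in>sphere 0 1. norm (t z) \<le> b" using laurent_bounded[OF t(1), of 1] by auto
  obtain k where k: "\<And>i. i \<in> F \<Longrightarrow> \<bar>i\<bar> \<le> k" "0 \<le> k"
    using F(1) by (metis Max_ge abs_ge_zero finite_imageI finite_insert imageI insertI1 insertI2)
  have tm: "t \<in> borel_measurable \<T>" by (rule L2_measurable[OF laurent_L2[OF t(1)]])
  have fL: "f \<in> L2 \<T>" by (rule L2_bounded[OF finite_measure_circle B])
  show ?thesis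
  proof (intro bexI[of _ "\<lambda>z. f z + t z"] exI[of _ "B + b"] exI[of _ k] conjI allI impI)
    show "(\<lambda>z. f z + t z) \<in> borel_measurable \<T>" using B(1) tm by measurable
    show "AE z in \<T>. norm (f z + t z) \<le> B + b"
      using B(2) AE_space
    proof eventually_elim
      case (elim z)
      have "norm (t z) \<le> b" using elim b by simp
      then show ?case using elim norm_triangle_ineq[of "f z" "t z"] by linarith
    qed
    show "AE z in \<T>. norm (h z - (f z + t z)) \<le> e"
      using hfg AE_space
    proof eventually_elim
      case (elim z)
      then show ?case using t(2)[of z] by simp
    qed
    fix n assume n: "n < - k"
    then have "n \<notin> F" "n < 0" using k by force+
    then show "fourier_coeff (\<lambda>z. f z + t z) n = 0"
      by (simp add: fourier_coeff_add[OF fL laurent_L2[OF t(1)]] f0 fourier_coeff_laurent[OF tF])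
  qed
qed

context annulus_radius
begin

lemma symbol_approx:
  assumes \<phi>: "\<phi> \<in> borel_measurable \<nu>" and C: "symbol_C \<phi> \<in> Hinfty_plus_C" and C0: "symbol_C0 R \<phi> \<in> Hinfty_plus_C"
    and e: "e > 0"
  shows "\<exists>\<phi>'\<in>borel_measurable \<nu>. \<exists>M k. 0 \<le> M \<and> (AE z in \<nu>. norm (\<phi>' z) \<le> M) \<and> (AE z in \<nu>. norm (\<phi> z - \<phi>' z) \<le> e) \<and>
    (\<forall>n. n < - k \<longrightarrow> fourier_coeff \<phi>' n = 0) \<and> (\<forall>n. n < - k \<longrightarrow> fourier_coeff (\<lambda>z. \<phi>' (of_real R / z)) n = 0)"
proof -
  obtain u M k where u: "u \<in> borel_measurable \<T>" "AE z in \<T>. norm (u z) \<le> M" "AE z in \<T>. norm (symbol_C \<phi> z - u z) \<le> e"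
    "\<And>n. n < - k \<Longrightarrow> fourier_coeff u n = 0" using Hinfty_plus_C_approx[OF C e] by blast
  obtain v M' k' where v: "v \<in> borel_measurable \<T>" "AE z in \<T>. norm (v z) \<le> M'" "AE z in \<T>. norm (symbol_C0 R \<phi> z - v z) \<le> e"
    "\<And>n. n < - k' \<Longrightarrow> fourier_coeff v n = 0" using Hinfty_plus_C_approx[OF C0 e] by blast
  have ext: "(\<lambda>z. indicator (sphere 0 1) z *\<^sub>R w z) \<in> borel_measurable borel" if "w \<in> borel_measurable \<T>" for w :: "complex \<Rightarrow> complex"
    using that by (simp add: measurable_cong_sets[OF sets_circle refl] borel_measurable_restrict_space_iff)
  \<comment> \<open>on each circle exactly one of the two indicators is nonzero\<close>
  define \<phi>' where "\<phi>' z = indicator (sphere 0 1) z *\<^sub>R u z + indicator (sphere 0 1) (of_real R / z) *\<^sub>R v (of_real R / z)" for z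
  have "(\<lambda>z. indicator (sphere 0 1) (of_real R / z) *\<^sub>R v (of_real R / z)) \<in> borel_measurable borel"
    by (rule measurable_compose[OF _ ext[OF v(1)]]) measurable
  then have m: "\<phi>' \<in> borel_measurable \<nu>"
    unfolding \<phi>'_def using ext[OF u(1)] by (intro borel_imp_\<nu> borel_measurable_add)
  have C': "\<phi>' z = u z" "\<phi>' (of_real R / z) = v z" if "norm z = 1" for z
    using that R0 R1 by (auto simp: \<phi>'_def norm_divide indicator_def)
  have [measurable]: "\<phi>' \<in> borel_measurable \<nu>" "\<phi> \<in> borel_measurable \<nu>" by fact+
  have fc: "fourier_coeff \<phi>' n = fourier_coeff u n" "fourier_coeff (\<lambda>z. \<phi>' (of_real R / z)) n = fourier_coeff v n" for n
    unfolding fourier_coeff_def by (rule circle_integral_cong, simp add: C')+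
  have "AE z in \<nu>. norm (\<phi>' z) \<le> max 0 (max M M')"
  proof (rule AE_\<nu>I)
    show "Measurable.pred \<nu> (\<lambda>z. norm (\<phi>' z) \<le> max 0 (max M M'))" by measurable
    show "AE z in \<T>. norm (\<phi>' z) \<le> max 0 (max M M')" using u(2) AE_space by eventually_elim (auto simp: C')
    show "AE z in \<T>. norm (\<phi>' (of_real R / z)) \<le> max 0 (max M M')" using v(2) AE_space by eventually_elim (auto simp: C')
  qed
  moreover have "AE z in \<nu>. norm (\<phi> z - \<phi>' z) \<le> e"
  proof (rule AE_\<nu>I)
    show "Measurable.pred \<nu> (\<lambda>z. norm (\<phi> z - \<phi>' z) \<le> e)" by measurable
    show "AE z in \<T>. norm (\<phi> z - \<phi>' z) \<le> e"
      using u(3) AE_space by eventually_elim (auto simp: C' symbol_C_def)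
    show "AE z in \<T>. norm (\<phi> (of_real R / z) - \<phi>' (of_real R / z)) \<le> e"
      using v(3) AE_space by eventually_elim (auto simp: C' symbol_C0_def)
  qed
  moreover have "\<forall>n. n < - max k k' \<longrightarrow> fourier_coeff \<phi>' n = 0 \<and> fourier_coeff (\<lambda>z. \<phi>' (of_real R / z)) n = 0"
    using u(4) v(4) by (simp add: fc)
  ultimately show ?thesis using m by (intro bexI[of _ \<phi>'] exI[of _ "max 0 (max M M')"] exI[of _ "max k k'"]) auto
qed

text \<open>
  For $x = H_\phi f$ one has $\|x\|^2 = B(f, s\,\overline{x})$, and $s\,\overline{x}$ lies in the
  Hardy space and has the norm of $x$. The symbol is then replaced by an approximation with finitely
  many negative frequencies.
\<close>

lemma hankel_bound:
  assumes \<phi>: "\<phi> \<in> borel_measurable \<nu>" "AE z in \<nu>. norm (\<phi> z) \<le> B" "0 \<le> B"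
    and C: "symbol_C \<phi> \<in> Hinfty_plus_C" and C0: "symbol_C0 R \<phi> \<in> Hinfty_plus_C" and \<delta>: "\<delta> > 0"
  shows "\<exists>K L. K \<ge> 0 \<and> (\<forall>f\<in>H2 R. \<forall>p\<in>H2 R. (\<lambda>z. \<phi> z * f z - p z) \<in> H2_perp R \<longrightarrow>
    L2_norm \<nu> (\<lambda>z. \<phi> z * f z - p z) \<le> K * (\<Sum>i\<in>{- L..L}. norm (L2_inner \<nu> f (\<lambda>z. z powi i))) + \<delta> * L2_norm \<nu> f)"
proof -
  have d2: "\<delta> / 2 > 0" using \<delta> by simp
  obtain \<phi>' M k where \<phi>': "\<phi>' \<in> borel_measurable \<nu>" "AE z in \<nu>. norm (\<phi>' z) \<le> M" "0 \<le> M"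
    and ap: "AE z in \<nu>. norm (\<phi> z - \<phi>' z) \<le> \<delta> / 2"
    and co: "\<And>n. n < - k \<Longrightarrow> fourier_coeff \<phi>' n = 0" "\<And>n. n < - k \<Longrightarrow> fourier_coeff (\<lambda>z. \<phi>' (of_real R / z)) n = 0"
    using symbol_approx[OF \<phi>(1) C C0 d2] by blast
  obtain K L where K: "K \<ge> 0" and KL: "\<And>f g. f \<in> laurent UNIV \<Longrightarrow> g \<in> laurent UNIV \<Longrightarrow> norm (hankel_form \<phi>' f g) \<le>
    (K * (\<Sum>i\<in>{- L..L}. norm (L2_inner \<nu> f (\<lambda>z. z powi i))) + \<delta> / 2 * L2_norm \<nu> f) * L2_norm \<nu> g"
    using hankel_form_laurent_bound[OF \<phi>' co d2] by blast
  have "L2_norm \<nu> x \<le> K * (\<Sum>i\<in>{- L..L}. norm (L2_inner \<nu> f (\<lambda>z. z powi i))) + \<delta> * L2_norm \<nu> f"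
    if f: "f \<in> H2 R" and p: "p \<in> H2 R" and x: "x = (\<lambda>z. \<phi> z * f z - p z)" "x \<in> H2_perp R" for f p x
  proof -
    note fL = H2_L2[OF f] and xL = H2_perp_L2[OF x(2)]
    let ?g = "\<lambda>z. sg z * cnj (x z)" and ?T = "\<Sum>i\<in>{- L..L}. norm (L2_inner \<nu> f (\<lambda>z. z powi i))"
    have g: "?g \<in> H2 R" by (rule sg_cnj_perp_H2[OF x(2)])
    note gL = H2_L2[OF g]
    have gn: "L2_norm \<nu> ?g = L2_norm \<nu> x" by (rule L2_norm_sg_cnj)
    have dm: "(\<lambda>z. \<phi> z - \<phi>' z) \<in> borel_measurable \<nu>" using \<phi>(1) \<phi>'(1) by measurable
    have "of_real ((L2_norm \<nu> x)\<^sup>2) = hankel_form \<phi> f ?g"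
      unfolding L2_inner_self[symmetric]
      by (rule perp_inner_hankel_form[OF x(1) L2_mult_bounded[OF fL \<phi>(1,2)] p x(2)])
    also have "\<dots> = hankel_form \<phi>' f ?g + hankel_form (\<lambda>z. \<phi> z - \<phi>' z) f ?g"
      unfolding hankel_form_def
      by (subst Bochner_Integration.integral_add[symmetric])
         (use hankel_form_le(2)[OF \<phi>' fL gL] hankel_form_le(2)[OF dm ap less_imp_le[OF d2] fL gL] in \<open>simp_all add: algebra_simps\<close>)
    finally have "(L2_norm \<nu> x)\<^sup>2 = norm (hankel_form \<phi>' f ?g + hankel_form (\<lambda>z. \<phi> z - \<phi>' z) f ?g)"
      by (metis norm_of_real abs_of_nonneg zero_le_power2)
    also have "\<dots> \<le> norm (hankel_form \<phi>' f ?g) + norm (hankel_form (\<lambda>z. \<phi> z - \<phi>' z) f ?g)"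
      by (rule norm_triangle_ineq)
    also have "\<dots> \<le> (K * ?T + \<delta> / 2 * L2_norm \<nu> f) * L2_norm \<nu> x + \<delta> / 2 * L2_norm \<nu> f * L2_norm \<nu> x"
      using hankel_form_H2_bound[OF \<phi>' KL f g] hankel_form_le(1)[OF dm ap less_imp_le[OF d2] fL gL]
      unfolding gn by (rule add_mono)
    also have "\<dots> = (K * ?T + \<delta> * L2_norm \<nu> f) * L2_norm \<nu> x" by (simp add: algebra_simps)
    finally have *: "L2_norm \<nu> x * L2_norm \<nu> x \<le> (K * ?T + \<delta> * L2_norm \<nu> f) * L2_norm \<nu> x"
      by (simp add: power2_eq_square)
    have nn: "0 \<le> K * ?T + \<delta> * L2_norm \<nu> f" using K \<delta> by (intro add_nonneg_nonneg mult_nonneg_nonneg sum_nonneg) auto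
    show ?thesis
    proof (cases "L2_norm \<nu> x = 0")
      case False
      then have "L2_norm \<nu> x > 0" by (simp add: less_le)
      with * show ?thesis by (rule mult_right_le_imp_le)
    qed (use nn in simp)
  qed
  then show ?thesis using K by blast
qed

text \<open>
  Choose a subsequence along which the inner products with all monomials converge. By \<open>hankel_bound\<close> the
  images form a Cauchy sequence.
\<close>

lemma Hinfty_plus_C_imp_compact:
  assumes \<phi>: "\<phi> \<in> borel_measurable \<nu>" "AE z in \<nu>. norm (\<phi> z) \<le> B" "0 \<le> B"
    and C: "symbol_C \<phi> \<in> Hinfty_plus_C" and C0: "symbol_C0 R \<phi> \<in> Hinfty_plus_C"
  shows "compact_operator \<nu> (H2 R) (H2_perp R) (hankel R \<phi>)"
  unfolding compact_operator_def
proof (intro conjI ballI allI impI)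
  have hp: "hankel R \<phi> f \<in> H2_perp R" "\<exists>p\<in>H2 R. hankel R \<phi> f = (\<lambda>z. \<phi> z * f z - p z)" if "f \<in> H2 R" for f
    using hankel_props[OF L2_mult_bounded[OF H2_L2[OF that] \<phi>(1,2)]] by auto
  then show "hankel R \<phi> f \<in> H2_perp R" if "f \<in> H2 R" for f using that by blast
  fix F :: "nat \<Rightarrow> complex \<Rightarrow> complex" assume "(\<forall>n. F n \<in> H2 R) \<and> (\<exists>B. \<forall>n. L2_norm \<nu> (F n) \<le> B)"
  then obtain b where F: "\<And>n. F n \<in> H2 R" and b: "\<And>n. L2_norm \<nu> (F n) \<le> b" by blast
  note FL = H2_L2[OF F]
  have b0: "0 \<le> b" using b[of 0] L2_norm_nonneg order_trans by blast
  have "norm (L2_inner \<nu> (F n) (\<lambda>z. z powi i) / of_real (monomial_norm i)) \<le> b" for n i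
  proof -
    have "norm (L2_inner \<nu> (F n) (\<lambda>z. z powi i)) \<le> b * monomial_norm i"
      using L2_Cauchy_Schwarz[OF FL powi_L2_\<nu>, of n i] mult_right_mono[OF b[of n], of "monomial_norm i"] by simp
    moreover have "monomial_norm i > 0" using monomial_norm_ge(1)[of i] by linarith
    ultimately show ?thesis by (simp add: norm_divide divide_le_eq)
  qed
  then obtain s where s: "strict_mono (s :: nat \<Rightarrow> nat)"
    and "\<And>i. i \<in> (UNIV :: int set) \<Longrightarrow> \<exists>l. (\<lambda>n. L2_inner \<nu> (F (s n)) (\<lambda>z. z powi i) / of_real (monomial_norm i)) \<longlonglongrightarrow> l"
    using function_convergent_subsequence[of "UNIV :: int set" "\<lambda>n i. L2_inner \<nu> (F n) (\<lambda>z. z powi i) / of_real (monomial_norm i)" b]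
    by (metis countableI_type)
  then have conv: "\<exists>l. (\<lambda>n. L2_inner \<nu> (F (s n)) (\<lambda>z. z powi i) / of_real (monomial_norm i)) \<longlonglongrightarrow> l" for i by blast
  have Cau: "Cauchy (\<lambda>n. L2_inner \<nu> (F (s n)) (\<lambda>z. z powi i))" for i
  proof -
    obtain l where "(\<lambda>n. L2_inner \<nu> (F (s n)) (\<lambda>z. z powi i) / of_real (monomial_norm i)) \<longlonglongrightarrow> l" using conv by blast
    then have "(\<lambda>n. L2_inner \<nu> (F (s n)) (\<lambda>z. z powi i) / of_real (monomial_norm i) * of_real (monomial_norm i)) \<longlonglongrightarrow> l * of_real (monomial_norm i)"
      by (intro tendsto_intros)
    moreover have "monomial_norm i \<noteq> 0" using monomial_norm_ge(1)[of i] by linarith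
    ultimately have "(\<lambda>n. L2_inner \<nu> (F (s n)) (\<lambda>z. z powi i)) \<longlonglongrightarrow> l * of_real (monomial_norm i)" by simp
    then show ?thesis by (rule LIMSEQ_imp_Cauchy)
  qed
  let ?H = "\<lambda>n. hankel R \<phi> (F (s n))"
  note HL = H2_perp_L2[OF hp(1)[OF F]]
  have "\<exists>g\<in>L2 \<nu>. (\<lambda>n. L2_norm \<nu> (\<lambda>x. ?H n x - g x)) \<longlonglongrightarrow> 0"
  proof (rule L2_complete[OF finite_measure_\<nu> HL])
    fix e :: real assume e: "e > 0"
    \<comment> \<open>differences of members of the sequence have norm at most \<open>2 * b\<close>; the summand \<open>1\<close> avoids division by zero\<close>
    define \<delta> where "\<delta> = e / 2 / (2 * b + 1)"
    have \<delta>: "\<delta> > 0" "\<delta> * (2 * b) < e / 2" using e b0 by (auto simp: \<delta>_def field_simps)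
    obtain K L where K: "K \<ge> 0" and KL: "\<And>f p. f \<in> H2 R \<Longrightarrow> p \<in> H2 R \<Longrightarrow> (\<lambda>z. \<phi> z * f z - p z) \<in> H2_perp R \<Longrightarrow>
       L2_norm \<nu> (\<lambda>z. \<phi> z * f z - p z) \<le> K * (\<Sum>i\<in>{- L..L}. norm (L2_inner \<nu> f (\<lambda>z. z powi i))) + \<delta> * L2_norm \<nu> f"
      using hankel_bound[OF \<phi> C C0 \<delta>(1)] by blast
    define c where "c = real (card {- L..L})"
    define r where "r = e / 2 / (K * c + 1)"
    have Kc: "0 \<le> K * c" using K by (simp add: c_def)
    have r: "r > 0" "K * (c * r) \<le> e / 2" unfolding r_def using e Kc by (auto simp: field_simps add_nonneg_pos)
    have "\<exists>N0. \<forall>m\<ge>N0. \<forall>n\<ge>N0. norm (L2_inner \<nu> (F (s m)) (\<lambda>z. z powi i) - L2_inner \<nu> (F (s n)) (\<lambda>z. z powi i)) < r" for i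
      using CauchyD[OF Cau r(1)] .
    then obtain N0 where N0: "\<And>i m n. m \<ge> N0 i \<Longrightarrow> n \<ge> N0 i \<Longrightarrow>
      norm (L2_inner \<nu> (F (s m)) (\<lambda>z. z powi i) - L2_inner \<nu> (F (s n)) (\<lambda>z. z powi i)) < r" by metis
    define N1 where "N1 = (\<Sum>i\<in>{- L..L}. N0 i)"
    have N1: "N0 i \<le> N1" if "i \<in> {- L..L}" for i unfolding N1_def by (rule member_le_sum[OF that]) auto
    have "L2_norm \<nu> (\<lambda>x. ?H m x - ?H n x) < e" if mn: "m \<ge> N1" "n \<ge> N1" for m n
    proof -
      obtain p q where p: "p \<in> H2 R" "?H m = (\<lambda>z. \<phi> z * F (s m) z - p z)" and q: "q \<in> H2 R" "?H n = (\<lambda>z. \<phi> z * F (s n) z - q z)"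
        using hp(2)[OF F] by metis
      have eq: "(\<lambda>x. ?H m x - ?H n x) = (\<lambda>z. \<phi> z * (F (s m) z - F (s n) z) - (p z - q z))"
        unfolding p(2) q(2) by (auto simp: algebra_simps)
      have "L2_norm \<nu> (\<lambda>x. ?H m x - ?H n x) \<le> K * (\<Sum>i\<in>{- L..L}. norm (L2_inner \<nu> (\<lambda>z. F (s m) z - F (s n) z) (\<lambda>z. z powi i)))
          + \<delta> * L2_norm \<nu> (\<lambda>z. F (s m) z - F (s n) z)"
        unfolding eq
      proof (rule KL)
        show "(\<lambda>z. \<phi> z * (F (s m) z - F (s n) z) - (p z - q z)) \<in> H2_perp R"
          unfolding eq[symmetric] by (intro L2_subspaceD(5)[OF H2_perp_subspace] hp F)
      qed (intro L2_subspaceD(5)[OF H2_subspace] F p q)+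
      also have "\<dots> \<le> K * (c * r) + \<delta> * (2 * b)"
      proof (intro add_mono mult_left_mono)
        have "(\<Sum>i\<in>{- L..L}. norm (L2_inner \<nu> (\<lambda>z. F (s m) z - F (s n) z) (\<lambda>z. z powi i))) \<le> (\<Sum>i\<in>{- L..L}. r)"
        proof (rule sum_mono)
          fix i assume i: "i \<in> {- L..L}"
          show "norm (L2_inner \<nu> (\<lambda>z. F (s m) z - F (s n) z) (\<lambda>z. z powi i)) \<le> r"
            using N0[of i m n] N1[OF i] mn by (simp add: L2_inner_diff_left[OF FL FL powi_L2_\<nu>])
        qed
        then show "(\<Sum>i\<in>{- L..L}. norm (L2_inner \<nu> (\<lambda>z. F (s m) z - F (s n) z) (\<lambda>z. z powi i))) \<le> c * r"
          by (simp add: c_def)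
        show "L2_norm \<nu> (\<lambda>z. F (s m) z - F (s n) z) \<le> 2 * b"
          using L2_norm_triangle_diff[OF FL[of "s m"] L2_zero FL[of "s n"]] b[of "s m"] b[of "s n"]
          by (simp add: L2_norm_def)
      qed (use K \<delta> in auto)
      finally have "L2_norm \<nu> (\<lambda>x. ?H m x - ?H n x) \<le> K * (c * r) + \<delta> * (2 * b)" .
      with r(2) \<delta>(2) show ?thesis by linarith
    qed
    then show "\<exists>N. \<forall>m\<ge>N. \<forall>n\<ge>N. L2_norm \<nu> (\<lambda>x. ?H m x - ?H n x) < e" by blast
  qed
  then obtain g where g: "g \<in> L2 \<nu>" and lim: "(\<lambda>n. L2_norm \<nu> (\<lambda>x. ?H n x - g x)) \<longlonglongrightarrow> 0" by blast
  have "g \<in> H2_perp R"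
    unfolding H2_perp_def L2_orth_def
  proof (safe intro!: g)
    fix f assume f: "f \<in> H2 R"
    have "(\<lambda>n. L2_inner \<nu> (?H n) f) \<longlonglongrightarrow> L2_inner \<nu> g f"
      by (rule L2_inner_tendsto_left[OF HL g H2_L2[OF f] lim])
    moreover have "L2_inner \<nu> (?H n) f = 0" for n by (rule H2_perp_inner(1)[OF hp(1)[OF F] f])
    ultimately show "L2_inner \<nu> g f = 0" by (simp add: LIMSEQ_const_iff)
  qed
  with s lim show "\<exists>g\<in>H2_perp R. \<exists>s. strict_mono s \<and> (\<lambda>n. L2_norm \<nu> (\<lambda>x. hankel R \<phi> (F (s n)) x - g x)) \<longlonglongrightarrow> 0"
    by blast
qed

end

theorem theorem2p11:
  fixes R :: real and \<phi> :: "complex \<Rightarrow> complex"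
  assumes "0 < R" and "R < 1" and "\<phi> \<in> Linfty (annulus_measure R)"
  shows "compact_operator (annulus_measure R) (H2 R) (H2_perp R) (hankel R \<phi>) \<longleftrightarrow>
         symbol_C \<phi> \<in> Hinfty_plus_C \<and> symbol_C0 R \<phi> \<in> Hinfty_plus_C"
proof -
  interpret annulus_radius R by unfold_locales fact+
  obtain B where B: "\<phi> \<in> borel_measurable \<nu>" "AE z in \<nu>. norm (\<phi> z) \<le> B" using assms(3) by (auto simp: Linfty_def)
  have B': "AE z in \<nu>. norm (\<phi> z) \<le> max 0 B" using B(2) by eventually_elim simp
  show ?thesis
  proof
    assume comp: "compact_operator \<nu> (H2 R) (H2_perp R) (hankel R \<phi>)"
    show "symbol_C \<phi> \<in> Hinfty_plus_C \<and> symbol_C0 R \<phi> \<in> Hinfty_plus_C"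
      using compact_imp_Hinfty_plus_C[OF comp assms(3), of "\<lambda>z. z"]
        compact_imp_Hinfty_plus_C[OF comp assms(3), of "\<lambda>z. of_real R / z"]
      by (simp add: symbol_C_def symbol_C0_def)
  next
    assume "symbol_C \<phi> \<in> Hinfty_plus_C \<and> symbol_C0 R \<phi> \<in> Hinfty_plus_C"
    then show "compact_operator \<nu> (H2 R) (H2_perp R) (hankel R \<phi>)"
      using Hinfty_plus_C_imp_compact[OF B(1) B'] by simp
  qed
qed

end
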